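(* For every $\theta\in(0,\infty)$ let $(Y^{(\theta)}(t))_{t\ge0}$ be a one-dimensional continuous state branching process with immigration on $\mathbb{R}_+$ with branching mechanism $$R^{(\theta)}(z):=-\beta^{(\theta)}z+\alpha^{(\theta)}z^2+\int_{(0,\infty)}(e^{-zu}-1+zu)\,p(\mathrm{d}u),\qquad z\in\mathbb{R}_+,$$ and with immigration mechanism $$F^{(\theta)}(z):=b^{(\theta)}z+\int_{(0,\infty)}(1-e^{-zu})\,n(\mathrm{d}u),\qquad z\in\mathbb{R}_+,$$ where $\alpha^{(\theta)}\ge0$, $b^{(\theta)}\ge0$, $\beta^{(\theta)}\in\mathbb{R}$, and $n$ and $p$ are measures on $(0,\infty)$ (not depending on $\theta$) such that $$\int_{(0,\infty)}u\,n(\mathrm{d}u)<\infty\qquad\text{and}\qquad\int_{(0,\infty)}u^2\,p(\mathrm{d}u)<\infty .$$ Let $\alpha,b,\beta\in\mathbb{R}$, and let $(Y(t))_{t\ge0}$ be a one-dimensional continuous state branching process with immigration on $\mathbb{R}_+$ with branching mechanism $$R(z):=-\beta z+\Big(\alpha+\frac12\int_{(0,\infty)}u^2\,p(\mathrm{d}u)\Big)z^2,\qquad z\in\mathbb{R}_+,$$ and with immigration mechanism $$F(z):=\Big(b+\int_{(0,\infty)}u\,n(\mathrm{d}u)\Big)z,\qquad z\in\mathbb{R}_+.$$ If, as $\theta\to\infty$, $\alpha^{(\theta)}\to\alpha$, $b^{(\theta)}\to b$, $\theta\beta^{(\theta)}\to\beta$ and $\theta^{-1}Y^{(\theta)}(0)$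 converges in distribution to $Y(0)$, then $$\left(\theta^{-1}Y^{(\theta)}(\theta t)\right)_{t\ge0}\longrightarrow(Y(t))_{t\ge0}$$ in distribution in $\mathbb{D}(\mathbb{R}_+,\mathbb{R}_+)$ as $\theta\to\infty$.
   Context: $\mathbb{R}_+=[0,\infty)$, and $\mathbb{D}(\mathbb{R}_+,\mathbb{R}_+)$ is the space of càdlàg functions from $\mathbb{R}_+$ to $\mathbb{R}_+$ with the Skorokhod topology. A continuous state branching process with immigration with branching mechanism $R$ and immigration mechanism $F$ is a càdlàg time-homogeneous Markov process $(Y(t))_{t\ge0}$ on $\mathbb{R}_+$ with $$\mathbb{E}\big(e^{-zY(t)}\mid Y(0)=x\big)=\exp\Big\{-x\,v_t(z)-\int_0^tF(v_s(z))\,\mathrm{d}s\Big\},\qquad x,z,t\in\mathbb{R}_+,$$ where $t\mapsto v_t(z)$ is the unique nonnegative solution of $\frac{\mathrm{d}}{\mathrm{d}t}v_t(z)=-R(v_t(z))$, $v_0(z)=z$. *)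

theory Defs
  imports "HOL-Probability.Probability"
begin

section \<open>The Skorokhod space of nonnegative cadlag functions on the half-line\<close>

definition cadlag :: "(real \<Rightarrow> real) \<Rightarrow> bool" where
  "cadlag x \<longleftrightarrow> (\<forall>t\<ge>0. continuous (at_right t) x) \<and>
     (\<forall>t>0. \<exists>l. (x \<longlongrightarrow> l) (at_left t))"

text \<open>Paths are functions on \<open>[0,\<infinity>)\<close>, so they are taken extensional: outside the half-line they carry
  no information.\<close>

definition skorokhod_space :: "(real \<Rightarrow> real) set" where
  "skorokhod_space = {x \<in> extensional {0..}. cadlag x \<and> (\<forall>t\<ge>0. 0 \<le> x t)}"

definition time_changes :: "(real \<Rightarrow> real) set" where
  "time_changes = {l. continuous_on {0..} l \<and> strict_mono_on {0..} l \<and> l ` {0..} = {0..}}"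

definition skorokhod_nbhd :: "(real \<Rightarrow> real) \<Rightarrow> real \<Rightarrow> real \<Rightarrow> (real \<Rightarrow> real) set" where
  "skorokhod_nbhd x T e = {y \<in> skorokhod_space. \<exists>l\<in>time_changes. \<exists>d<e.
     (\<forall>s\<ge>0. \<bar>l s - s\<bar> \<le> d) \<and> (\<forall>s\<in>{0..T}. \<bar>y (l s) - x s\<bar> \<le> d)}"

text \<open>The bound \<open>d < e\<close> says that both suprema are strictly below \<open>e\<close>; the sets \<open>skorokhod_nbhd\<close>
  are then open and form a neighbourhood base.  That this is Skorokhod's J1 topology on the
  half-line is confirmed by the description of its convergent sequences in
  \<open>limitin_skorokhod_sequentially\<close> below (the criterion of Billingsley and of Jacod and Shiryaev;
  it determines the topology, since every point has a countable neighbourhood base).\<close>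

definition skorokhod_topology :: "(real \<Rightarrow> real) topology" where
  "skorokhod_topology = topology (\<lambda>U. U \<subseteq> skorokhod_space \<and>
     (\<forall>x\<in>U. \<exists>T. \<exists>e>0. skorokhod_nbhd x T e \<subseteq> U))"

lemma skorokhod_nbhd_mono:
  assumes "T' \<le> T" "e \<le> e'"
  shows "skorokhod_nbhd x T e \<subseteq> skorokhod_nbhd x T' e'"
proof
  fix y assume "y \<in> skorokhod_nbhd x T e"
  then obtain l d where "y \<in> skorokhod_space" "l \<in> time_changes" "d < e"
    "\<forall>s\<ge>0. \<bar>l s - s\<bar> \<le> d" "\<forall>s\<in>{0..T}. \<bar>y (l s) - x s\<bar> \<le> d"
    unfolding skorokhod_nbhd_def by blast
  moreover from this assms have "d < e'" "\<forall>s\<in>{0..T'}. \<bar>y (l s) - x s\<bar> \<le> d" by auto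
  ultimately show "y \<in> skorokhod_nbhd x T' e'"
    unfolding skorokhod_nbhd_def by blast
qed

lemma openin_skorokhod:
  "openin skorokhod_topology U \<longleftrightarrow> U \<subseteq> skorokhod_space \<and>
     (\<forall>x\<in>U. \<exists>T. \<exists>e>0. skorokhod_nbhd x T e \<subseteq> U)"
proof -
  have "istopology (\<lambda>U. U \<subseteq> skorokhod_space \<and>
     (\<forall>x\<in>U. \<exists>T. \<exists>e>0. skorokhod_nbhd x T e \<subseteq> U))"
    unfolding istopology_def
  proof (intro conjI allI impI, goal_cases)
    case (2 A B)
    show ?case
    proof
      fix x assume x: "x \<in> A \<inter> B"
      obtain T e T' e' where *: "e > 0" "e' > 0" "skorokhod_nbhd x T e \<subseteq> A"
          "skorokhod_nbhd x T' e' \<subseteq> B"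
        using 2 x by blast
      have "skorokhod_nbhd x (max T T') (min e e') \<subseteq> A \<inter> B"
        using * skorokhod_nbhd_mono[of T "max T T'" "min e e'" e x]
          skorokhod_nbhd_mono[of T' "max T T'" "min e e'" e' x] by auto
      then show "\<exists>T. \<exists>e>0. skorokhod_nbhd x T e \<subseteq> A \<inter> B"
        using * by (metis min_less_iff_conj)
    qed
  next
    case (4 K)
    show ?case
    proof
      fix x assume "x \<in> \<Union> K"
      then obtain A where A: "A \<in> K" "x \<in> A" by blast
      then obtain T e where "e > 0" "skorokhod_nbhd x T e \<subseteq> A" using 4 by blast
      then show "\<exists>T. \<exists>e>0. skorokhod_nbhd x T e \<subseteq> \<Union> K" using A by blast
    qed
  qed auto
  then show ?thesis
    unfolding skorokhod_topology_def by (simp add: topology_inverse')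
qed

lemma id_time_change: "(\<lambda>s. s) \<in> time_changes"
  by (auto simp: time_changes_def strict_mono_on_def)

lemma self_in_skorokhod_nbhd:
  assumes "x \<in> skorokhod_space" "e > 0"
  shows "x \<in> skorokhod_nbhd x T e"
  unfolding skorokhod_nbhd_def using assms id_time_change
  by (auto intro!: bexI[of _ "\<lambda>s. s"] exI[of _ 0])

lemma topspace_skorokhod [simp]: "topspace skorokhod_topology = skorokhod_space"
proof
  show "topspace skorokhod_topology \<subseteq> skorokhod_space"
    using openin_skorokhod openin_topspace by blast
  have "openin skorokhod_topology skorokhod_space"
    unfolding openin_skorokhod by (auto simp: skorokhod_nbhd_def intro: exI[of _ 1])
  then show "skorokhod_space \<subseteq> topspace skorokhod_topology"
    by (rule openin_subset)
qed

lemma openin_skorokhod_nbhd: "openin skorokhod_topology (skorokhod_nbhd x T e)"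
  unfolding openin_skorokhod
proof (intro conjI ballI)
  show "skorokhod_nbhd x T e \<subseteq> skorokhod_space"
    by (auto simp: skorokhod_nbhd_def)
next
  fix y assume "y \<in> skorokhod_nbhd x T e"
  then obtain l d where l: "l \<in> time_changes" and d: "d < e"
    and ld: "\<And>s. 0 \<le> s \<Longrightarrow> \<bar>l s - s\<bar> \<le> d"
    and yd: "\<And>s. s \<in> {0..T} \<Longrightarrow> \<bar>y (l s) - x s\<bar> \<le> d"
    unfolding skorokhod_nbhd_def by blast
  have lpos: "0 \<le> l s" if "0 \<le> s" for s
    using l that unfolding time_changes_def by auto
  have "skorokhod_nbhd y (T + d) (e - d) \<subseteq> skorokhod_nbhd x T e"
  proof
    fix z assume "z \<in> skorokhod_nbhd y (T + d) (e - d)"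
    then obtain m c where z: "z \<in> skorokhod_space" and m: "m \<in> time_changes" and c: "c < e - d"
      and mc: "\<And>s. 0 \<le> s \<Longrightarrow> \<bar>m s - s\<bar> \<le> c"
      and zc: "\<And>s. s \<in> {0..T + d} \<Longrightarrow> \<bar>z (m s) - y s\<bar> \<le> c"
      unfolding skorokhod_nbhd_def by blast
    have "(\<lambda>s. m (l s)) \<in> time_changes"
    proof -
      have "continuous_on {0..} (m \<circ> l)"
        using l m unfolding time_changes_def by (intro continuous_on_compose) auto
      moreover have "strict_mono_on {0..} (m \<circ> l)"
        using l m lpos unfolding time_changes_def strict_mono_on_def by auto
      moreover have "(m \<circ> l) ` {0..} = {0..}"
        using l m unfolding time_changes_def image_comp[symmetric] by simp
      ultimately show ?thesis by (simp add: time_changes_def comp_def)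
    qed
    moreover have "\<bar>m (l s) - s\<bar> \<le> c + d" if "0 \<le> s" for s
      using mc[OF lpos[OF that]] ld[OF that] by linarith
    moreover have "\<bar>z (m (l s)) - x s\<bar> \<le> c + d" if s: "s \<in> {0..T}" for s
    proof -
      have "l s \<in> {0..T + d}" using s lpos[of s] ld[of s] by auto
      from zc[OF this] yd[OF s] show ?thesis by linarith
    qed
    moreover have "c + d < e" using c by simp
    ultimately show "z \<in> skorokhod_nbhd x T e"
      using z unfolding skorokhod_nbhd_def by (auto intro!: bexI[of _ "\<lambda>s. m (l s)"] exI[of _ "c + d"])
  qed
  then show "\<exists>T' e'. 0 < e' \<and> skorokhod_nbhd y T' e' \<subseteq> skorokhod_nbhd x T e"
    using d by (intro exI[of _ "T + d"] exI[of _ "e - d"]) auto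
qed

lemma limitin_skorokhod:
  "limitin skorokhod_topology f x F \<longleftrightarrow> x \<in> skorokhod_space \<and>
     (\<forall>T. \<forall>e>0. eventually (\<lambda>i. f i \<in> skorokhod_nbhd x T e) F)"
  (is "?L \<longleftrightarrow> ?R")
proof
  assume ?L
  then show ?R
    unfolding limitin_def using openin_skorokhod_nbhd self_in_skorokhod_nbhd by auto
next
  assume R: ?R
  show ?L
    unfolding limitin_def
  proof (intro conjI allI impI)
    show "x \<in> topspace skorokhod_topology" using R by simp
    fix U assume "openin skorokhod_topology U \<and> x \<in> U"
    then obtain T e where "e > 0" "skorokhod_nbhd x T e \<subseteq> U" unfolding openin_skorokhod by blast
    with R show "eventually (\<lambda>i. f i \<in> U) F" by (metis (mono_tags, lifting) eventually_mono subsetD)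
  qed
qed

theorem limitin_skorokhod_sequentially:
  assumes "\<And>n. f n \<in> skorokhod_space" "x \<in> skorokhod_space"
  shows "limitin skorokhod_topology f x sequentially \<longleftrightarrow>
    (\<exists>l. (\<forall>n. l n \<in> time_changes) \<and> uniform_limit {0..} l (\<lambda>s. s) sequentially \<and>
      (\<forall>T. uniform_limit {0..T} (\<lambda>n s. f n (l n s)) x sequentially))"
  (is "?L \<longleftrightarrow> ?R")
proof
  assume ?R
  then obtain l where l: "\<And>n. l n \<in> time_changes" "uniform_limit {0..} l (\<lambda>s. s) sequentially"
    "\<And>T. uniform_limit {0..T} (\<lambda>n s. f n (l n s)) x sequentially" by blast
  have "eventually (\<lambda>n. f n \<in> skorokhod_nbhd x T e) sequentially" if "e > 0" for T e
  proof -
    have e2: "e / 2 > 0" using that by simp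
    have "eventually (\<lambda>n. \<forall>s\<in>{0..}. dist (l n s) s < e / 2) sequentially"
      "eventually (\<lambda>n. \<forall>s\<in>{0..T}. dist (f n (l n s)) (x s) < e / 2) sequentially"
      using uniform_limitD[OF l(2) e2] uniform_limitD[OF l(3) e2] by auto
    then show ?thesis
    proof eventually_elim
      case (elim n)
      then show ?case
        unfolding skorokhod_nbhd_def using assms l(1) that
        by (auto simp: dist_real_def intro!: bexI[of _ "l n"] exI[of _ "e / 2"] less_imp_le)
    qed
  qed
  then show ?L using assms by (simp add: limitin_skorokhod)
next
  assume ?L
  define V where "V k = skorokhod_nbhd x (real k) (1 / real (Suc k))" for k
  have ev: "eventually (\<lambda>n. f n \<in> V k) sequentially" for k
    using \<open>?L\<close> unfolding limitin_skorokhod V_def by auto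
  define K where "K n = Max (insert 0 {k. k \<le> n \<and> f n \<in> V k})" for n
  have Kev: "eventually (\<lambda>n. m \<le> K n \<and> f n \<in> V (K n)) sequentially" for m
    using ev[of m] ev[of 0] eventually_ge_at_top[of m]
  proof eventually_elim
    case (elim n)
    have fin: "finite (insert 0 {k. k \<le> n \<and> f n \<in> V k})" by simp
    have "m \<le> K n" unfolding K_def using elim by (intro Max_ge[OF fin]) auto
    moreover have "K n \<in> insert 0 {k. k \<le> n \<and> f n \<in> V k}"
      unfolding K_def by (rule Max_in[OF fin]) simp
    ultimately show ?case using elim by auto
  qed
  define good where "good n l \<longleftrightarrow> l \<in> time_changes \<and>
      (f n \<in> V (K n) \<longrightarrow> (\<forall>s\<ge>0. \<bar>l s - s\<bar> < 1 / real (Suc (K n))) \<and>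
      (\<forall>s\<in>{0..real (K n)}. \<bar>f n (l s) - x s\<bar> < 1 / real (Suc (K n))))" for n l
  have "\<exists>l. good n l" for n
  proof (cases "f n \<in> V (K n)")
    case True
    then obtain l d where "l \<in> time_changes" "d < 1 / real (Suc (K n))"
      "\<forall>s\<ge>0. \<bar>l s - s\<bar> \<le> d" "\<forall>s\<in>{0..real (K n)}. \<bar>f n (l s) - x s\<bar> \<le> d"
      unfolding V_def skorokhod_nbhd_def by blast
    then show ?thesis unfolding good_def by (intro exI[of _ l]) (meson order_le_less_trans)
  next
    case False
    then show ?thesis unfolding good_def using id_time_change by blast
  qed
  then obtain l where l: "\<And>n. good n (l n)" by metis
  have small: "eventually (\<lambda>n. T \<le> real (K n) \<and> 1 / real (Suc (K n)) < e \<and> f n \<in> V (K n)) sequentially"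
    if e: "e > 0" for T e :: real
  proof -
    obtain a :: nat where a: "1 / real (Suc a) < e"
      using reals_Archimedean[OF e] by (auto simp: divide_inverse)
    obtain b :: nat where b: "T \<le> real b" using real_arch_simple by blast
    show ?thesis using Kev[of "max a b"]
    proof eventually_elim
      case (elim n)
      have "1 / real (Suc (K n)) \<le> 1 / real (Suc a)" using elim by (intro divide_left_mono) auto
      then show ?case using elim a b by (auto intro: order_trans)
    qed
  qed
  have "uniform_limit {0..} l (\<lambda>s. s) sequentially"
  proof (rule uniform_limitI)
    fix e :: real assume "e > 0"
    from small[OF this, of 0] show "\<forall>\<^sub>F n in sequentially. \<forall>s\<in>{0..}. dist (l n s) s < e"
    proof eventually_elim
      case (elim n)
      then show ?case using l[of n] unfolding good_def dist_real_def by (metis atLeast_iff less_trans)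
    qed
  qed
  moreover have "uniform_limit {0..T} (\<lambda>n s. f n (l n s)) x sequentially" for T
  proof (rule uniform_limitI)
    fix e :: real assume "e > 0"
    from small[OF this, of T]
    show "\<forall>\<^sub>F n in sequentially. \<forall>s\<in>{0..T}. dist (f n (l n s)) (x s) < e"
    proof eventually_elim
      case (elim n)
      then have "\<forall>s\<in>{0..real (K n)}. \<bar>f n (l n s) - x s\<bar> < 1 / real (Suc (K n))"
        using l[of n] unfolding good_def by blast
      then show ?case using elim unfolding dist_real_def
        by (meson atLeastAtMost_iff order_trans less_trans)
    qed
  qed
  ultimately show ?R using l unfolding good_def by blast
qed


section \<open>Convergence in distribution\<close>

definition borel_of :: "'a topology \<Rightarrow> 'a measure" where
  "borel_of T = sigma (topspace T) {U. openin T U}"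

text \<open>Random elements \<open>X i\<close> and \<open>Z\<close> of a topological space, each on its own probability space.
  Measurability is part of the notion: without it the expectations below would be meaningless.\<close>

definition converges_in_distribution ::
  "'c topology \<Rightarrow> ('i \<Rightarrow> 'a measure) \<Rightarrow> ('i \<Rightarrow> 'a \<Rightarrow> 'c) \<Rightarrow> 'b measure \<Rightarrow> ('b \<Rightarrow> 'c) \<Rightarrow> 'i filter \<Rightarrow> bool"
where
  "converges_in_distribution T M X N Z F \<longleftrightarrow>
     (\<forall>\<^sub>F i in F. X i \<in> M i \<rightarrow>\<^sub>M borel_of T) \<and> Z \<in> N \<rightarrow>\<^sub>M borel_of T \<and>
     (\<forall>f. continuous_map T euclideanreal f \<and> bounded (f ` topspace T) \<longrightarrow>
        ((\<lambda>i. \<integral>\<omega>. f (X i \<omega>) \<partial>M i) \<longlongrightarrow> (\<integral>\<omega>. f (Z \<omega>) \<partial>N)) F)"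


section \<open>Continuous state branching processes with immigration\<close>

abbreviation halfline :: "real measure" where
  "halfline \<equiv> restrict_space borel {0..}"

definition natural_filtration :: "'a measure \<Rightarrow> (real \<Rightarrow> 'a \<Rightarrow> real) \<Rightarrow> real \<Rightarrow> 'a measure" where
  "natural_filtration M Y s =
     sigma (space M) {Y u -` A \<inter> space M | u A. u \<in> {0..s} \<and> A \<in> sets halfline}"

definition markov_semigroup :: "(real \<Rightarrow> real \<Rightarrow> real measure) \<Rightarrow> bool" where
  "markov_semigroup P \<longleftrightarrow>
     (\<forall>t\<ge>0. P t \<in> halfline \<rightarrow>\<^sub>M prob_algebra halfline) \<and>
     (\<forall>x\<ge>0. P 0 x = return halfline x) \<and>
     (\<forall>s\<ge>0. \<forall>t\<ge>0. \<forall>x\<ge>0. P (s + t) x = P s x \<bind> P t)"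

definition markov_process ::
  "'a measure \<Rightarrow> (real \<Rightarrow> real \<Rightarrow> real measure) \<Rightarrow> (real \<Rightarrow> 'a \<Rightarrow> real) \<Rightarrow> bool" where
  "markov_process M P Y \<longleftrightarrow>
     (\<forall>t\<ge>0. Y t \<in> M \<rightarrow>\<^sub>M halfline) \<and>
     (\<forall>s\<ge>0. \<forall>t\<ge>0. \<forall>A\<in>sets halfline. AE \<omega> in M.
        real_cond_exp M (natural_filtration M Y s) (\<lambda>\<omega>. indicator A (Y (s + t) \<omega>)) \<omega>
          = measure (P t (Y s \<omega>)) A)"

definition solves_cumulant_ode :: "(real \<Rightarrow> real) \<Rightarrow> real \<Rightarrow> (real \<Rightarrow> real) \<Rightarrow> bool" where
  "solves_cumulant_ode R z w \<longleftrightarrow> w 0 = z \<and>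
     (\<forall>t\<ge>0. 0 \<le> w t \<and> (w has_real_derivative - R (w t)) (at t within {0..}))"

definition unique_cumulant :: "(real \<Rightarrow> real) \<Rightarrow> real \<Rightarrow> (real \<Rightarrow> real) \<Rightarrow> bool" where
  "unique_cumulant R z v \<longleftrightarrow> solves_cumulant_ode R z v \<and>
     (\<forall>w. solves_cumulant_ode R z w \<longrightarrow> (\<forall>t\<ge>0. w t = v t))"

text \<open>The conditional expectation given \<open>Y(0) = x\<close> is, for every \<open>x\<close>, the integral against the
  transition kernel started at \<open>x\<close>.\<close>

definition cbi_process ::
  "'a measure \<Rightarrow> (real \<Rightarrow> real) \<Rightarrow> (real \<Rightarrow> real) \<Rightarrow> (real \<Rightarrow> 'a \<Rightarrow> real) \<Rightarrow> bool" where
  "cbi_process M R F Y \<longleftrightarrow> prob_space M \<and>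
     (\<forall>\<omega>\<in>space M. cadlag (\<lambda>t. Y t \<omega>)) \<and>
     (\<exists>P v. markov_semigroup P \<and> markov_process M P Y \<and>
        (\<forall>z\<ge>0. unique_cumulant R z (\<lambda>t. v t z)) \<and>
        (\<forall>x\<ge>0. \<forall>z\<ge>0. \<forall>t\<ge>0.
           (\<integral>y. exp (- z * y) \<partial>P t x) = exp (- x * v t z - integral {0..t} (\<lambda>s. F (v s z)))))"

end

theory Submission
  imports Defs
begin

text \<open>An affine process enters only through the Laplace transform of its kernel, so one works with
  \<open>Z = exp (- X)\<close>, which takes values in a compact interval.  Let \<open>\<pi> x\<close> be the step function read off
  from the path \<open>x\<close> at the points \<open>j / n\<close>.  For a bounded continuous functional \<open>f\<close> on Skorokhod space,
  the largest function below \<open>f\<close> that is \<open>k\<close>-Lipschitz for the uniform distance of \<open>exp (- x)\<close> on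
  \<open>[0, k]\<close> increases to \<open>f\<close> with \<open>k\<close>, and it changes little when \<open>x\<close> is replaced by \<open>\<pi> x\<close>.  Hence
  convergence in distribution follows from the convergence of the values of \<open>Z\<close> on each grid and from a
  bound, uniform in the scaling parameter, on the expected uniform distance between \<open>x\<close> and \<open>\<pi> x\<close>;
  neither Prokhorov's theorem nor the path continuity of the limit is used.

  For the grids, the Markov property turns joint Laplace transforms into iterated cumulants, which depend
  continuously on the branching mechanism by Gronwall's inequality, and the Stone-Weierstrass theorem on
  the Hilbert cube passes from Laplace transforms to continuous functions.  For the oscillation, the
  conditional fourth moment of an increment of \<open>Z\<close> over a time \<open>h\<close> is a fourth difference in the
  exponent; its first-order term vanishes in the limit because the limiting mechanisms are polynomials of
  degree at most two, so for large scaling parameters it is \<open>O(h\<^sup>2)\<close> uniformly in the starting point.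
  Ottaviani's maximal inequality on each of the \<open>O(1 / h)\<close> grid cells then gives the bound.\<close>


subsection \<open>Approximation of cadlag paths by step functions\<close>

text \<open>In the variable \<open>exp (- X)\<close> the conditional fourth moment carries a factor
  \<open>exp (- 4 * x)\<close>, which absorbs the growth in \<open>x\<close> of all error terms. The
  power has to exceed two because of the number of cells: a second moment of order \<open>h\<close>,
  summed over \<open>1 / h\<close> cells, does not become small, whereas \<open>h\<^sup>2\<close>
  leaves a factor \<open>h\<close>. A prelimit process may jump, and then for a fixed scaling
  parameter its fourth moment is only of order \<open>h\<close> as \<open>h\<close> tends to 0. The
  estimate is therefore made for fixed \<open>h\<close>: its constant does not depend on
  \<open>h\<close>, but the threshold for the scaling parameter does.\<close>

lemma cadlag_partition:
  assumes x: "cadlag x" and T: "0 \<le> T" and e: "0 < e"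
  obtains P where "finite P" "P \<subseteq> {0<..}"
    "\<And>s q. 0 \<le> s \<Longrightarrow> s \<le> q \<Longrightarrow> q \<le> T \<Longrightarrow> P \<inter> {s<..q} = {} \<Longrightarrow> \<bar>x s - x q\<bar> \<le> e"
proof -
  \<comment> \<open>The condition \<open>P \<inter> {s<..q} = {}\<close> says that \<open>s\<close>
    and \<open>q\<close> lie in one cell of the partition, closed on the left and open on the right
    to suit right-continuity. No ordering of \<open>P\<close> is involved, so bisection can simply
    unite two partitions.\<close>
  define Q where "Q a b \<longleftrightarrow> (\<exists>P. finite P \<and> P \<subseteq> {0<..} \<and>
    (\<forall>s q. max 0 a \<le> s \<longrightarrow> s \<le> q \<longrightarrow> q \<le> b \<longrightarrow> P \<inter> {s<..q} = {} \<longrightarrow> \<bar>x s - x q\<bar> \<le> e))" for a b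
  from T have "Q 0 T"
  proof (induction rule: Bolzano)
    case (trans a b c)
    then obtain P1 P2 where P: "finite P1" "P1 \<subseteq> {0<..}" "finite P2" "P2 \<subseteq> {0<..}"
      and left: "\<And>s q. max 0 a \<le> s \<Longrightarrow> s \<le> q \<Longrightarrow> q \<le> b \<Longrightarrow> P1 \<inter> {s<..q} = {} \<Longrightarrow> \<bar>x s - x q\<bar> \<le> e"
      and right: "\<And>s q. max 0 b \<le> s \<Longrightarrow> s \<le> q \<Longrightarrow> q \<le> c \<Longrightarrow> P2 \<inter> {s<..q} = {} \<Longrightarrow> \<bar>x s - x q\<bar> \<le> e"
      unfolding Q_def by blast
    show ?case unfolding Q_def
    \<comment> \<open>The common endpoint \<open>b\<close> becomes a cut, so no admissible pair lies
      on both sides of it; for \<open>b \<le> 0\<close> no time of the half-line lies to its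
      left.\<close>
    proof (intro exI[of _ "P1 \<union> P2 \<union> ({b} \<inter> {0<..})"] conjI allI impI)
      fix s q assume *: "max 0 a \<le> s" "s \<le> q" "q \<le> c"
        "(P1 \<union> P2 \<union> ({b} \<inter> {0<..})) \<inter> {s<..q} = {}"
      consider "q < b" | "b \<le> s" | "s < b" "b \<le> q" by linarith
      then show "\<bar>x s - x q\<bar> \<le> e"
      proof cases
        case 3
        with * have "b \<in> {b} \<inter> {0<..} \<inter> {s<..q}" by auto
        with * show ?thesis by blast
      next
        case 1
        show ?thesis by (rule left) (use * \<open>q < b\<close> in auto)
      next
        case 2
        show ?thesis by (rule right) (use * \<open>b \<le> s\<close> in auto)
      qed
    qed (use P in auto)
  next
    case (local t)
    have "(x \<longlongrightarrow> x t) (at_right t)"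
      using x local by (auto simp: cadlag_def continuous_within)
    then have "eventually (\<lambda>u. dist (x u) (x t) < e/2) (at_right t)"
      using e by (intro tendstoD) auto
    then obtain d1 where d1: "d1 > t" "\<And>u. t < u \<Longrightarrow> u < d1 \<Longrightarrow> \<bar>x u - x t\<bar> < e/2"
      unfolding eventually_at_right_field dist_real_def by auto
    have "\<exists>l d2. d2 < t \<and> (\<forall>u. 0 \<le> u \<longrightarrow> d2 < u \<longrightarrow> u < t \<longrightarrow> \<bar>x u - l\<bar> < e/2)"
    proof (cases "t > 0")
      case True
      then obtain l where "(x \<longlongrightarrow> l) (at_left t)" using x by (auto simp: cadlag_def)
      then have "eventually (\<lambda>u. dist (x u) l < e/2) (at_left t)"
        using e by (intro tendstoD) auto
      then show ?thesis unfolding eventually_at_left_field dist_real_def by blast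
    next
      case False
      then have "t = 0" using local by simp
      \<comment> \<open>At time 0 there is no left limit; the claim is empty, as no \<open>u\<close>
        satisfies \<open>0 \<le> u\<close> and \<open>u < 0\<close>.\<close>
      then show ?thesis by (intro exI[of _ 0] exI[of _ "-1"]) auto
    qed
    then obtain l d2 where d2: "d2 < t" "\<And>u. 0 \<le> u \<Longrightarrow> d2 < u \<Longrightarrow> u < t \<Longrightarrow> \<bar>x u - l\<bar> < e/2" by blast
    have r: "\<bar>x u - x t\<bar> < e/2" if "t \<le> u" "u < d1" for u
      using d1(2)[of u] that e by (cases "u = t") auto
    show ?case
    proof (intro exI[of _ "min (d1 - t) (t - d2)"] conjI allI impI, goal_cases)
      case 1 then show ?case using d1 d2 by simp
    next
      case (2 a b)
      then have near: "a \<le> t" "t \<le> b" "b - a < d1 - t" "b - a < t - d2" by auto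
      show ?case unfolding Q_def
      \<comment> \<open>A jump may occur at \<open>t\<close> itself, so \<open>t\<close> is made a
        cut: just before it the path is near \<open>l\<close>, from it onwards near
        \<open>x t\<close>.\<close>
      proof (intro exI[of _ "{t} \<inter> {0<..}"] conjI allI impI)
        fix s q assume *: "max 0 a \<le> s" "s \<le> q" "q \<le> b" "{t} \<inter> {0<..} \<inter> {s<..q} = {}"
        consider "q < t" | "t \<le> s" | "s < t" "t \<le> q" by linarith
        then show "\<bar>x s - x q\<bar> \<le> e"
        proof cases
          case 1
          have "0 \<le> s" "d2 < s" "d2 < q" "s < t" using * near \<open>q < t\<close> by auto
          then have "\<bar>x s - l\<bar> < e/2" "\<bar>x q - l\<bar> < e/2" using d2(2)[of s] d2(2)[of q] * \<open>q < t\<close> by auto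
          then show ?thesis by linarith
        next
          case 2
          have "\<bar>x s - x t\<bar> < e/2" "\<bar>x q - x t\<bar> < e/2"
            using r[of s] r[of q] * near \<open>t \<le> s\<close> by auto
          then show ?thesis by linarith
        next
          case 3
          with * have "t \<in> {t} \<inter> {0<..} \<inter> {s<..q}" by auto
          with * show ?thesis by blast
        qed
      qed auto
    qed
  qed
  then obtain P where "finite P" "P \<subseteq> {0<..}"
    "\<forall>s q. max 0 0 \<le> s \<longrightarrow> s \<le> q \<longrightarrow> q \<le> T \<longrightarrow> P \<inter> {s<..q} = {} \<longrightarrow> \<bar>x s - x q\<bar> \<le> e"
    unfolding Q_def by blast
  then show ?thesis using that[of P] by simp
qed

text \<open>Up to an error 1, the value at \<open>s\<close> is the value at the last cut not after
  \<open>s\<close> (or at 0), and there are finitely many of these.\<close>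

lemma cadlag_bounded:
  assumes "cadlag x"
  obtains B where "\<And>s. 0 \<le> s \<Longrightarrow> s \<le> T \<Longrightarrow> \<bar>x s\<bar> \<le> B"
proof (cases "0 \<le> T")
  case True
  obtain P where P: "finite P" "P \<subseteq> {0<..}"
    "\<And>s q. 0 \<le> s \<Longrightarrow> s \<le> q \<Longrightarrow> q \<le> T \<Longrightarrow> P \<inter> {s<..q} = {} \<Longrightarrow> \<bar>x s - x q\<bar> \<le> 1"
    by (rule cadlag_partition[OF assms True zero_less_one]) (rule that)
  show ?thesis
  proof (rule that)
    fix s assume s: "0 \<le> s" "s \<le> T"
    define A where "A = insert 0 {p \<in> P. p \<le> s}"
    have A: "finite A" "A \<noteq> {}" using P(1,2) by (auto simp: A_def)
    define p where "p = Max A"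
    have pA: "p \<in> A" unfolding p_def by (rule Max_in[OF A])
    have "P \<inter> {p<..s} = {}"
    proof (rule ccontr)
      assume "P \<inter> {p<..s} \<noteq> {}"
      then obtain r where "r \<in> P" "p < r" "r \<le> s" by auto
      then have "r \<in> A" by (auto simp: A_def)
      then have "r \<le> p" unfolding p_def using A by auto
      with \<open>p < r\<close> show False by simp
    qed
    moreover have "0 \<le> p" "p \<le> s" using pA s P(1,2) by (auto simp: A_def)
    ultimately have "\<bar>x p - x s\<bar> \<le> 1" by (intro P(3)) (use s in auto)
    moreover have "\<bar>x p\<bar> \<le> (\<Sum>q\<in>insert 0 P. \<bar>x q\<bar>)"
      using P(1,2) pA by (intro member_le_sum) (auto simp: A_def)
    ultimately show "\<bar>x s\<bar> \<le> 1 + (\<Sum>q\<in>insert 0 P. \<bar>x q\<bar>)" by linarith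
  qed
next
  case False
  show ?thesis by (rule that[of 0]) (use False in linarith)
qed

section \<open>Time changes and the triangle inequality and symmetry of neighbourhoods\<close>

lemma time_changes_nonneg: "l \<in> time_changes \<Longrightarrow> 0 \<le> s \<Longrightarrow> 0 \<le> l s"
  unfolding time_changes_def by auto

lemma time_changes_compose:
  assumes "l \<in> time_changes" "m \<in> time_changes"
  shows "(\<lambda>s. m (l s)) \<in> time_changes"
proof -
  have "continuous_on {0..} (m \<circ> l)"
    using assms unfolding time_changes_def by (intro continuous_on_compose) auto
  moreover have "strict_mono_on {0..} (m \<circ> l)"
    using assms time_changes_nonneg[OF assms(1)] unfolding time_changes_def strict_mono_on_def by auto
  moreover have "(m \<circ> l) ` {0..} = {0..}"
    using assms unfolding time_changes_def image_comp[symmetric] by simp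
  ultimately show ?thesis by (simp add: time_changes_def comp_def)
qed

lemma time_changes_inverse:
  assumes l: "l \<in> time_changes"
  obtains m where "m \<in> time_changes" "\<And>s. 0 \<le> s \<Longrightarrow> l (m s) = s"
proof -
  define m where "m = the_inv_into {0..} l"
  have mono: "strict_mono_on {0..} l" and img: "l ` {0..} = {0..}"
    using l by (auto simp: time_changes_def)
  have inj: "inj_on l {0..}" using mono by (rule strict_mono_on_imp_inj_on)
  have lm: "l (m s) = s" if "0 \<le> s" for s
    unfolding m_def using that img by (intro f_the_inv_into_f[OF inj]) auto
  have m0: "0 \<le> m s" if "0 \<le> s" for s
    using the_inv_into_into[OF inj, of s "{0..}"] img that by (auto simp: m_def)
  have ml: "m (l s) = s" if "0 \<le> s" for s
    unfolding m_def using that by (intro the_inv_into_f_f[OF inj]) auto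
  have less: "m s < m t" if "0 \<le> s" "s < t" for s t
  proof (rule ccontr)
    assume "\<not> m s < m t"
    then have "l (m t) \<le> l (m s)"
      using m0[of s] m0[of t] that mono unfolding strict_mono_on_def
      by (cases "m t = m s") (auto intro!: less_imp_le)
    with lm[of s] lm[of t] that show False by auto
  qed
  \<comment> \<open>A monotone function with open range is continuous. Extending \<open>m\<close> by
    the identity to negative times makes the range the whole line.\<close>
  define g where "g s = (if s < 0 then s else m s)" for s
  have "continuous_on UNIV g"
  proof (rule continuous_onI_mono)
    have "r \<in> range g" for r
    proof (cases "r < 0")
      case True
      then show ?thesis by (intro image_eqI[of _ _ r]) (auto simp: g_def)
    next
      case False
      then show ?thesis
        using ml[of r] time_changes_nonneg[OF l, of r] by (intro image_eqI[of _ _ "l r"]) (auto simp: g_def)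
    qed
    then show "open (range g)" by (metis UNIV_eq_I open_UNIV)
    show "g s \<le> g t" if "s \<le> t" for s t
      using that less[of s t] m0[of t] by (cases "s = t") (auto simp: g_def)
  qed
  then have "continuous_on {0..} m"
    by (rule continuous_on_cong[THEN iffD1, OF refl, rotated, OF continuous_on_subset]) (auto simp: g_def)
  moreover have "m ` {0..} = {0..}"
  proof
    show "{0..} \<subseteq> m ` {0..}"
    proof
      fix r :: real assume "r \<in> {0..}"
      then show "r \<in> m ` {0..}" using ml[of r] time_changes_nonneg[OF l, of r]
        by (intro image_eqI[of _ _ "l r"]) auto
    qed
  qed (use m0 in auto)
  ultimately have "m \<in> time_changes"
    using less by (auto simp: time_changes_def strict_mono_on_def)
  with lm that show ?thesis by blast
qed

text \<open>The time change from \<open>x\<close> to \<open>y\<close> moves times by less than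
  \<open>e\<close>, hence the horizon \<open>T + e\<close> around \<open>y\<close>.\<close>

lemma skorokhod_nbhd_trans:
  assumes "y \<in> skorokhod_nbhd x T e" "z \<in> skorokhod_nbhd y (T + e) e'"
  shows "z \<in> skorokhod_nbhd x T (e + e')"
proof -
  obtain l d where l: "l \<in> time_changes" and d: "d < e"
    and ld: "\<And>s. 0 \<le> s \<Longrightarrow> \<bar>l s - s\<bar> \<le> d"
    and yd: "\<And>s. s \<in> {0..T} \<Longrightarrow> \<bar>y (l s) - x s\<bar> \<le> d"
    using assms unfolding skorokhod_nbhd_def by blast
  obtain m c where z: "z \<in> skorokhod_space" and m: "m \<in> time_changes" and c: "c < e'"
    and mc: "\<And>s. 0 \<le> s \<Longrightarrow> \<bar>m s - s\<bar> \<le> c"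
    and zc: "\<And>s. s \<in> {0..T + e} \<Longrightarrow> \<bar>z (m s) - y s\<bar> \<le> c"
    using assms unfolding skorokhod_nbhd_def by blast
  have "\<bar>m (l s) - s\<bar> \<le> c + d" if "0 \<le> s" for s
    using mc[OF time_changes_nonneg[OF l that]] ld[OF that] by linarith
  moreover have "\<bar>z (m (l s)) - x s\<bar> \<le> c + d" if s: "s \<in> {0..T}" for s
  proof -
    have "l s \<in> {0..T + e}" using s time_changes_nonneg[OF l, of s] ld[of s] d by auto
    from zc[OF this] yd[OF s] show ?thesis by linarith
  qed
  ultimately show ?thesis
    using z c d time_changes_compose[OF l m] unfolding skorokhod_nbhd_def
    by (auto intro!: bexI[of _ "\<lambda>s. m (l s)"] exI[of _ "c + d"])
qed

text \<open>The inverse time change is used. It can carry times up to \<open>T\<close> beyond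
  \<open>T\<close>, but by less than \<open>e\<close>, which explains the longer horizon of the
  hypothesis.\<close>

lemma skorokhod_nbhd_sym:
  assumes "y \<in> skorokhod_nbhd x (T + e) e" "x \<in> skorokhod_space"
  shows "x \<in> skorokhod_nbhd y T e"
proof -
  obtain l d where l: "l \<in> time_changes" and d: "d < e"
    and ld: "\<And>s. 0 \<le> s \<Longrightarrow> \<bar>l s - s\<bar> \<le> d"
    and yd: "\<And>s. s \<in> {0..T + e} \<Longrightarrow> \<bar>y (l s) - x s\<bar> \<le> d"
    using assms unfolding skorokhod_nbhd_def by blast
  obtain m where m: "m \<in> time_changes" and lm: "\<And>s. 0 \<le> s \<Longrightarrow> l (m s) = s"
    using time_changes_inverse[OF l] by blast
  have "\<bar>m s - s\<bar> \<le> d" if "0 \<le> s" for s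
    using ld[of "m s"] lm[OF that] time_changes_nonneg[OF m that] by auto
  moreover have "\<bar>x (m s) - y s\<bar> \<le> d" if "s \<in> {0..T}" for s
  proof -
    have "m s \<in> {0..T + e}" using time_changes_nonneg[OF m, of s] calculation[of s] that d by auto
    from yd[OF this] lm[of s] that show ?thesis by (simp add: abs_minus_commute)
  qed
  ultimately show ?thesis using m d assms(2) unfolding skorokhod_nbhd_def by blast
qed

lemma uniform_in_skorokhod_nbhd:
  assumes "y \<in> skorokhod_space" "d < e" "0 \<le> d" "\<And>s. 0 \<le> s \<Longrightarrow> s \<le> T \<Longrightarrow> \<bar>y s - x s\<bar> \<le> d"
  shows "y \<in> skorokhod_nbhd x T e"
  unfolding skorokhod_nbhd_def using assms id_time_change
  by (auto intro!: bexI[of _ "\<lambda>s. s"] exI[of _ d])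

text \<open>Coordinates are kept in the form \<open>exp (- x)\<close> with values in a compact interval; the cutoff
  at \<open>exp (- n)\<close> makes the inverse transformation continuous there.\<close>

definition step_path :: "nat \<Rightarrow> (nat \<Rightarrow> real) \<Rightarrow> real \<Rightarrow> real" where
  "step_path n z = (\<lambda>s\<in>{0..}. - ln (min 1 (max (z (nat \<lfloor>real n * s\<rfloor>)) (exp (- real n)))))"

definition grid_values :: "nat \<Rightarrow> (real \<Rightarrow> real) \<Rightarrow> nat \<Rightarrow> real" where
  "grid_values n x j = exp (- x (real j / real n))"

lemma exp_step_path:
  "0 \<le> s \<Longrightarrow> exp (- step_path n z s) = min 1 (max (z (nat \<lfloor>real n * s\<rfloor>)) (exp (- real n)))"
  by (simp add: step_path_def min_less_iff_conj less_max_iff_disj)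

lemma cadlag_step:
  fixes g :: "nat \<Rightarrow> real"
  shows "cadlag (\<lambda>s. g (nat \<lfloor>real n * s\<rfloor>))"
proof (cases "n = 0")
  case False
  then have n: "real n > 0" by simp
  show ?thesis unfolding cadlag_def
  proof (intro conjI allI impI)
    fix t :: real
    have "eventually (\<lambda>s. \<lfloor>real n * s\<rfloor> = \<lfloor>real n * t\<rfloor>) (at_right t)"
      unfolding eventually_at_right_field
    proof (intro exI[of _ "(\<lfloor>real n * t\<rfloor> + 1) / real n"] conjI allI impI)
      show "t < (\<lfloor>real n * t\<rfloor> + 1) / real n" using n by (simp add: field_simps) linarith
      fix y assume y: "t < y" "y < (\<lfloor>real n * t\<rfloor> + 1) / real n"
      have "real n * t \<le> real n * y" "real n * y < \<lfloor>real n * t\<rfloor> + 1" using n y by (auto simp: field_simps)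
      then show "\<lfloor>real n * y\<rfloor> = \<lfloor>real n * t\<rfloor>" by linarith
    qed
    then have "eventually (\<lambda>s. g (nat \<lfloor>real n * s\<rfloor>) = g (nat \<lfloor>real n * t\<rfloor>)) (at_right t)"
      by eventually_elim simp
    then show "continuous (at_right t) (\<lambda>s. g (nat \<lfloor>real n * s\<rfloor>))"
      unfolding continuous_within by (rule tendsto_eventually)
  next
    fix t :: real
    \<comment> \<open>The ceiling minus 1 is correct also when \<open>t\<close> is a grid point,
      where the floor jumps at \<open>t\<close>.\<close>
    have "eventually (\<lambda>s. \<lfloor>real n * s\<rfloor> = \<lceil>real n * t\<rceil> - 1) (at_left t)"
      unfolding eventually_at_left_field
    proof (intro exI[of _ "(\<lceil>real n * t\<rceil> - 1) / real n"] conjI allI impI)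
      show "(\<lceil>real n * t\<rceil> - 1) / real n < t" using n by (simp add: field_simps) linarith
      fix y assume y: "y < t" "(\<lceil>real n * t\<rceil> - 1) / real n < y"
      have "real n * y < real n * t" "\<lceil>real n * t\<rceil> - 1 < real n * y" using n y by (auto simp: field_simps)
      then show "\<lfloor>real n * y\<rfloor> = \<lceil>real n * t\<rceil> - 1" by linarith
    qed
    then have "eventually (\<lambda>s. g (nat \<lfloor>real n * s\<rfloor>) = g (nat (\<lceil>real n * t\<rceil> - 1))) (at_left t)"
      by eventually_elim simp
    then show "\<exists>l. ((\<lambda>s. g (nat \<lfloor>real n * s\<rfloor>)) \<longlongrightarrow> l) (at_left t)"
      by (intro exI[of _ "g (nat (\<lceil>real n * t\<rceil> - 1))"] tendsto_eventually)
  qed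
next
  case True
  then show ?thesis unfolding cadlag_def by (auto intro!: exI[of _ "g 0"])
qed

lemma cadlag_cong:
  assumes "\<And>s. 0 \<le> s \<Longrightarrow> x s = y s"
  shows "cadlag x \<longleftrightarrow> cadlag y"
proof -
  have "continuous (at_right t) x \<longleftrightarrow> continuous (at_right t) y" if "0 \<le> t" for t
    unfolding continuous_within assms[OF that] using assms that
    by (intro filterlim_cong refl) (auto simp: eventually_at_right_field intro!: exI[of _ "t + 1"])
  moreover have "(x \<longlongrightarrow> l) (at_left t) \<longleftrightarrow> (y \<longlongrightarrow> l) (at_left t)" if "0 < t" for t l
    using assms that by (intro filterlim_cong refl) (auto simp: eventually_at_left_field intro!: exI[of _ 0])
  ultimately show ?thesis unfolding cadlag_def by metis
qed

lemma step_path_in_skorokhod_space: "step_path n z \<in> skorokhod_space"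
proof -
  have "cadlag (\<lambda>s. (\<lambda>j. - ln (min 1 (max (z j) (exp (- real n))))) (nat \<lfloor>real n * s\<rfloor>))"
    by (rule cadlag_step)
  then have "cadlag (step_path n z)"
    by (subst cadlag_cong[where y = "\<lambda>s. - ln (min 1 (max (z (nat \<lfloor>real n * s\<rfloor>)) (exp (- real n))))"])
       (auto simp: step_path_def)
  moreover have "0 \<le> step_path n z t" if "0 \<le> t" for t
  proof -
    have "exp (- step_path n z t) \<le> 1" unfolding exp_step_path[OF that] by simp
    then show ?thesis by simp
  qed
  ultimately show ?thesis
    by (auto simp: skorokhod_space_def step_path_def)
qed

text \<open>Under \<open>exp (- x)\<close> the cutoff at \<open>exp (- n)\<close> is a truncation at
  height \<open>n\<close>; on a bounded time interval it disappears for large \<open>n\<close>,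
  because the path is bounded there.\<close>

lemma step_path_grid_values:
  assumes x: "\<And>s. 0 \<le> s \<Longrightarrow> 0 \<le> x s" and s: "0 \<le> s"
  shows "step_path n (grid_values n x) s = min (x (real (nat \<lfloor>real n * s\<rfloor>) / real n)) (real n)"
proof -
  define a where "a = x (real (nat \<lfloor>real n * s\<rfloor>) / real n)"
  have a: "0 \<le> a" using x by (simp add: a_def)
  have "exp (- step_path n (grid_values n x) s) = min 1 (max (exp (- a)) (exp (- real n)))"
    unfolding exp_step_path[OF s] grid_values_def a_def ..
  also have "\<dots> = exp (- min a (real n))"
    using a by (auto simp: min_def max_def)
  finally show ?thesis by (simp add: a_def)
qed

section \<open>Discretised paths converge in the Skorokhod topology\<close>

lemma separated_finite_set:
  fixes A :: "real set"
  assumes "finite A"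
  obtains g where "0 < g" "\<And>p q. p \<in> A \<Longrightarrow> q \<in> A \<Longrightarrow> p \<noteq> q \<Longrightarrow> g \<le> \<bar>p - q\<bar>"
proof -
  define D where "D = {1} \<union> (\<Union>p\<in>A. (\<lambda>q. \<bar>p - q\<bar>) ` (A - {p}))"
  have fin: "finite D" using assms by (simp add: D_def)
  have "D \<noteq> {}" "\<forall>a\<in>D. 0 < a" by (auto simp: D_def)
  then have "0 < Min D" using fin by simp
  moreover have "Min D \<le> \<bar>p - q\<bar>" if "p \<in> A" "q \<in> A" "p \<noteq> q" for p q
  proof (rule Min_le[OF fin])
    have "\<bar>p - q\<bar> \<in> (\<lambda>q. \<bar>p - q\<bar>) ` (A - {p})" using that by blast
    then show "\<bar>p - q\<bar> \<in> D" unfolding D_def using that(1) by blast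
  qed
  ultimately show ?thesis by (rule that)
qed

text \<open>Adding to the identity narrow hats of height \<open>c p\<close> at the points \<open>p\<close> moves each of these
  points to the right by exactly \<open>c p\<close>.\<close>

lemma hat_time_change:
  fixes c :: "real \<Rightarrow> real" and r g :: real
  assumes P: "finite P" "P \<subseteq> {0<..}" and r: "0 < r" "card P * r < g"
    and sep: "\<And>p q. p \<in> insert 0 P \<Longrightarrow> q \<in> insert 0 P \<Longrightarrow> p \<noteq> q \<Longrightarrow> g \<le> \<bar>p - q\<bar>"
    and c: "\<And>p. p \<in> P \<Longrightarrow> 0 \<le> c p" "\<And>p. p \<in> P \<Longrightarrow> c p \<le> r"
  obtains l where "l \<in> time_changes" "\<And>s. 0 \<le> s \<Longrightarrow> s \<le> l s \<and> l s \<le> s + card P * r"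
    "\<And>p. p \<in> P \<Longrightarrow> l p = p + c p"
proof -
  have "0 \<le> card P * r" using r(1) by simp
  then have g: "0 < g" using r(2) by linarith
  define hat where "hat p s = max 0 (1 - \<bar>s - p\<bar> / g)" for p s :: real
  define l where "l s = s + (\<Sum>p\<in>P. c p * hat p s)" for s
  have hat01: "0 \<le> hat p s" "hat p s \<le> 1" for p s using g by (auto simp: hat_def)
  \<comment> \<open>Each hat has slope at most \<open>1 / g\<close>, so the hats together decrease
    at a rate of at most \<open>card P * r / g\<close>, which is less than 1. This keeps
    \<open>l\<close> strictly increasing.\<close>
  have hat_lip: "hat p s - hat p t \<le> (t - s) / g" if "s \<le> t" for p s t
  proof -
    have "\<bar>t - p\<bar> \<le> \<bar>s - p\<bar> + (t - s)" using that by linarith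
    then have "\<bar>t - p\<bar> / g \<le> \<bar>s - p\<bar> / g + (t - s) / g"
      using g by (simp add: add_divide_distrib[symmetric] divide_right_mono)
    moreover have "0 \<le> (t - s) / g" using that g by simp
    ultimately show ?thesis unfolding hat_def by linarith
  qed
  \<comment> \<open>Distinct points are at least \<open>g\<close> apart, so each hat vanishes at all
    the other points; counting 0 among them gives \<open>l 0 = 0\<close>.\<close>
  have hat0: "hat p q = 0" if "p \<in> insert 0 P" "q \<in> insert 0 P" "p \<noteq> q" for p q
    using sep[OF that] g by (auto simp: hat_def field_simps)
  have l0: "l 0 = 0"
  proof -
    have "(\<Sum>p\<in>P. c p * hat p 0) = 0"
      using hat0 P by (intro sum.neutral) force
    then show ?thesis by (simp add: l_def)
  qed
  have lp: "l p = p + c p" if "p \<in> P" for p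
  proof -
    have "(\<Sum>q\<in>P. c q * hat q p) = (\<Sum>q\<in>P. if q = p then c p else 0)"
      using hat0 that by (intro sum.cong) (auto simp: hat_def)
    also have "\<dots> = c p" using that P by simp
    finally show ?thesis by (simp add: l_def)
  qed
  have ge: "s \<le> l s" for s
    unfolding l_def using c hat01 by (simp add: sum_nonneg)
  have "c p * hat p s \<le> r * 1" if "p \<in> P" for p s
    using c(2)[OF that] hat01[of p s] r(1) by (intro mult_mono) auto
  then have "(\<Sum>p\<in>P. c p * hat p s) \<le> (\<Sum>p\<in>P. r)" for s
    by (intro sum_mono) simp
  then have le: "l s \<le> s + card P * r" for s by (simp add: l_def)
  have mono: "l s < l t" if "s < t" for s t
  proof -
    have "(\<Sum>p\<in>P. c p * hat p s) - (\<Sum>p\<in>P. c p * hat p t) = (\<Sum>p\<in>P. c p * (hat p s - hat p t))"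
      by (simp add: sum_subtractf right_diff_distrib)
    also have "\<dots> \<le> (\<Sum>p\<in>P. r * ((t - s) / g))"
    proof (rule sum_mono)
      fix p assume "p \<in> P"
      have "c p * (hat p s - hat p t) \<le> c p * ((t - s) / g)"
        using hat_lip[of s t p] that c(1)[OF \<open>p \<in> P\<close>] by (intro mult_left_mono) auto
      also have "\<dots> \<le> r * ((t - s) / g)"
        using c(2)[OF \<open>p \<in> P\<close>] that g by (intro mult_right_mono) auto
      finally show "c p * (hat p s - hat p t) \<le> r * ((t - s) / g)" .
    qed
    also have "\<dots> = (card P * r) * (t - s) / g" by simp
    also have "\<dots> < g * (t - s) / g"
      using mult_strict_right_mono[OF r(2), of "t - s"] that g by (intro divide_strict_right_mono) auto
    also have "\<dots> = t - s" using g by simp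
    finally show ?thesis by (simp add: l_def)
  qed
  have cont: "continuous_on A l" for A
    unfolding l_def hat_def using g by (intro continuous_intros) auto
  have "l ` {0..} = {0..}"
  proof
    show "l ` {0..} \<subseteq> {0..}" using ge by (auto intro: order_trans)
    show "{0..} \<subseteq> l ` {0..}"
    proof
      fix y :: real assume y: "y \<in> {0..}"
      have "\<exists>x\<ge>0. x \<le> y \<and> l x = y"
        using y l0 ge cont by (intro IVT') auto
      then show "y \<in> l ` {0..}" by auto
    qed
  qed
  then have "l \<in> time_changes"
    using cont mono by (auto simp: time_changes_def strict_mono_on_def)
  with ge le lp that show ?thesis by blast
qed

text \<open>The grid notices a jump at \<open>p\<close> only at the next grid point. A time change
  that moves \<open>p\<close> there makes the step path and \<open>x\<close> change cells
  simultaneously, and then they differ only by an oscillation within one cell.\<close>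

lemma step_path_grid_tendsto:
  assumes x: "x \<in> skorokhod_space" and e: "0 < e"
  shows "eventually (\<lambda>n. step_path n (grid_values n x) \<in> skorokhod_nbhd x T e) sequentially"
proof -
  have cx: "cadlag x" and x0: "\<And>s. 0 \<le> s \<Longrightarrow> 0 \<le> x s" using x by (auto simp: skorokhod_space_def)
  \<comment> \<open>The time change moves times up to \<open>T\<close> by at most
    \<open>e / 2\<close>, so all times that are compared stay below \<open>T1\<close>.\<close>
  define T1 where "T1 = max T 0 + e"
  have T1: "0 \<le> T1" using e by (simp add: T1_def)
  obtain P where P: "finite P" "P \<subseteq> {0<..}"
    and osc: "\<And>s q. 0 \<le> s \<Longrightarrow> s \<le> q \<Longrightarrow> q \<le> T1 \<Longrightarrow> P \<inter> {s<..q} = {} \<Longrightarrow> \<bar>x s - x q\<bar> \<le> e / 2"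
    by (rule cadlag_partition[OF cx T1 half_gt_zero[OF e]]) (rule that)
  obtain B where B: "\<And>s. 0 \<le> s \<Longrightarrow> s \<le> T1 \<Longrightarrow> \<bar>x s\<bar> \<le> B"
    by (rule cadlag_bounded[OF cx]) (rule that)
  obtain g where g: "0 < g"
    and sep: "\<And>p q. p \<in> insert 0 P \<Longrightarrow> q \<in> insert 0 P \<Longrightarrow> p \<noteq> q \<Longrightarrow> g \<le> \<bar>p - q\<bar>"
    by (rule separated_finite_set[OF finite.insertI[OF P(1)]]) (rule that)
  have "eventually (\<lambda>n. n > 0 \<and> card P * (1 / real n) < min g (e / 2) \<and> B \<le> real n) sequentially"
  proof (intro eventually_conj)
    have "((\<lambda>n. card P * (1 / real n)) \<longlongrightarrow> real (card P) * 0) sequentially"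
      by (intro tendsto_intros lim_const_over_n)
    moreover have "real (card P) * 0 < min g (e / 2)" using g e by simp
    ultimately show "eventually (\<lambda>n. card P * (1 / real n) < min g (e / 2)) sequentially"
      by (rule order_tendstoD)
    show "eventually (\<lambda>n. B \<le> real n) sequentially"
      using eventually_ge_at_top[of "nat \<lceil>B\<rceil>"] by eventually_elim linarith
  qed (rule eventually_gt_at_top)
  then show ?thesis
  proof eventually_elim
    case (elim n)
    then have n: "real n > 0" by simp
    have small: "card P * (1 / real n) < g" "card P * (1 / real n) < e / 2"
      using elim by (simp_all only: min_less_iff_conj)
    have Bn: "B \<le> real n" using elim by simp
    \<comment> \<open>\<open>p + c p\<close> is the first grid point at or after
      \<open>p\<close>.\<close>
    define c where "c p = \<lceil>real n * p\<rceil> / real n - p" for p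
    have c_eq: "c p = (\<lceil>real n * p\<rceil> - real n * p) / real n" for p
      using n by (simp add: c_def diff_divide_distrib)
    have c: "0 \<le> c p" "c p \<le> 1 / real n" for p
    proof -
      show "0 \<le> c p" unfolding c_eq using n by simp
      show "c p \<le> 1 / real n" unfolding c_eq
        by (rule divide_right_mono) (linarith, simp)
    qed
    obtain l where l: "l \<in> time_changes"
      and lb: "\<And>s. 0 \<le> s \<Longrightarrow> s \<le> l s \<and> l s \<le> s + card P * (1 / real n)"
      and lp: "\<And>p. p \<in> P \<Longrightarrow> l p = p + c p"
      using hat_time_change[OF P, of "1 / real n" g c] sep c elim n by auto
    have lmono: "l s < l t" if "0 \<le> s" "s < t" for s t
      using l that by (auto simp: time_changes_def strict_mono_on_def)
    have "\<bar>step_path n (grid_values n x) (l s) - x s\<bar> \<le> e / 2" if s: "s \<in> {0..T}" for s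
    proof -
      define k where "k = \<lfloor>real n * l s\<rfloor>"
      define q where "q = real (nat k) / real n"
      have ls: "s \<le> l s" "l s \<le> s + e / 2" 
      proof -
        have "s \<le> l s \<and> l s \<le> s + card P * (1 / real n)" by (rule lb) (use s in simp)
        then show "s \<le> l s" "l s \<le> s + e / 2" using small(2) by linarith+
      qed
      have k0: "0 \<le> k" using ls s n by (simp add: k_def)
      have q: "0 \<le> q" "q \<le> l s" "real n * q = k"
        using k0 n by (auto simp: q_def k_def field_simps)
      have qT: "q \<le> T1" "s \<le> T1" using q ls s e by (auto simp: T1_def)
      \<comment> \<open>By monotonicity \<open>p \<le> s\<close> means \<open>l p \<le> l s\<close>.
        As \<open>l p\<close> is the first grid point not before \<open>p\<close> and
        \<open>q\<close> is the last one not after \<open>l s\<close>, this is equivalent to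
        \<open>p \<le> q\<close>. Thus \<open>s\<close> and \<open>q\<close> lie in one
        cell.\<close>
      have pq: "p \<le> s \<longleftrightarrow> p \<le> q" if "p \<in> P" for p
      proof
        have npl: "real n * l p = \<lceil>real n * p\<rceil>" using lp[OF that] n by (simp add: c_def)
        have p0: "0 < p" using P that by auto
        {
          assume "p \<le> s"
          then have "l p \<le> l s" using lmono[of p s] p0 by (cases "p = s") auto
          then have "\<lceil>real n * p\<rceil> \<le> real n * l s" using npl n by (metis mult_le_cancel_left_pos)
          then have "\<lceil>real n * p\<rceil> \<le> k" by (simp add: k_def le_floor_iff)
          then have "real n * p \<le> real n * q" unfolding q(3) by linarith
          then show "p \<le> q" using n by simp
        }
        {
          assume "p \<le> q"
          show "p \<le> s"
          proof (rule ccontr)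
            assume "\<not> p \<le> s"
            then have "l s < l p" using lmono[of s p] s by auto
            then have "real n * l s < \<lceil>real n * p\<rceil>" using npl n by (metis mult_less_cancel_left_pos)
            then have "k < \<lceil>real n * p\<rceil>" by (simp add: k_def floor_less_iff)
            then have "real n * q < real n * p" unfolding q(3) by linarith
            then show False using n \<open>p \<le> q\<close> by simp
          qed
        }
      qed
      have "\<bar>x q - x s\<bar> \<le> e / 2"
      proof (cases "s \<le> q")
        case True
        have "P \<inter> {s<..q} = {}" using pq by fastforce
        from osc[OF _ True qT(1) this] s show ?thesis by (simp add: abs_minus_commute)
      next
        case False
        have "P \<inter> {q<..s} = {}" using pq by fastforce
        from osc[OF q(1) _ qT(2) this] False show ?thesis by simp
      qed
      moreover have "step_path n (grid_values n x) (l s) = x q"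
      proof -
        have "step_path n (grid_values n x) (l s) = min (x q) (real n)"
          using step_path_grid_values[of x "l s" n] x0 ls s by (simp add: q_def k_def)
        moreover have "x q \<le> real n" using B[OF q(1) qT(1)] Bn by linarith
        ultimately show ?thesis by simp
      qed
      ultimately show ?thesis by simp
    qed
    moreover have "\<bar>l s - s\<bar> \<le> e / 2" if "0 \<le> s" for s
      using lb[OF that] small by linarith
    ultimately show "step_path n (grid_values n x) \<in> skorokhod_nbhd x T e"
      unfolding skorokhod_nbhd_def using l e step_path_in_skorokhod_space
      by (auto intro!: bexI[of _ l] exI[of _ "e / 2"])
  qed
qed

section \<open>Borel sets of the Skorokhod space described by grid values\<close>

lemma open_step_path_vimage:
  assumes W: "openin skorokhod_topology W"
  shows "open {z. step_path n z \<in> W}"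
proof (subst open_subopen, intro ballI)
  fix z assume "z \<in> {z. step_path n z \<in> W}"
  then obtain T e where e: "0 < e" and sub: "skorokhod_nbhd (step_path n z) T e \<subseteq> W"
    using W unfolding openin_skorokhod by blast
  define c where "c a = - ln (min 1 (max a (exp (- real n))))" for a
  have "0 < min 1 (max a (exp (- real n)))" for a :: real by (simp add: less_max_iff_disj)
  then have "min 1 (max a (exp (- real n))) \<noteq> 0" for a :: real by (metis less_irrefl)
  then have "continuous_on UNIV c"
    unfolding c_def by (intro continuous_intros) auto
  then have cont: "continuous_on UNIV (\<lambda>z'. c (z' j))" for j :: nat
    by (rule continuous_on_compose2) auto
  \<comment> \<open>Up to time \<open>T\<close> the step path sees finitely many coordinates, so
    this condition is open in the product topology.\<close>
  define O' where "O' = (\<Inter>j\<in>{..nat \<lfloor>real n * T\<rfloor>}. {z'. \<bar>c (z' j) - c (z j)\<bar> < e / 2})"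
  have "open {z'. \<bar>c (z' j) - c (z j)\<bar> < e / 2}" for j
    by (intro open_Collect_less continuous_intros cont)
  then have "open O'" unfolding O'_def by (intro open_INT) auto
  moreover have "z \<in> O'" using e by (simp add: O'_def)
  moreover have "O' \<subseteq> {z. step_path n z \<in> W}"
  proof
    fix z' assume z': "z' \<in> O'"
    have "\<bar>step_path n z' s - step_path n z s\<bar> \<le> e / 2" if "0 \<le> s" "s \<le> T" for s
    proof -
      have "nat \<lfloor>real n * s\<rfloor> \<le> nat \<lfloor>real n * T\<rfloor>"
        using that by (intro nat_mono floor_mono mult_left_mono) auto
      with z' have "\<bar>c (z' (nat \<lfloor>real n * s\<rfloor>)) - c (z (nat \<lfloor>real n * s\<rfloor>))\<bar> < e / 2"
        by (auto simp: O'_def)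
      moreover have "step_path n y s = c (y (nat \<lfloor>real n * s\<rfloor>))" for y
        using that(1) by (simp only: step_path_def c_def restrict_apply atLeast_iff if_True)
      ultimately show ?thesis by (simp only: less_imp_le)
    qed
    then have "step_path n z' \<in> skorokhod_nbhd (step_path n z) T e"
      using e step_path_in_skorokhod_space by (intro uniform_in_skorokhod_nbhd[where d = "e / 2"]) auto
    with sub show "z' \<in> {z. step_path n z \<in> W}" by auto
  qed
  ultimately show "\<exists>S. open S \<and> z \<in> S \<and> S \<subseteq> {z. step_path n z \<in> W}" by blast
qed

text \<open>Discretised paths converge to \<open>x\<close>, but a limit of points of
  \<open>U\<close> need not lie in \<open>U\<close>. A margin that is uniform in \<open>n\<close>
  repairs this: \<open>W k\<close> asks for a neighbourhood inside \<open>U\<close> whose size is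
  fixed by \<open>k\<close>. The right-hand side is a countable condition on grid values.\<close>

lemma openin_skorokhod_step_path_approx:
  assumes U: "openin skorokhod_topology U"
  obtains W where "\<And>k. openin skorokhod_topology (W k)"
    "\<And>x. x \<in> skorokhod_space \<Longrightarrow> x \<in> U \<longleftrightarrow>
      (\<exists>k::nat. eventually (\<lambda>n. step_path n (grid_values n x) \<in> W k) sequentially)"
proof -
  define V where "V k = {y \<in> skorokhod_space. skorokhod_nbhd y (real k) (1 / Suc k) \<subseteq> U}" for k :: nat
  define W where "W k = skorokhod_topology interior_of V k" for k
  show ?thesis
  proof (rule that)
    show openW: "openin skorokhod_topology (W k)" for k by (simp add: W_def)
    fix x assume x: "x \<in> skorokhod_space"
    show "x \<in> U \<longleftrightarrow> (\<exists>k::nat. eventually (\<lambda>n. step_path n (grid_values n x) \<in> W k) sequentially)"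
    proof
      assume "x \<in> U"
      then obtain T e where e: "0 < e" and sub: "skorokhod_nbhd x T e \<subseteq> U"
        using U unfolding openin_skorokhod by blast
      \<comment> \<open>For such \<open>k\<close> the neighbourhood in the definition of
        \<open>V k\<close> is contained in the one of horizon \<open>T + e / 2\<close> and radius
        \<open>e / 2\<close>, and two steps of size \<open>e / 2\<close> stay inside
        \<open>skorokhod_nbhd x T e\<close>.\<close>
      obtain k :: nat where k: "max (T + e / 2) (2 / e) \<le> real k" using real_arch_simple by blast
      have "1 / Suc k \<le> e / 2" using k e by (simp add: field_simps)
      then have "skorokhod_nbhd y (real k) (1 / Suc k) \<subseteq> skorokhod_nbhd y (T + e / 2) (e / 2)" for y
        using k by (intro skorokhod_nbhd_mono) auto
      note mono = this
      have "skorokhod_nbhd x T (e / 2) \<subseteq> V k"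
      proof
        fix y assume y: "y \<in> skorokhod_nbhd x T (e / 2)"
        have "skorokhod_nbhd y (real k) (1 / Suc k) \<subseteq> U"
        proof
          fix z assume "z \<in> skorokhod_nbhd y (real k) (1 / Suc k)"
          then have "z \<in> skorokhod_nbhd x T (e / 2 + e / 2)"
            using mono by (intro skorokhod_nbhd_trans[OF y]) (rule subsetD)
          with sub show "z \<in> U" by (simp only: field_sum_of_halves subset_iff)
        qed
        with y show "y \<in> V k" by (simp add: V_def skorokhod_nbhd_def[of x])
      qed
      then have "skorokhod_nbhd x T (e / 2) \<subseteq> W k"
        unfolding W_def by (intro interior_of_maximal openin_skorokhod_nbhd)
      moreover have "eventually (\<lambda>n. step_path n (grid_values n x) \<in> skorokhod_nbhd x T (e / 2)) sequentially"
        using step_path_grid_tendsto[OF x] e by simp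
      ultimately show "\<exists>k. eventually (\<lambda>n. step_path n (grid_values n x) \<in> W k) sequentially"
        by (intro exI[of _ k]) (auto elim: eventually_mono)
    next
      assume "\<exists>k. eventually (\<lambda>n. step_path n (grid_values n x) \<in> W k) sequentially"
      then obtain k where "eventually (\<lambda>n. step_path n (grid_values n x) \<in> W k) sequentially" by blast
      \<comment> \<open>The horizon exceeds \<open>k\<close> by the radius, which is the price of
        exchanging the two paths by \<open>skorokhod_nbhd_sym\<close>.\<close>
      moreover have "eventually (\<lambda>n. step_path n (grid_values n x) \<in>
          skorokhod_nbhd x (real k + 1 / Suc k) (1 / Suc k)) sequentially"
        by (rule step_path_grid_tendsto[OF x]) simp
      ultimately have "eventually (\<lambda>n. x \<in> U) sequentially"
      proof eventually_elim
        case (elim n)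
        have "step_path n (grid_values n x) \<in> V k"
          by (rule subsetD[OF interior_of_subset elim(1)[unfolded W_def]])
        then have "skorokhod_nbhd (step_path n (grid_values n x)) (real k) (1 / Suc k) \<subseteq> U"
          unfolding V_def by (rule CollectE) (rule conjunct2)
        from subsetD[OF this skorokhod_nbhd_sym[OF elim(2) x]] show ?case .
      qed
      then show "x \<in> U" by simp
    qed
  qed
qed

text \<open>Membership in an open set is a countable combination of open conditions on grid values,
  so measurability of the coordinates already gives measurability for the Borel sets of the
  topology.\<close>

lemma measurable_borel_of_skorokhod:
  assumes X: "\<And>\<omega>. \<omega> \<in> space M \<Longrightarrow> X \<omega> \<in> skorokhod_space"
    and meas: "\<And>t. 0 \<le> t \<Longrightarrow> (\<lambda>\<omega>. X \<omega> t) \<in> borel_measurable M"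
  shows "X \<in> M \<rightarrow>\<^sub>M borel_of skorokhod_topology"
  unfolding borel_of_def
proof (rule measurable_measure_of)
  show "{U. openin skorokhod_topology U} \<subseteq> Pow (topspace skorokhod_topology)"
    using openin_subset by blast
  show "X \<in> space M \<rightarrow> topspace skorokhod_topology" using X by simp
  fix U assume "U \<in> {U. openin skorokhod_topology U}"
  then have "openin skorokhod_topology U" by simp
  then obtain W where W: "\<And>k. openin skorokhod_topology (W k)"
    and UW: "\<And>x. x \<in> skorokhod_space \<Longrightarrow> x \<in> U \<longleftrightarrow>
      (\<exists>k::nat. eventually (\<lambda>n. step_path n (grid_values n x) \<in> W k) sequentially)"
    by (rule openin_skorokhod_step_path_approx) auto
  have [measurable]: "(\<lambda>\<omega>. grid_values n (X \<omega>)) \<in> borel_measurable M" for n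
    unfolding grid_values_def using meas
    by (intro measurable_coordinatewise_then_product) auto
  have [measurable]: "{z. step_path n z \<in> W k} \<in> sets borel" for n k
    using open_step_path_vimage[OF W] by simp
  have "X \<omega> \<in> U \<longleftrightarrow> (\<exists>k N. \<forall>n\<ge>N. grid_values n (X \<omega>) \<in> {z. step_path n z \<in> W k})"
    if "\<omega> \<in> space M" for \<omega>
    using UW[OF X[OF that]] by (simp only: eventually_sequentially mem_Collect_eq)
  then have "X -` U \<inter> space M = {\<omega> \<in> space M. \<exists>k N. \<forall>n\<ge>N. grid_values n (X \<omega>) \<in> {z. step_path n z \<in> W k}}"
    by blast
  also have "\<dots> \<in> sets M" by measurable
  finally show "X -` U \<inter> space M \<in> sets M" .
qed


subsection \<open>Lipschitz envelopes and convergence in distribution\<close>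

text \<open>A supremum over rational times is countable, hence measurable in the paths. In the
  variable \<open>exp (- x)\<close> it is at most 1 on the Skorokhod space, so its expectations
  exist.\<close>

definition path_dist :: "nat \<Rightarrow> (real \<Rightarrow> real) \<Rightarrow> (real \<Rightarrow> real) \<Rightarrow> real" where
  "path_dist k y x = (SUP s\<in>\<rat> \<inter> {0..real k}. \<bar>exp (- y s) - exp (- x s)\<bar>)"

lemma exp_neg_diff_le_1:
  fixes a b :: real
  assumes "0 \<le> a" "0 \<le> b"
  shows "\<bar>exp (- a) - exp (- b)\<bar> \<le> 1"
proof -
  have "0 < exp (- a)" "exp (- a) \<le> 1" "0 < exp (- b)" "exp (- b) \<le> 1" using assms by auto
  then show ?thesis by linarith
qed

lemma skorokhod_space_nonneg: "x \<in> skorokhod_space \<Longrightarrow> 0 \<le> s \<Longrightarrow> 0 \<le> x s"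
  by (simp add: skorokhod_space_def)

lemma rats_Icc_nonempty: "\<rat> \<inter> {0..real k} \<noteq> {}"
proof -
  have "0 \<in> \<rat> \<inter> {0..real k}" by simp
  then show ?thesis by blast
qed

lemma path_dist_le:
  assumes "\<And>s. 0 \<le> s \<Longrightarrow> s \<le> real k \<Longrightarrow> \<bar>exp (- y s) - exp (- x s)\<bar> \<le> c"
  shows "path_dist k y x \<le> c"
  unfolding path_dist_def
proof (rule cSUP_least)
  show "\<rat> \<inter> {0..real k} \<noteq> {}" by (rule rats_Icc_nonempty)
qed (use assms in auto)

lemma path_dist_bdd:
  assumes "x \<in> skorokhod_space" "y \<in> skorokhod_space"
  shows "bdd_above ((\<lambda>s. \<bar>exp (- y s) - exp (- x s)\<bar>) ` (\<rat> \<inter> {0..real k}))"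
proof (rule bdd_aboveI2)
  fix s assume "s \<in> \<rat> \<inter> {0..real k}"
  then show "\<bar>exp (- y s) - exp (- x s)\<bar> \<le> 1"
    by (intro exp_neg_diff_le_1 skorokhod_space_nonneg[OF assms(1)] skorokhod_space_nonneg[OF assms(2)]) simp_all
qed

lemma path_dist_ge_rat:
  assumes "x \<in> skorokhod_space" "y \<in> skorokhod_space" "s \<in> \<rat>" "0 \<le> s" "s \<le> real k"
  shows "\<bar>exp (- y s) - exp (- x s)\<bar> \<le> path_dist k y x"
  unfolding path_dist_def using assms
  by (intro cSUP_upper path_dist_bdd) auto

lemma path_dist_nonneg:
  assumes "x \<in> skorokhod_space" "y \<in> skorokhod_space"
  shows "0 \<le> path_dist k y x"
  using order_trans[OF abs_ge_zero path_dist_ge_rat[OF assms Rats_0 order_refl]] by simp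

lemma path_dist_le_1:
  assumes "x \<in> skorokhod_space" "y \<in> skorokhod_space"
  shows "path_dist k y x \<le> 1"
  by (intro path_dist_le exp_neg_diff_le_1 skorokhod_space_nonneg[OF assms(1)] skorokhod_space_nonneg[OF assms(2)])

lemma path_dist_commute: "path_dist k y x = path_dist k x y"
  unfolding path_dist_def by (simp add: abs_minus_commute)

lemma path_dist_refl: "path_dist k x x = 0"
proof -
  have "\<rat> \<inter> {0..real k} \<noteq> {}" by (rule rats_Icc_nonempty)
  then show ?thesis by (simp add: path_dist_def)
qed

lemma path_dist_triangle:
  assumes "x \<in> skorokhod_space" "y \<in> skorokhod_space" "z \<in> skorokhod_space"
  shows "path_dist k x z \<le> path_dist k x y + path_dist k y z"
  unfolding path_dist_def[of k x z]
proof (rule cSUP_least)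
  show "\<rat> \<inter> {0..real k} \<noteq> {}" by (rule rats_Icc_nonempty)
  fix s assume "s \<in> \<rat> \<inter> {0..real k}"
  then have "\<bar>exp (- x s) - exp (- y s)\<bar> \<le> path_dist k x y" "\<bar>exp (- y s) - exp (- z s)\<bar> \<le> path_dist k y z"
    using assms by (auto intro!: path_dist_ge_rat)
  then show "\<bar>exp (- x s) - exp (- z s)\<bar> \<le> path_dist k x y + path_dist k y z" by linarith
qed

text \<open>By right-continuity the rational times control all times; the endpoint is excluded because
  it has no rationals to its right in the interval.\<close>

lemma path_dist_ge:
  assumes x: "x \<in> skorokhod_space" and y: "y \<in> skorokhod_space" and s: "0 \<le> s" "s < real k"
  shows "\<bar>exp (- y s) - exp (- x s)\<bar> \<le> path_dist k y x"
proof (rule ccontr)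
  define h where "h u = \<bar>exp (- y u) - exp (- x u)\<bar>" for u
  assume "\<not> ?thesis"
  then have less: "path_dist k y x < h s" by (simp add: h_def)
  have "(x \<longlongrightarrow> x s) (at_right s)" "(y \<longlongrightarrow> y s) (at_right s)"
    using x y s by (simp_all add: skorokhod_space_def cadlag_def continuous_within)
  then have "(h \<longlongrightarrow> h s) (at_right s)" unfolding h_def by (intro tendsto_intros)
  from order_tendstoD(1)[OF this less]
  obtain d where d: "s < d" "\<And>u. s < u \<Longrightarrow> u < d \<Longrightarrow> path_dist k y x < h u"
    unfolding eventually_at_right_field by blast
  obtain q where q: "q \<in> \<rat>" "s < q" "q < min d (real k)"
    using Rats_dense_in_real[of s "min d (real k)"] d(1) s(2) by auto
  then have "h q \<le> path_dist k y x"
    unfolding h_def using s by (intro path_dist_ge_rat[OF x y]) auto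
  with d(2)[of q] q show False by auto
qed

lemma measurable_path_dist:
  assumes X: "\<And>\<omega>. \<omega> \<in> space M \<Longrightarrow> X \<omega> \<in> skorokhod_space" "\<And>t. 0 \<le> t \<Longrightarrow> (\<lambda>\<omega>. X \<omega> t) \<in> borel_measurable M"
    and Y: "\<And>\<omega>. \<omega> \<in> space M \<Longrightarrow> Y \<omega> \<in> skorokhod_space" "\<And>t. 0 \<le> t \<Longrightarrow> (\<lambda>\<omega>. Y \<omega> t) \<in> borel_measurable M"
  shows "(\<lambda>\<omega>. path_dist k (X \<omega>) (Y \<omega>)) \<in> borel_measurable M"
  unfolding path_dist_def
proof (rule borel_measurable_cSUP)
  show "countable (\<rat> \<inter> {0..real k})" by (simp add: countable_rat)
  fix s assume "s \<in> \<rat> \<inter> {0..real k}"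
  then have [measurable]: "(\<lambda>\<omega>. X \<omega> s) \<in> borel_measurable M" "(\<lambda>\<omega>. Y \<omega> s) \<in> borel_measurable M"
    using X(2) Y(2) by simp_all
  show "(\<lambda>\<omega>. \<bar>exp (- X \<omega> s) - exp (- Y \<omega> s)\<bar>) \<in> borel_measurable M" by measurable
next
  fix \<omega> assume "\<omega> \<in> space M"
  then show "bdd_above ((\<lambda>s. \<bar>exp (- X \<omega> s) - exp (- Y \<omega> s)\<bar>) ` (\<rat> \<inter> {0..real k}))"
    by (intro path_dist_bdd X(1) Y(1))
qed

text \<open>The truncation in \<open>exp_step_path\<close> is 1-Lipschitz, and up to time
  \<open>k\<close> only finitely many coordinates occur.\<close>

lemma eventually_path_dist_step_path_le:
  "eventually (\<lambda>z. path_dist k (step_path n z) (step_path n z0) \<le> d) (at z0)" if "0 < d"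
proof -
  have "eventually (\<lambda>z. \<bar>z j - z0 j\<bar> < d) (at z0)" for j :: nat
  proof -
    have "continuous (at z0) (\<lambda>z. z j)"
      by (rule continuous_on_interior[OF continuous_on_product_coordinates]) simp
    then have "((\<lambda>z. z j) \<longlongrightarrow> z0 j) (at z0)" by (simp add: continuous_within)
    from tendstoD[OF this that] show ?thesis by (simp add: dist_real_def)
  qed
  then have "eventually (\<lambda>z. \<forall>j\<in>{..nat \<lfloor>real n * real k\<rfloor>}. \<bar>z j - z0 j\<bar> < d) (at z0)"
    by (intro eventually_ball_finite) auto
  then show ?thesis
  proof eventually_elim
    case (elim z)
    show ?case
    proof (rule path_dist_le)
      fix s :: real assume s: "0 \<le> s" "s \<le> real k"
      define j where "j = nat \<lfloor>real n * s\<rfloor>"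
      have "j \<le> nat \<lfloor>real n * real k\<rfloor>"
        unfolding j_def using s by (intro nat_mono floor_mono mult_left_mono) auto
      with elim have "\<bar>z j - z0 j\<bar> < d" by simp
      then show "\<bar>exp (- step_path n z s) - exp (- step_path n z0 s)\<bar> \<le> d"
        unfolding exp_step_path[OF s(1)] j_def[symmetric] by linarith
    qed
  qed
qed

text \<open>The map \<open>exp (- x)\<close> flattens at infinity, so its increments are bounded
  below only as long as \<open>b\<close> stays below a level \<open>C\<close>. The threshold is the
  drop from \<open>C\<close> to \<open>C + d\<close>, the smallest one that can occur.\<close>

lemma exp_neg_separated:
  fixes a b C d :: real
  assumes "b \<le> C" "0 < d" "\<bar>exp (- a) - exp (- b)\<bar> < exp (- C) * (1 - exp (- d))"
  shows "\<bar>a - b\<bar> \<le> d"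
proof (rule ccontr)
  assume "\<not> \<bar>a - b\<bar> \<le> d"
  then consider "b + d < a" | "a < b - d" by linarith
  then have "exp (- b) * (1 - exp (- d)) \<le> \<bar>exp (- a) - exp (- b)\<bar>"
  proof cases
    case 1
    then have "exp (- a) \<le> exp (- b) * exp (- d)" by (simp add: exp_add[symmetric])
    then show ?thesis by (simp add: right_diff_distrib)
  next
    case 2
    then have *: "exp (- b) * exp d \<le> exp (- a)" by (simp add: exp_add[symmetric])
    have "1 - exp (- d) \<le> exp d - 1"
      using exp_ge_add_one_self[of d] exp_ge_add_one_self[of "- d"] by linarith
    then have "exp (- b) * (1 - exp (- d)) \<le> exp (- b) * (exp d - 1)"
      by (intro mult_left_mono) auto
    with * show ?thesis by (simp add: right_diff_distrib)
  qed
  moreover have "exp (- C) * (1 - exp (- d)) \<le> exp (- b) * (1 - exp (- d))"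
    using assms by (intro mult_right_mono) auto
  ultimately show False using assms(3) by linarith
qed

text \<open>The Lipschitz envelope of \<open>f\<close> with respect to the pseudometric \<open>path_dist k\<close>: it is
  determined up to a small error by the values of the path on a grid.\<close>

definition lipschitz_envelope :: "((real \<Rightarrow> real) \<Rightarrow> real) \<Rightarrow> nat \<Rightarrow> (real \<Rightarrow> real) \<Rightarrow> real" where
  "lipschitz_envelope f k x = (INF y\<in>skorokhod_space. f y + real k * path_dist k y x)"

context
  fixes f :: "(real \<Rightarrow> real) \<Rightarrow> real" and B :: real
  assumes f_bound: "\<And>x. x \<in> skorokhod_space \<Longrightarrow> \<bar>f x\<bar> \<le> B"
begin

lemma lipschitz_envelope_bdd:
  assumes "x \<in> skorokhod_space"
  shows "bdd_below ((\<lambda>y. f y + real k * path_dist k y x) ` skorokhod_space)"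
proof (rule bdd_belowI2)
  fix y assume y: "y \<in> skorokhod_space"
  have "0 \<le> real k * path_dist k y x" using path_dist_nonneg[OF assms y] by simp
  then show "- B \<le> f y + real k * path_dist k y x" using f_bound[OF y] by linarith
qed

lemma lipschitz_envelope_le: "x \<in> skorokhod_space \<Longrightarrow> lipschitz_envelope f k x \<le> f x"
  unfolding lipschitz_envelope_def
  using cINF_lower[OF lipschitz_envelope_bdd, of x x k] by (simp add: path_dist_refl)

lemma lipschitz_envelope_lipschitz:
  assumes x: "x \<in> skorokhod_space" and x': "x' \<in> skorokhod_space"
  shows "\<bar>lipschitz_envelope f k x - lipschitz_envelope f k x'\<bar> \<le> real k * path_dist k x x'"
proof -
  have *: "lipschitz_envelope f k x - real k * path_dist k x x' \<le> lipschitz_envelope f k x'"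
    if x: "x \<in> skorokhod_space" and x': "x' \<in> skorokhod_space" for x x'
    unfolding lipschitz_envelope_def[of f k x']
  proof (rule cINF_greatest)
    show "skorokhod_space \<noteq> {}" using x by blast
    fix y assume y: "y \<in> skorokhod_space"
    have "lipschitz_envelope f k x \<le> f y + real k * path_dist k y x"
      unfolding lipschitz_envelope_def by (rule cINF_lower[OF lipschitz_envelope_bdd[OF x] y])
    also have "real k * path_dist k y x \<le> real k * (path_dist k y x' + path_dist k x' x)"
      by (intro mult_left_mono path_dist_triangle y x x') simp
    finally show "lipschitz_envelope f k x - real k * path_dist k x x' \<le> f y + real k * path_dist k y x'"
      by (simp add: path_dist_commute[of k x x'] distrib_left)
  qed
  show ?thesis using *[OF x x'] *[OF x' x] by (simp add: path_dist_commute[of k x' x] abs_le_iff)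
qed

lemma lipschitz_envelope_bound:
  assumes "x \<in> skorokhod_space"
  shows "\<bar>lipschitz_envelope f k x\<bar> \<le> B"
proof -
  have "- B \<le> lipschitz_envelope f k x"
    unfolding lipschitz_envelope_def
  proof (rule cINF_greatest)
    show "skorokhod_space \<noteq> {}" using assms by blast
    fix y assume y: "y \<in> skorokhod_space"
    have "0 \<le> real k * path_dist k y x" using path_dist_nonneg[OF assms y] by simp
    then show "- B \<le> f y + real k * path_dist k y x" using f_bound[OF y] by linarith
  qed
  with lipschitz_envelope_le[OF assms, of k] f_bound[OF assms] show ?thesis by linarith
qed

lemma continuous_lipschitz_envelope_step_path:
  "continuous_on UNIV (\<lambda>z. lipschitz_envelope f k (step_path n z))"
proof -
  have "((\<lambda>z. lipschitz_envelope f k (step_path n z)) \<longlongrightarrow> lipschitz_envelope f k (step_path n z0)) (at z0)" for z0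
  proof (rule tendstoI)
    fix e :: real assume e: "0 < e"
    \<comment> \<open>\<open>K\<close> serves as a divisor; the added 1 covers
      \<open>k = 0\<close>.\<close>
    define K where "K = real k + 1"
    define d where "d = e / (2 * K)"
    have K: "0 < K" "real k \<le> K" by (simp_all add: K_def)
    have d: "0 < d" using e K by (simp add: d_def)
    have "real k * d \<le> K * d" using d K by (intro mult_right_mono) auto
    also have "\<dots> = e / 2" using K by (simp add: d_def)
    finally have kd: "real k * d < e" using e by linarith
    from eventually_path_dist_step_path_le[OF d, of k n z0]
    show "eventually (\<lambda>z. dist (lipschitz_envelope f k (step_path n z)) (lipschitz_envelope f k (step_path n z0)) < e) (at z0)"
    proof eventually_elim
      case (elim z)
      have "real k * path_dist k (step_path n z) (step_path n z0) \<le> real k * d"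
        using elim by (intro mult_left_mono) auto
      then show ?case
        using lipschitz_envelope_lipschitz[OF step_path_in_skorokhod_space step_path_in_skorokhod_space, of k n z n z0] kd
        unfolding dist_real_def by linarith
    qed
  qed
  then show ?thesis by (simp add: continuous_on_eq_continuous_at continuous_within)
qed

text \<open>Paths \<open>y\<close> with \<open>path_dist k y x < \<eta>\<close> are uniformly close
  to \<open>x\<close> up to time \<open>T\<close>, so that \<open>f y\<close> exceeds
  \<open>f x - \<epsilon>/2\<close>. For all others the penalty is at least
  \<open>k * \<eta>\<close>, which exceeds \<open>2 * B\<close>, so they do not compete in the
  infimum.\<close>

lemma lipschitz_envelope_tendsto:
  assumes cont: "continuous_map skorokhod_topology euclideanreal f" and x: "x \<in> skorokhod_space"
  shows "(\<lambda>k. lipschitz_envelope f k x) \<longlonglongrightarrow> f x"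
proof (rule tendstoI)
  fix \<epsilon> :: real assume \<epsilon>: "0 < \<epsilon>"
  have "openin skorokhod_topology {y \<in> topspace skorokhod_topology. f y \<in> {f x - \<epsilon>/2<..}}"
    by (rule openin_continuous_map_preimage[OF cont]) simp
  moreover have "x \<in> {y \<in> topspace skorokhod_topology. f y \<in> {f x - \<epsilon>/2<..}}" using x \<epsilon> by simp
  ultimately obtain T e where e: "0 < e"
    and sub: "skorokhod_nbhd x T e \<subseteq> {y \<in> topspace skorokhod_topology. f y \<in> {f x - \<epsilon>/2<..}}"
    unfolding openin_skorokhod by blast
  have "cadlag x" using x by (simp add: skorokhod_space_def)
  then obtain C where C: "\<And>s. 0 \<le> s \<Longrightarrow> s \<le> T \<Longrightarrow> \<bar>x s\<bar> \<le> C" by (rule cadlag_bounded) (rule that)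
  define \<eta> where "\<eta> = exp (- C) * (1 - exp (- (e / 2)))"
  have \<eta>: "0 < \<eta>" using e by (simp add: \<eta>_def)
  \<comment> \<open>\<open>path_dist k\<close> controls the times before \<open>k\<close> only,
    hence the strict inequality with \<open>T\<close>.\<close>
  have "eventually (\<lambda>k. max T (2 * B / \<eta>) < real k) sequentially"
    using eventually_gt_at_top[of "nat \<lceil>max T (2 * B / \<eta>)\<rceil>"] by eventually_elim linarith
  then show "eventually (\<lambda>k. dist (lipschitz_envelope f k x) (f x) < \<epsilon>) sequentially"
  proof eventually_elim
    case (elim k)
    have "f x - \<epsilon>/2 \<le> lipschitz_envelope f k x"
      unfolding lipschitz_envelope_def
    proof (rule cINF_greatest)
      show "skorokhod_space \<noteq> {}" using x by blast
      fix y assume y: "y \<in> skorokhod_space"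
      have nn: "0 \<le> real k * path_dist k y x" using path_dist_nonneg[OF x y] by simp
      show "f x - \<epsilon>/2 \<le> f y + real k * path_dist k y x"
      proof (cases "path_dist k y x < \<eta>")
        case True
        have "\<bar>y s - x s\<bar> \<le> e / 2" if s: "0 \<le> s" "s \<le> T" for s
        proof (rule exp_neg_separated)
          show "x s \<le> C" using C[OF s] by linarith
          have "s < real k" using s elim by linarith
          from path_dist_ge[OF x y s(1) this] True
          show "\<bar>exp (- y s) - exp (- x s)\<bar> < exp (- C) * (1 - exp (- (e / 2)))"
            unfolding \<eta>_def by linarith
        qed (use e in simp)
        then have "y \<in> skorokhod_nbhd x T e"
          using y e by (intro uniform_in_skorokhod_nbhd[where d = "e / 2"]) auto
        with sub have "f x - \<epsilon>/2 < f y" by blast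
        with nn show ?thesis by linarith
      next
        case False
        have "2 * B / \<eta> < real k" using elim by linarith
        then have "2 * B < real k * \<eta>" using \<eta> by (simp add: divide_less_eq)
        also have "\<dots> \<le> real k * path_dist k y x" using False by (intro mult_left_mono) auto
        finally show ?thesis using f_bound[OF x] f_bound[OF y] \<epsilon> by linarith
      qed
    qed
    with lipschitz_envelope_le[OF x, of k] \<epsilon> show ?case unfolding dist_real_def by linarith
  qed
qed

end

section \<open>From envelopes to expectations\<close>

lemma measurable_grid_values:
  assumes "\<And>t. 0 \<le> t \<Longrightarrow> (\<lambda>\<omega>. X \<omega> t) \<in> borel_measurable M"
  shows "(\<lambda>\<omega>. grid_values n (X \<omega>)) \<in> borel_measurable M"
  unfolding grid_values_def using assms
  by (intro measurable_coordinatewise_then_product) auto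

lemma measurable_step_path:
  assumes "\<And>t. 0 \<le> t \<Longrightarrow> (\<lambda>\<omega>. X \<omega> t) \<in> borel_measurable M" and t: "0 \<le> t"
  shows "(\<lambda>\<omega>. step_path n (grid_values n (X \<omega>)) t) \<in> borel_measurable M"
proof -
  have [measurable]: "(\<lambda>\<omega>. X \<omega> (real j / real n)) \<in> borel_measurable M" for j
    using assms(1) by simp
  have "(\<lambda>\<omega>. - ln (min 1 (max (exp (- X \<omega> (real j / real n))) (exp (- real n))))) \<in> borel_measurable M" for j
    by measurable
  then show ?thesis using t by (simp only: step_path_def grid_values_def restrict_apply atLeast_iff if_True)
qed

lemma continuous_map_measurable_borel_of:
  assumes "continuous_map T euclideanreal f"
  shows "f \<in> borel_of T \<rightarrow>\<^sub>M borel"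
proof (rule borel_measurableI)
  fix S :: "real set" assume "open S"
  then have "openin T {x \<in> topspace T. f x \<in> S}"
    using openin_continuous_map_preimage[OF assms] by simp
  moreover have "{U. openin T U} \<subseteq> Pow (topspace T)" using openin_subset by blast
  moreover have "f -` S \<inter> topspace T = {x \<in> topspace T. f x \<in> S}" by blast
  ultimately show "f -` S \<inter> space (borel_of T) \<in> sets (borel_of T)"
    by (simp add: borel_of_def space_measure_of_conv sets_measure_of_conv sigma_sets.Basic)
qed

lemma integrable_path_dist_step:
  assumes "prob_space M" and X: "\<And>\<omega>. \<omega> \<in> space M \<Longrightarrow> X \<omega> \<in> skorokhod_space"
    "\<And>t. 0 \<le> t \<Longrightarrow> (\<lambda>\<omega>. X \<omega> t) \<in> borel_measurable M"
  shows "integrable M (\<lambda>\<omega>. path_dist k (X \<omega>) (step_path n (grid_values n (X \<omega>))))"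
proof -
  interpret prob_space M by fact
  show ?thesis
  proof (rule integrable_const_bound)
    show "(\<lambda>\<omega>. path_dist k (X \<omega>) (step_path n (grid_values n (X \<omega>)))) \<in> borel_measurable M"
      by (rule measurable_path_dist) (rule X step_path_in_skorokhod_space measurable_step_path | assumption)+
    show "AE \<omega> in M. norm (path_dist k (X \<omega>) (step_path n (grid_values n (X \<omega>)))) \<le> 1"
    proof (rule AE_I2)
      fix \<omega> assume "\<omega> \<in> space M"
      note * = step_path_in_skorokhod_space X(1)[OF this]
      show "norm (path_dist k (X \<omega>) (step_path n (grid_values n (X \<omega>)))) \<le> 1"
        using path_dist_nonneg[OF *] path_dist_le_1[OF *] by simp
    qed
  qed
qed

text \<open>With a mean discretisation error of at most \<open>1 / (k + 1)\<^sup>2\<close>, the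
  Lipschitz constant \<open>k\<close> costs at most \<open>1 / (k + 1)\<close>. Up to this cost the
  expectation of \<open>f\<close> is bounded below by that of the envelope at the discretised path,
  a continuous function of grid values, whose expectation converges. The margin \<open>e\<close> is
  split between this cost, the convergence on the grid and the distance from envelope to
  \<open>f\<close> in the limit.\<close>

lemma eventually_expectation_ge:
  assumes X: "eventually (\<lambda>i. prob_space (M i) \<and> (\<forall>\<omega>\<in>space (M i). X i \<omega> \<in> skorokhod_space) \<and>
      (\<forall>t\<ge>0. (\<lambda>\<omega>. X i \<omega> t) \<in> borel_measurable (M i))) F"
    and N: "prob_space N" and Y: "\<And>\<omega>. \<omega> \<in> space N \<Longrightarrow> Y \<omega> \<in> skorokhod_space"
      "\<And>t. 0 \<le> t \<Longrightarrow> (\<lambda>\<omega>. Y \<omega> t) \<in> borel_measurable N"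
    and fdd: "\<And>n (g :: (nat \<Rightarrow> real) \<Rightarrow> real). 0 < n \<Longrightarrow> continuous_on UNIV g \<Longrightarrow>
      ((\<lambda>i. \<integral>\<omega>. g (grid_values n (X i \<omega>)) \<partial>M i) \<longlongrightarrow> (\<integral>\<omega>. g (grid_values n (Y \<omega>)) \<partial>N)) F"
    and tight: "\<And>k e. 0 < e \<Longrightarrow> \<exists>n>0.
      (\<integral>\<omega>. path_dist k (Y \<omega>) (step_path n (grid_values n (Y \<omega>))) \<partial>N) \<le> e \<and>
      eventually (\<lambda>i. (\<integral>\<omega>. path_dist k (X i \<omega>) (step_path n (grid_values n (X i \<omega>))) \<partial>M i) \<le> e) F"
    and f: "continuous_map skorokhod_topology euclideanreal f"
    and B: "\<And>x. x \<in> skorokhod_space \<Longrightarrow> \<bar>f x\<bar> \<le> B" and e: "0 < e"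
  shows "eventually (\<lambda>i. (\<integral>\<omega>. f (X i \<omega>) \<partial>M i) \<ge> (\<integral>\<omega>. f (Y \<omega>) \<partial>N) - e) F"
proof -
  define P where "P k n \<longleftrightarrow> 0 < n \<and>
      (\<integral>\<omega>. path_dist k (Y \<omega>) (step_path n (grid_values n (Y \<omega>))) \<partial>N) \<le> 1 / (real k + 1)^2 \<and>
      eventually (\<lambda>i. (\<integral>\<omega>. path_dist k (X i \<omega>) (step_path n (grid_values n (X i \<omega>))) \<partial>M i)
        \<le> 1 / (real k + 1)^2) F" for k n
  have "\<exists>n. P k n" for k
    unfolding P_def by (rule tight) (simp add: add_nonneg_pos)
  then obtain n where n_P: "\<And>k. P k (n k)" using choice[of P] by blast
  have n: "0 < n k"
    and nY: "(\<integral>\<omega>. path_dist k (Y \<omega>) (step_path (n k) (grid_values (n k) (Y \<omega>))) \<partial>N) \<le> 1 / (real k + 1)^2"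
    and nX: "eventually (\<lambda>i. (\<integral>\<omega>. path_dist k (X i \<omega>) (step_path (n k) (grid_values (n k) (X i \<omega>))) \<partial>M i)
        \<le> 1 / (real k + 1)^2) F" for k
    using n_P[of k] unfolding P_def by (simp_all only:)
  define g where "g k z = lipschitz_envelope f k (step_path (n k) z)" for k z
  have gcont: "continuous_on UNIV (g k)" for k
    unfolding g_def by (rule continuous_lipschitz_envelope_step_path) (rule B)
  have gmeas: "g k \<in> borel_measurable borel" for k
    by (rule borel_measurable_continuous_onI[OF gcont])
  have gB: "\<bar>g k z\<bar> \<le> B" for k z
    unfolding g_def by (rule lipschitz_envelope_bound[OF B step_path_in_skorokhod_space])
  have small: "real k * (1 / (real k + 1)^2) \<le> 1 / (real k + 1)" for k
  proof -
    define K where "K = real k + 1"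
    have K: "0 < K" "real k \<le> K" by (simp_all add: K_def)
    have "real k * (1 / K^2) \<le> K * (1 / K^2)" using K by (intro mult_right_mono) auto
    also have "\<dots> = 1 / K" using K by (simp add: power2_eq_square)
    finally show ?thesis by (simp only: K_def)
  qed
  define u where "u k \<omega> = real k * path_dist k (Y \<omega>) (step_path (n k) (grid_values (n k) (Y \<omega>)))" for k \<omega>
  have u_int: "integrable N (u k)" for k
    unfolding u_def by (intro integrable_mult_right integrable_path_dist_step N Y)
  have u_nonneg: "0 \<le> u k \<omega>" if "\<omega> \<in> space N" for k \<omega>
    unfolding u_def by (intro mult_nonneg_nonneg path_dist_nonneg step_path_in_skorokhod_space Y that) simp
  have u_lim: "(\<lambda>k. \<integral>\<omega>. norm (u k \<omega>) \<partial>N) \<longlonglongrightarrow> 0"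
  proof (rule tendsto_sandwich[OF _ _ tendsto_const])
    show "(\<lambda>k. 1 / (real k + 1)) \<longlonglongrightarrow> 0"
      using LIMSEQ_inverse_real_of_nat by (simp add: inverse_eq_divide add.commute)
    have "(\<integral>\<omega>. norm (u k \<omega>) \<partial>N) \<le> 1 / (real k + 1)" for k
    proof -
      have "(\<integral>\<omega>. norm (u k \<omega>) \<partial>N) = (\<integral>\<omega>. u k \<omega> \<partial>N)"
        using u_nonneg by (intro Bochner_Integration.integral_cong) auto
      also have "\<dots> \<le> real k * (1 / (real k + 1)^2)"
        unfolding u_def by (simp only: integral_mult_right_zero) (intro mult_left_mono nY, simp)
      finally show ?thesis using small[of k] by linarith
    qed
    then show "eventually (\<lambda>k. (\<integral>\<omega>. norm (u k \<omega>) \<partial>N) \<le> 1 / (real k + 1)) sequentially" by simp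
  qed simp
  \<comment> \<open>Convergence in mean gives almost sure convergence along a subsequence; this is
    enough, since in the end a single large index is used.\<close>
  obtain r where r: "strict_mono (r :: nat \<Rightarrow> nat)" and ur: "AE \<omega> in N. (\<lambda>j. u (r j) \<omega>) \<longlonglongrightarrow> 0"
    using tendsto_L1_AE_subseq[OF u_int u_lim] by blast
  have fY_meas: "(\<lambda>\<omega>. f (Y \<omega>)) \<in> borel_measurable N"
    using measurable_comp[OF measurable_borel_of_skorokhod[of N Y, OF Y] continuous_map_measurable_borel_of[OF f]]
    by (simp add: comp_def)
  have gr_lim: "(\<lambda>j. \<integral>\<omega>. g (r j) (grid_values (n (r j)) (Y \<omega>)) \<partial>N) \<longlonglongrightarrow> (\<integral>\<omega>. f (Y \<omega>) \<partial>N)"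
  proof (rule integral_dominated_convergence[where w = "\<lambda>_. B"])
    interpret prob_space N by (rule N)
    show "integrable N (\<lambda>_. B)" by simp
    show "(\<lambda>\<omega>. f (Y \<omega>)) \<in> borel_measurable N" by (rule fY_meas)
    show "(\<lambda>\<omega>. g (r j) (grid_values (n (r j)) (Y \<omega>))) \<in> borel_measurable N" for j
      by (rule measurable_compose[OF measurable_grid_values gmeas]) (rule Y)
    show "AE \<omega> in N. norm (g (r j) (grid_values (n (r j)) (Y \<omega>))) \<le> B" for j
      using gB by simp
    show "AE \<omega> in N. (\<lambda>j. g (r j) (grid_values (n (r j)) (Y \<omega>))) \<longlonglongrightarrow> f (Y \<omega>)"
      using ur AE_space
    proof eventually_elim
      case (elim \<omega>)
      have lim: "(\<lambda>j. lipschitz_envelope f (r j) (Y \<omega>)) \<longlonglongrightarrow> f (Y \<omega>)"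
        using LIMSEQ_subseq_LIMSEQ[OF lipschitz_envelope_tendsto[OF B f Y(1)[OF elim(2)]] r]
        by (simp add: comp_def)
      have diff: "\<bar>lipschitz_envelope f (r j) (Y \<omega>) - g (r j) (grid_values (n (r j)) (Y \<omega>))\<bar> \<le> u (r j) \<omega>" for j
        unfolding g_def u_def
        by (rule lipschitz_envelope_lipschitz[OF B Y(1)[OF elim(2)] step_path_in_skorokhod_space])
      have "(\<lambda>j. lipschitz_envelope f (r j) (Y \<omega>) - g (r j) (grid_values (n (r j)) (Y \<omega>))) \<longlonglongrightarrow> 0"
        by (rule Lim_null_comparison[OF _ elim(1)]) (use diff in simp)
      from tendsto_diff[OF lim this] show ?case by simp
    qed
  qed
  have "eventually (\<lambda>j. (\<integral>\<omega>. g (r j) (grid_values (n (r j)) (Y \<omega>)) \<partial>N) > (\<integral>\<omega>. f (Y \<omega>) \<partial>N) - e / 3) sequentially"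
    using order_tendstoD(1)[OF gr_lim] e by simp
  moreover have "eventually (\<lambda>j. 3 / e < real j) sequentially"
    using eventually_gt_at_top[of "nat \<lceil>3 / e\<rceil>"] by eventually_elim linarith
  ultimately have "eventually (\<lambda>j. (\<integral>\<omega>. g (r j) (grid_values (n (r j)) (Y \<omega>)) \<partial>N) > (\<integral>\<omega>. f (Y \<omega>) \<partial>N) - e / 3
    \<and> 3 / e < real j) sequentially" by (rule eventually_conj)
  then obtain j where j: "(\<integral>\<omega>. g (r j) (grid_values (n (r j)) (Y \<omega>)) \<partial>N) > (\<integral>\<omega>. f (Y \<omega>) \<partial>N) - e / 3"
    "3 / e < real j" using eventually_happens'[OF sequentially_bot] by blast
  define k where "k = r j"
  have "real j \<le> real k" using seq_suble[OF r] by (simp add: k_def)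
  then have "3 / e < real k + 1" using j(2) by linarith
  then have k: "1 / (real k + 1) < e / 3" using e by (simp add: field_simps)
  have "eventually (\<lambda>i. (\<integral>\<omega>. g k (grid_values (n k) (X i \<omega>)) \<partial>M i) > (\<integral>\<omega>. g k (grid_values (n k) (Y \<omega>)) \<partial>N) - e / 3) F"
    using order_tendstoD(1)[OF fdd[OF n gcont]] e by simp
  with X nX[of k] show ?thesis
  proof eventually_elim
    case (elim i)
    then have XD: "\<And>\<omega>. \<omega> \<in> space (M i) \<Longrightarrow> X i \<omega> \<in> skorokhod_space"
      and Xm: "\<And>t. 0 \<le> t \<Longrightarrow> (\<lambda>\<omega>. X i \<omega> t) \<in> borel_measurable (M i)" by blast+
    interpret prob_space "M i" using elim by blast
    let ?d = "\<lambda>\<omega>. path_dist k (X i \<omega>) (step_path (n k) (grid_values (n k) (X i \<omega>)))"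
    have d_int: "integrable (M i) ?d"
      by (rule integrable_path_dist_step[OF prob_space_axioms XD Xm])
    have g_int: "integrable (M i) (\<lambda>\<omega>. g k (grid_values (n k) (X i \<omega>)))"
      by (rule integrable_const_bound[of _ B]) (use gB in simp, rule measurable_compose[OF measurable_grid_values[OF Xm] gmeas])
    have "(\<lambda>\<omega>. f (X i \<omega>)) \<in> borel_measurable (M i)"
      using measurable_comp[OF measurable_borel_of_skorokhod[of "M i" "X i", OF XD Xm] continuous_map_measurable_borel_of[OF f]]
      by (simp add: comp_def)
    then have f_int: "integrable (M i) (\<lambda>\<omega>. f (X i \<omega>))"
      using B XD by (intro integrable_const_bound[of _ B]) auto
    have "(\<integral>\<omega>. g k (grid_values (n k) (X i \<omega>)) \<partial>M i) - real k * (\<integral>\<omega>. ?d \<omega> \<partial>M i)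
        = (\<integral>\<omega>. g k (grid_values (n k) (X i \<omega>)) - real k * ?d \<omega> \<partial>M i)"
      using g_int d_int by simp
    also have "\<dots> \<le> (\<integral>\<omega>. f (X i \<omega>) \<partial>M i)"
    proof (rule integral_mono)
      show "integrable (M i) (\<lambda>\<omega>. g k (grid_values (n k) (X i \<omega>)) - real k * ?d \<omega>)"
        by (intro Bochner_Integration.integrable_diff integrable_mult_right g_int d_int)
      fix \<omega> assume \<omega>: "\<omega> \<in> space (M i)"
      have "\<bar>lipschitz_envelope f k (X i \<omega>) - g k (grid_values (n k) (X i \<omega>))\<bar> \<le> real k * ?d \<omega>"
        unfolding g_def by (rule lipschitz_envelope_lipschitz[OF B XD[OF \<omega>] step_path_in_skorokhod_space])
      moreover have "lipschitz_envelope f k (X i \<omega>) \<le> f (X i \<omega>)"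
        by (rule lipschitz_envelope_le[OF B XD[OF \<omega>]])
      ultimately show "g k (grid_values (n k) (X i \<omega>)) - real k * ?d \<omega> \<le> f (X i \<omega>)" by linarith
    qed (rule f_int)
    finally have "(\<integral>\<omega>. g k (grid_values (n k) (X i \<omega>)) \<partial>M i) - real k * (\<integral>\<omega>. ?d \<omega> \<partial>M i) \<le> (\<integral>\<omega>. f (X i \<omega>) \<partial>M i)" .
    moreover have "real k * (\<integral>\<omega>. ?d \<omega> \<partial>M i) \<le> real k * (1 / (real k + 1)^2)"
      using elim(2) by (intro mult_left_mono) auto
    ultimately show ?case using elim(3) small[of k] k j(1) unfolding k_def[symmetric] by linarith
  qed
qed

text \<open>Envelopes bound expectations from below only; the other half comes from applying the
  bound to \<open>- f\<close>. The test functions \<open>g\<close> carry no bound, as the grid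
  values of nonnegative paths lie in a compact cube.\<close>

theorem converges_in_distribution_skorokhodI:
  assumes X: "eventually (\<lambda>i. prob_space (M i) \<and> (\<forall>\<omega>\<in>space (M i). X i \<omega> \<in> skorokhod_space) \<and>
      (\<forall>t\<ge>0. (\<lambda>\<omega>. X i \<omega> t) \<in> borel_measurable (M i))) F"
    and N: "prob_space N" and Y: "\<And>\<omega>. \<omega> \<in> space N \<Longrightarrow> Y \<omega> \<in> skorokhod_space"
      "\<And>t. 0 \<le> t \<Longrightarrow> (\<lambda>\<omega>. Y \<omega> t) \<in> borel_measurable N"
    and fdd: "\<And>n (g :: (nat \<Rightarrow> real) \<Rightarrow> real). 0 < n \<Longrightarrow> continuous_on UNIV g \<Longrightarrow>
      ((\<lambda>i. \<integral>\<omega>. g (grid_values n (X i \<omega>)) \<partial>M i) \<longlongrightarrow> (\<integral>\<omega>. g (grid_values n (Y \<omega>)) \<partial>N)) F"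
    and tight: "\<And>k e. 0 < e \<Longrightarrow> \<exists>n>0.
      (\<integral>\<omega>. path_dist k (Y \<omega>) (step_path n (grid_values n (Y \<omega>))) \<partial>N) \<le> e \<and>
      eventually (\<lambda>i. (\<integral>\<omega>. path_dist k (X i \<omega>) (step_path n (grid_values n (X i \<omega>))) \<partial>M i) \<le> e) F"
  shows "converges_in_distribution skorokhod_topology M X N Y F"
  unfolding converges_in_distribution_def
proof (intro conjI allI impI)
  show "eventually (\<lambda>i. X i \<in> M i \<rightarrow>\<^sub>M borel_of skorokhod_topology) F"
    using X
  proof eventually_elim
    case (elim i)
    then show ?case by (intro measurable_borel_of_skorokhod) blast+
  qed
  show "Y \<in> N \<rightarrow>\<^sub>M borel_of skorokhod_topology" by (rule measurable_borel_of_skorokhod[OF Y])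
  fix f :: "(real \<Rightarrow> real) \<Rightarrow> real"
  assume "continuous_map skorokhod_topology euclideanreal f \<and> bounded (f ` topspace skorokhod_topology)"
  then obtain B where f: "continuous_map skorokhod_topology euclideanreal f"
    and B: "\<And>x. x \<in> skorokhod_space \<Longrightarrow> \<bar>f x\<bar> \<le> B"
    unfolding bounded_iff by auto
  show "((\<lambda>i. \<integral>\<omega>. f (X i \<omega>) \<partial>M i) \<longlongrightarrow> (\<integral>\<omega>. f (Y \<omega>) \<partial>N)) F"
  proof (rule tendstoI)
    fix e :: real assume "0 < e"
    then have e: "0 < e / 2" by simp
    have mf: "continuous_map skorokhod_topology euclideanreal (\<lambda>x. - f x)"
      using f by (rule continuous_map_minus)
    have mB: "\<bar>- f x\<bar> \<le> B" if "x \<in> skorokhod_space" for x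
      unfolding abs_minus_cancel by (rule B[OF that])
    have "eventually (\<lambda>i. (\<integral>\<omega>. f (X i \<omega>) \<partial>M i) \<ge> (\<integral>\<omega>. f (Y \<omega>) \<partial>N) - e / 2) F"
      by (rule eventually_expectation_ge[OF X N Y fdd tight f B e])
    moreover have "eventually (\<lambda>i. (\<integral>\<omega>. - f (X i \<omega>) \<partial>M i) \<ge> (\<integral>\<omega>. - f (Y \<omega>) \<partial>N) - e / 2) F"
      by (rule eventually_expectation_ge[OF X N Y fdd tight mf mB e])
    ultimately show "eventually (\<lambda>i. dist (\<integral>\<omega>. f (X i \<omega>) \<partial>M i) (\<integral>\<omega>. f (Y \<omega>) \<partial>N) < e) F"
    proof eventually_elim
      case (elim i)
      then show ?case using \<open>0 < e\<close> unfolding dist_real_def integral_minus by linarith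
    qed
  qed
qed


subsection \<open>Tightness for affine Markov processes\<close>

text \<open>In this description of an affine Markov process the transition kernel enters only through its
  Laplace transform, which is all that the estimates below need.\<close>

locale laplace_markov = prob_space M for M :: "'a measure" +
  fixes G :: "real \<Rightarrow> 'a measure" and X :: "real \<Rightarrow> 'a \<Rightarrow> real" and V \<Phi> :: "real \<Rightarrow> real \<Rightarrow> real"
  assumes subalg: "\<And>s. 0 \<le> s \<Longrightarrow> subalgebra M (G s)"
    and adapted: "\<And>u s. 0 \<le> u \<Longrightarrow> u \<le> s \<Longrightarrow> X u \<in> borel_measurable (G s)"
    and nonneg: "\<And>t \<omega>. 0 \<le> t \<Longrightarrow> \<omega> \<in> space M \<Longrightarrow> 0 \<le> X t \<omega>"
    and cadlag_paths: "\<And>\<omega>. \<omega> \<in> space M \<Longrightarrow> cadlag (\<lambda>t. X t \<omega>)"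
    and V_nonneg: "\<And>t z. 0 \<le> t \<Longrightarrow> 0 \<le> z \<Longrightarrow> 0 \<le> V t z"
    and markov: "\<And>s t z U. 0 \<le> s \<Longrightarrow> 0 \<le> t \<Longrightarrow> 0 \<le> z \<Longrightarrow> U \<in> borel_measurable (G s) \<Longrightarrow>
      (\<And>\<omega>. \<omega> \<in> space M \<Longrightarrow> 0 \<le> U \<omega> \<and> U \<omega> \<le> 1) \<Longrightarrow>
      (\<integral>\<omega>. U \<omega> * exp (- z * X (s + t) \<omega>) \<partial>M) = (\<integral>\<omega>. U \<omega> * exp (- X s \<omega> * V t z - \<Phi> t z) \<partial>M)"

definition path_of :: "(real \<Rightarrow> 'a \<Rightarrow> real) \<Rightarrow> 'a \<Rightarrow> real \<Rightarrow> real" where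
  "path_of X = (\<lambda>\<omega>. \<lambda>t\<in>{0..}. X t \<omega>)"

text \<open>The conditional fourth moment of the increment of \<open>exp (- X)\<close> over a time \<open>t\<close>, given the
  starting value \<open>x\<close>.\<close>

definition kernel4 :: "(real \<Rightarrow> real \<Rightarrow> real) \<Rightarrow> (real \<Rightarrow> real \<Rightarrow> real) \<Rightarrow> real \<Rightarrow> real \<Rightarrow> real" where
  "kernel4 V \<Phi> t x = (\<Sum>k\<le>4. real (4 choose k) * (- 1) ^ (4 - k) *
     (exp (- x) ^ (4 - k) * exp (- x * V t (real k) - \<Phi> t (real k))))"

context laplace_markov
begin

lemma X_measurable: "0 \<le> t \<Longrightarrow> X t \<in> borel_measurable M"
  by (rule measurable_from_subalg[OF subalg adapted[OF _ order_refl]])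

lemma space_G: "0 \<le> s \<Longrightarrow> space (G s) = space M"
  using subalg by (simp add: subalgebra_def)

lemma path_of_in_skorokhod_space: "\<omega> \<in> space M \<Longrightarrow> path_of X \<omega> \<in> skorokhod_space"
  using cadlag_cong[of "path_of X \<omega>" "\<lambda>t. X t \<omega>"] cadlag_paths[of \<omega>]
  by (simp add: skorokhod_space_def path_of_def nonneg)

lemma path_of_measurable: "0 \<le> t \<Longrightarrow> (\<lambda>\<omega>. path_of X \<omega> t) \<in> borel_measurable M"
  using X_measurable[of t] by (simp add: path_of_def)

lemma bounded_integrable:
  fixes f :: "'a \<Rightarrow> real"
  assumes "f \<in> borel_measurable M" "\<And>\<omega>. \<omega> \<in> space M \<Longrightarrow> \<bar>f \<omega>\<bar> \<le> C"
  shows "integrable M f"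
  using assms by (intro integrable_const_bound[where B = C]) auto

text \<open>In the binomial expansion the factor
  \<open>U \<omega> * exp (- X s \<omega>) ^ (4 - k)\<close> is known at time \<open>s\<close> and
  lies between 0 and 1, so \<open>markov\<close> applies to each power with
  \<open>z = k\<close>.\<close>

lemma expectation_fourth_power:
  assumes s: "0 \<le> s" and t: "0 \<le> t" and U: "U \<in> borel_measurable (G s)"
    "\<And>\<omega>. \<omega> \<in> space M \<Longrightarrow> 0 \<le> U \<omega> \<and> U \<omega> \<le> 1"
  shows "(\<integral>\<omega>. U \<omega> * (exp (- X (s + t) \<omega>) - exp (- X s \<omega>)) ^ 4 \<partial>M) = (\<integral>\<omega>. U \<omega> * kernel4 V \<Phi> t (X s \<omega>) \<partial>M)"
    and "integrable M (\<lambda>\<omega>. U \<omega> * kernel4 V \<Phi> t (X s \<omega>))"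
proof -
  have [measurable]: "U \<in> borel_measurable M" using measurable_from_subalg[OF subalg[OF s] U(1)] .
  have [measurable]: "X s \<in> borel_measurable M" "X (s + t) \<in> borel_measurable M"
    using X_measurable s t by auto
  have [measurable]: "X s \<in> borel_measurable (G s)" using adapted s by simp
  note [measurable] = U(1)
  define c where "c k = real (4 choose k) * (- 1) ^ (4 - k)" for k :: nat
  define W where "W k \<omega> = U \<omega> * exp (- X s \<omega>) ^ (4 - k)" for k :: nat and \<omega>
  have W01: "0 \<le> W k \<omega> \<and> W k \<omega> \<le> 1" if "\<omega> \<in> space M" for k \<omega>
  proof -
    have "exp (- X s \<omega>) ^ (4 - k) \<le> 1" using nonneg[OF s that] by (intro power_le_one) auto
    then show ?thesis using U(2)[OF that] unfolding W_def by (auto intro!: mult_le_one)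
  qed
  have Wm: "W k \<in> borel_measurable (G s)" for k unfolding W_def by measurable
  have Wm': "W k \<in> borel_measurable M" for k unfolding W_def by measurable
  have mk: "(\<integral>\<omega>. W k \<omega> * exp (- X (s + t) \<omega>) ^ k \<partial>M)
      = (\<integral>\<omega>. W k \<omega> * exp (- X s \<omega> * V t (real k) - \<Phi> t (real k)) \<partial>M)" for k
    using markov[OF s t of_nat_0_le_iff Wm W01, of k k] by (simp add: exp_of_nat_mult[symmetric])
  have expand: "U \<omega> * (exp (- X (s + t) \<omega>) - exp (- X s \<omega>)) ^ 4
      = (\<Sum>k\<le>4. c k * (W k \<omega> * exp (- X (s + t) \<omega>) ^ k))" for \<omega>
  proof -
    have "(exp (- X (s + t) \<omega>) + - exp (- X s \<omega>)) ^ 4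
      = (\<Sum>k\<le>4. real (4 choose k) * exp (- X (s + t) \<omega>) ^ k * (- exp (- X s \<omega>)) ^ (4 - k))"
      by (rule binomial_ring)
    also have "U \<omega> * \<dots> = (\<Sum>k\<le>4. c k * (W k \<omega> * exp (- X (s + t) \<omega>) ^ k))"
      unfolding sum_distrib_left c_def W_def
    proof (rule sum.cong[OF refl])
      fix k :: nat
      have "(- exp (- X s \<omega>)) ^ (4 - k) = (- 1) ^ (4 - k) * exp (- X s \<omega>) ^ (4 - k)"
        by (rule power_minus)
      then show "U \<omega> * (real (4 choose k) * exp (- X (s + t) \<omega>) ^ k * (- exp (- X s \<omega>)) ^ (4 - k))
        = real (4 choose k) * (- 1) ^ (4 - k) * (U \<omega> * exp (- X s \<omega>) ^ (4 - k) * exp (- X (s + t) \<omega>) ^ k)"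
        by (simp only: mult_ac)
    qed
    finally show ?thesis by (simp only: diff_conv_add_uminus)
  qed
  have expand': "U \<omega> * kernel4 V \<Phi> t (X s \<omega>)
      = (\<Sum>k\<le>4. c k * (W k \<omega> * exp (- X s \<omega> * V t (real k) - \<Phi> t (real k))))" for \<omega>
    unfolding kernel4_def sum_distrib_left c_def W_def by (rule sum.cong[OF refl]) (simp only: mult_ac)
  have int1: "integrable M (\<lambda>\<omega>. W k \<omega> * exp (- X (s + t) \<omega>) ^ k)" for k
  proof (rule bounded_integrable)
    show "(\<lambda>\<omega>. W k \<omega> * exp (- X (s + t) \<omega>) ^ k) \<in> borel_measurable M" using Wm' by measurable
    fix \<omega> assume \<omega>: "\<omega> \<in> space M"
    have "exp (- X (s + t) \<omega>) ^ k \<le> 1" using nonneg[OF _ \<omega>, of "s + t"] s t by (intro power_le_one) auto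
    then show "\<bar>W k \<omega> * exp (- X (s + t) \<omega>) ^ k\<bar> \<le> 1"
      using W01[OF \<omega>, of k] by (auto simp: abs_mult intro!: mult_le_one)
  qed
  have int2: "integrable M (\<lambda>\<omega>. W k \<omega> * exp (- X s \<omega> * V t (real k) - \<Phi> t (real k)))" for k
  proof (rule bounded_integrable)
    show "(\<lambda>\<omega>. W k \<omega> * exp (- X s \<omega> * V t (real k) - \<Phi> t (real k))) \<in> borel_measurable M" using Wm' by measurable
    fix \<omega> assume \<omega>: "\<omega> \<in> space M"
    have "0 \<le> X s \<omega> * V t (real k)" using nonneg[OF s \<omega>] V_nonneg[OF t, of "real k"] by simp
    then have "exp (- X s \<omega> * V t (real k) - \<Phi> t (real k)) \<le> exp (- \<Phi> t (real k))" by simp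
    then have "W k \<omega> * exp (- X s \<omega> * V t (real k) - \<Phi> t (real k)) \<le> 1 * exp (- \<Phi> t (real k))"
      using W01[OF \<omega>, of k] by (intro mult_mono) auto
    then show "\<bar>W k \<omega> * exp (- X s \<omega> * V t (real k) - \<Phi> t (real k))\<bar> \<le> exp (- \<Phi> t (real k))"
      using W01[OF \<omega>, of k] by (simp add: abs_mult)
  qed
  show "(\<integral>\<omega>. U \<omega> * (exp (- X (s + t) \<omega>) - exp (- X s \<omega>)) ^ 4 \<partial>M) = (\<integral>\<omega>. U \<omega> * kernel4 V \<Phi> t (X s \<omega>) \<partial>M)"
    unfolding expand expand' using int1 int2 mk by (simp add: integral_sum)
  show "integrable M (\<lambda>\<omega>. U \<omega> * kernel4 V \<Phi> t (X s \<omega>))"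
    unfolding expand' using int2 by (intro Bochner_Integration.integrable_sum integrable_mult_right)
qed

text \<open>Chebyshev's inequality with the fourth power. An event \<open>A\<close> of the past is
  carried along because its probability on the right-hand side can be summed over disjoint
  events.\<close>

lemma prob_increment_le:
  assumes s: "0 \<le> s" and t: "0 \<le> t" and A: "A \<in> sets (G s)" and \<delta>: "0 < \<delta>"
    and Q: "\<And>x. 0 \<le> x \<Longrightarrow> kernel4 V \<Phi> t x \<le> Q"
  shows "prob (A \<inter> {\<omega> \<in> space M. \<delta> \<le> \<bar>exp (- X (s + t) \<omega>) - exp (- X s \<omega>)\<bar>}) \<le> Q / \<delta> ^ 4 * prob A"
proof -
  have AM: "A \<in> sets M" using A subalg[OF s] by (auto simp: subalgebra_def)
  have [measurable]: "X s \<in> borel_measurable M" "X (s + t) \<in> borel_measurable M"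
    using X_measurable s t by auto
  let ?B = "A \<inter> {\<omega> \<in> space M. \<delta> \<le> \<bar>exp (- X (s + t) \<omega>) - exp (- X s \<omega>)\<bar>}"
  let ?D = "\<lambda>\<omega>. exp (- X (s + t) \<omega>) - exp (- X s \<omega>)"
  have B: "?B \<in> sets M" using AM by measurable
  have U: "indicator A \<in> borel_measurable (G s)" "\<And>\<omega>. \<omega> \<in> space M \<Longrightarrow> 0 \<le> (indicator A \<omega> :: real) \<and> indicator A \<omega> \<le> (1 :: real)"
    using A by (auto simp: indicator_def)
  note ex = expectation_fourth_power[OF s t U]
  have "\<delta> ^ 4 * prob ?B = (\<integral>\<omega>. \<delta> ^ 4 * indicator ?B \<omega> \<partial>M)" using B by simp
  also have "\<dots> \<le> (\<integral>\<omega>. indicator A \<omega> * ?D \<omega> ^ 4 \<partial>M)"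
  proof (rule integral_mono)
    show "integrable M (\<lambda>\<omega>. \<delta> ^ 4 * indicator ?B \<omega>)"
      by (intro integrable_mult_right integrable_real_indicator B) (simp add: less_top[symmetric])
    have "\<bar>?D \<omega>\<bar> \<le> 1" if "\<omega> \<in> space M" for \<omega>
      using nonneg[OF _ that] s t by (intro exp_neg_diff_le_1) auto
    then have bound: "\<bar>indicator A \<omega> * ?D \<omega> ^ 4\<bar> \<le> 1" if "\<omega> \<in> space M" for \<omega>
      using power_le_one[OF abs_ge_zero, of "?D \<omega>" 4] that by (simp add: indicator_def abs_mult power_abs)
    have "(\<lambda>\<omega>. ?D \<omega> ^ 4) \<in> borel_measurable M" by measurable
    then have "(\<lambda>\<omega>. indicator A \<omega> * ?D \<omega> ^ 4) \<in> borel_measurable M"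
      using AM by (intro borel_measurable_times borel_measurable_indicator)
    then show "integrable M (\<lambda>\<omega>. indicator A \<omega> * ?D \<omega> ^ 4)"
      by (rule bounded_integrable[OF _ bound])
    fix \<omega>
    have "\<delta> ^ 4 \<le> ?D \<omega> ^ 4" if "\<delta> \<le> \<bar>?D \<omega>\<bar>"
    proof -
      have "\<delta> ^ 4 \<le> \<bar>?D \<omega>\<bar> ^ 4" using that \<delta> by (intro power_mono) auto
      then show ?thesis by (simp add: power_even_abs)
    qed
    then show "\<delta> ^ 4 * indicator ?B \<omega> \<le> indicator A \<omega> * ?D \<omega> ^ 4"
      by (auto simp: indicator_def)
  qed
  also have "\<dots> = (\<integral>\<omega>. indicator A \<omega> * kernel4 V \<Phi> t (X s \<omega>) \<partial>M)" by (rule ex(1))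
  also have "\<dots> \<le> (\<integral>\<omega>. Q * indicator A \<omega> \<partial>M)"
  proof (rule integral_mono[OF ex(2)])
    show "integrable M (\<lambda>\<omega>. Q * indicator A \<omega>)"
      by (intro integrable_mult_right integrable_real_indicator AM) (simp add: less_top[symmetric])
    fix \<omega> assume "\<omega> \<in> space M"
    then show "indicator A \<omega> * kernel4 V \<Phi> t (X s \<omega>) \<le> Q * indicator A \<omega>"
      using Q[OF nonneg[OF s]] by (auto simp: indicator_def)
  qed
  also have "\<dots> = Q * prob A" using AM by simp
  finally show ?thesis using \<delta> by (simp add: field_simps)
qed

text \<open>Ottaviani's argument: decompose according to the first time in \<open>S\<close> at which the increment is
  at least \<open>2 \<delta>\<close>; then either the increment up to the right endpoint is at least \<open>\<delta>\<close>, or the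
  increment from that time to the endpoint is.\<close>

lemma prob_finite_oscillation_le:
  assumes a: "0 \<le> a" and h: "0 \<le> h" and S: "finite S" "S \<subseteq> {a..a + h}" and \<delta>: "0 < \<delta>" and Q0: "0 \<le> Q"
    and Q: "\<And>t x. 0 \<le> t \<Longrightarrow> t \<le> h \<Longrightarrow> 0 \<le> x \<Longrightarrow> kernel4 V \<Phi> t x \<le> Q"
  shows "prob {\<omega> \<in> space M. \<exists>s\<in>S. 2 * \<delta> \<le> \<bar>exp (- X s \<omega>) - exp (- X a \<omega>)\<bar>} \<le> 2 * Q / \<delta> ^ 4"
proof -
  define D where "D s r \<omega> = \<bar>exp (- X s \<omega>) - exp (- X r \<omega>)\<bar>" for s r \<omega>
  define A where "A s = {\<omega> \<in> space M. 2 * \<delta> \<le> D s a \<omega> \<and> (\<forall>r\<in>{r \<in> S. r < s}. \<not> 2 * \<delta> \<le> D r a \<omega>)}" for s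
  define E where "E = {\<omega> \<in> space M. \<exists>s\<in>S. 2 * \<delta> \<le> D s a \<omega>}"
  have S0: "0 \<le> s" "a \<le> s" "s \<le> a + h" if "s \<in> S" for s using that S(2) a by auto
  have AG: "A s \<in> sets (G s)" if "s \<in> S" for s
  proof -
    have m: "D r a \<in> borel_measurable (G s)" if "a \<le> r" "r \<le> s" for r
    proof -
      have [measurable]: "X r \<in> borel_measurable (G s)" "X a \<in> borel_measurable (G s)"
        using adapted[of r s] adapted[of a s] a that by auto
      show ?thesis unfolding D_def by measurable
    qed
    have [measurable]: "{\<omega> \<in> space (G s). 2 * \<delta> \<le> D r a \<omega>} \<in> sets (G s)" if "a \<le> r" "r \<le> s" for r
      using borel_measurable_const m[OF that] by (rule borel_measurable_le)
    have "A s = {\<omega> \<in> space (G s). 2 * \<delta> \<le> D s a \<omega>} - (\<Union>r\<in>{r \<in> S. r < s}. {\<omega> \<in> space (G s). 2 * \<delta> \<le> D r a \<omega>})"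
      using space_G[OF S0(1)[OF that]] by (auto simp: A_def)
    also have "\<dots> \<in> sets (G s)"
    proof (rule sets.Diff)
      show "{\<omega> \<in> space (G s). 2 * \<delta> \<le> D s a \<omega>} \<in> sets (G s)" using S0[OF that] by auto
      show "(\<Union>r\<in>{r \<in> S. r < s}. {\<omega> \<in> space (G s). 2 * \<delta> \<le> D r a \<omega>}) \<in> sets (G s)"
        using S(1) S0(2) by (intro sets.finite_UN) auto
    qed
    finally show ?thesis .
  qed
  have AM: "A s \<in> sets M" if "s \<in> S" for s
    using AG[OF that] subalg[OF S0(1)[OF that]] by (auto simp: subalgebra_def)
  have disj: "disjoint_family_on A S"
    unfolding disjoint_family_on_def
  proof (intro ballI impI)
    fix s r assume "s \<in> S" "r \<in> S" "s \<noteq> r"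
    then show "A s \<inter> A r = {}"
      by (cases "s < r") (auto simp: A_def)
  qed
  have EU: "E = (\<Union>s\<in>S. A s)"
  proof (rule antisym)
    show "E \<subseteq> (\<Union>s\<in>S. A s)"
    proof
      fix \<omega> assume \<omega>: "\<omega> \<in> E"
      define B where "B = {s \<in> S. 2 * \<delta> \<le> D s a \<omega>}"
      have B: "finite B" "B \<noteq> {}" using S(1) \<omega> by (auto simp: B_def E_def)
      have "Min B \<in> B" by (rule Min_in[OF B])
      moreover have "\<not> 2 * \<delta> \<le> D r a \<omega>" if "r \<in> S" "r < Min B" for r
        using that Min_le[OF B(1), of r] by (auto simp: B_def)
      ultimately show "\<omega> \<in> (\<Union>s\<in>S. A s)" using \<omega> by (auto simp: A_def B_def E_def)
    qed
  qed (auto simp: A_def E_def)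
  have probE: "prob E = (\<Sum>s\<in>S. prob (A s))"
    unfolding EU using S(1) AM disj by (intro finite_measure_finite_Union) auto
  \<comment> \<open>The endpoint \<open>a + h\<close> is written as \<open>s + (a + h - s)\<close>
    to match the increment in \<open>prob_increment_le\<close>.\<close>
  define C where "C s = A s \<inter> {\<omega> \<in> space M. \<delta> \<le> \<bar>exp (- X (s + (a + h - s)) \<omega>) - exp (- X s \<omega>)\<bar>}" for s
  define C0 where "C0 = space M \<inter> {\<omega> \<in> space M. \<delta> \<le> \<bar>exp (- X (a + h) \<omega>) - exp (- X a \<omega>)\<bar>}"
  have Xm: "X t \<in> borel_measurable M" if "0 \<le> t" for t by (rule X_measurable[OF that])
  have lev: "{\<omega> \<in> space M. \<delta> \<le> \<bar>exp (- X t \<omega>) - exp (- X s \<omega>)\<bar>} \<in> sets M" if "0 \<le> t" "0 \<le> s" for t s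
  proof -
    have [measurable]: "X t \<in> borel_measurable M" "X s \<in> borel_measurable M" using Xm that by auto
    show ?thesis by measurable
  qed
  have C: "C s \<in> sets M" if "s \<in> S" for s
    unfolding C_def using AM[OF that] lev[of "s + (a + h - s)" s] S0[OF that] a h by (intro sets.Int) auto
  have C0: "C0 \<in> sets M" unfolding C0_def using lev[of "a + h" a] a h by (intro sets.Int) auto
  have PC: "prob (C s) \<le> Q / \<delta> ^ 4 * prob (A s)" if "s \<in> S" for s
    unfolding C_def using S0[OF that] AG[OF that] \<delta> by (intro prob_increment_le Q) auto
  have PC0: "prob C0 \<le> Q / \<delta> ^ 4 * prob (space M)"
    unfolding C0_def using a h \<delta> sets.top[of "G a"] space_G[OF a] by (intro prob_increment_le Q) auto
  have "E \<subseteq> C0 \<union> (\<Union>s\<in>S. C s)"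
  proof
    fix \<omega> assume "\<omega> \<in> E"
    then obtain s where s: "s \<in> S" "\<omega> \<in> A s" unfolding EU by blast
    have D2: "2 * \<delta> \<le> D s a \<omega>" "\<omega> \<in> space M" using s(2) by (auto simp: A_def)
    show "\<omega> \<in> C0 \<union> (\<Union>s\<in>S. C s)"
    proof (cases "\<delta> \<le> D (a + h) s \<omega>")
      case True
      then have "\<omega> \<in> C s" using s D2 by (simp add: C_def D_def)
      then show ?thesis using s by blast
    next
      case False
      then have "\<delta> \<le> \<bar>exp (- X (a + h) \<omega>) - exp (- X a \<omega>)\<bar>" using D2(1) unfolding D_def by linarith
      then show ?thesis using D2 by (simp add: C0_def)
    qed
  qed
  then have "prob E \<le> prob (C0 \<union> (\<Union>s\<in>S. C s))"
    using C C0 S(1) by (intro finite_measure_mono) auto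
  also have "\<dots> \<le> prob C0 + prob (\<Union>s\<in>S. C s)"
    using C C0 S(1) by (intro measure_Un_le) auto
  also have "prob (\<Union>s\<in>S. C s) \<le> (\<Sum>s\<in>S. prob (C s))"
    using C S(1) by (intro finite_measure_subadditive_finite) auto
  also have "\<dots> \<le> (\<Sum>s\<in>S. Q / \<delta> ^ 4 * prob (A s))" by (intro sum_mono PC)
  \<comment> \<open>Since the events \<open>A s\<close> are disjoint with union \<open>E\<close>,
    all points of \<open>S\<close> together cost no more than a single increment.\<close>
  also have "\<dots> = Q / \<delta> ^ 4 * prob E" by (simp only: probE sum_distrib_left)
  also have "\<dots> \<le> Q / \<delta> ^ 4 * 1" using Q0 \<delta> by (intro mult_left_mono) auto
  finally have "prob E \<le> prob C0 + Q / \<delta> ^ 4 * 1" by simp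
  also have "\<dots> \<le> 2 * Q / \<delta> ^ 4" using PC0 by (simp add: prob_space)
  finally show ?thesis unfolding E_def D_def .
qed

text \<open>The bound for finite sets does not depend on their number of points, so it passes to the
  increasing union of the initial segments of an enumeration.\<close>

lemma prob_countable_oscillation_le:
  assumes a: "0 \<le> a" and h: "0 \<le> h" and S: "countable S" "S \<subseteq> {a..a + h}" and \<delta>: "0 < \<delta>" and Q0: "0 \<le> Q"
    and Q: "\<And>t x. 0 \<le> t \<Longrightarrow> t \<le> h \<Longrightarrow> 0 \<le> x \<Longrightarrow> kernel4 V \<Phi> t x \<le> Q"
  shows "{\<omega> \<in> space M. \<exists>s\<in>S. 2 * \<delta> \<le> \<bar>exp (- X s \<omega>) - exp (- X a \<omega>)\<bar>} \<in> sets M" (is "?E S \<in> _")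
    and "prob {\<omega> \<in> space M. \<exists>s\<in>S. 2 * \<delta> \<le> \<bar>exp (- X s \<omega>) - exp (- X a \<omega>)\<bar>} \<le> 2 * Q / \<delta> ^ 4"
proof -
  have lev: "{\<omega> \<in> space M. 2 * \<delta> \<le> \<bar>exp (- X s \<omega>) - exp (- X a \<omega>)\<bar>} \<in> sets M" if "s \<in> S" for s
  proof -
    have [measurable]: "X s \<in> borel_measurable M" "X a \<in> borel_measurable M"
      using X_measurable[of s] X_measurable[of a] that S(2) a by auto
    show ?thesis by measurable
  qed
  have sets: "?E T \<in> sets M" if "T \<subseteq> S" for T
  proof -
    have "?E T = (\<Union>s\<in>T. {\<omega> \<in> space M. 2 * \<delta> \<le> \<bar>exp (- X s \<omega>) - exp (- X a \<omega>)\<bar>})" by blast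
    also have "\<dots> \<in> sets M"
      using that countable_subset[OF that S(1)] lev by (intro sets.countable_UN') auto
    finally show ?thesis .
  qed
  show "?E S \<in> sets M" by (rule sets) simp
  show "prob (?E S) \<le> 2 * Q / \<delta> ^ 4"
  proof (cases "S = {}")
    case True
    then show ?thesis using Q0 \<delta> by simp
  next
    case False
    define T where "T n = from_nat_into S ` {..n}" for n :: nat
    have T: "T n \<subseteq> S" "finite (T n)" for n using from_nat_into[OF False] by (auto simp: T_def)
    have ST: "S = (\<Union>n. T n)"
    proof
      show "S \<subseteq> (\<Union>n. T n)"
      proof
        fix s assume "s \<in> S"
        then obtain n where "s = from_nat_into S n" by (metis from_nat_into_surj S(1))
        then show "s \<in> (\<Union>n. T n)" by (auto simp: T_def)
      qed
    qed (use T in blast)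
    have inc: "incseq (\<lambda>n. ?E (T n))"
    proof (rule incseq_SucI)
      fix n
      have "T n \<subseteq> T (Suc n)" unfolding T_def by (intro image_mono) auto
      then show "?E (T n) \<subseteq> ?E (T (Suc n))" by blast
    qed
    have "(\<lambda>n. prob (?E (T n))) \<longlonglongrightarrow> prob (\<Union>n. ?E (T n))"
      by (rule finite_Lim_measure_incseq[OF _ inc]) (use sets[OF T(1)] in blast)
    moreover have "(\<Union>n. ?E (T n)) = ?E S" unfolding ST by blast
    ultimately have lim: "(\<lambda>n. prob (?E (T n))) \<longlonglongrightarrow> prob (?E S)" by simp
    show ?thesis
    proof (rule LIMSEQ_le_const2[OF lim], intro exI[of _ 0] allI impI)
      fix n :: nat
      show "prob (?E (T n)) \<le> 2 * Q / \<delta> ^ 4"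
        by (rule prob_finite_oscillation_le[OF a h T(2) subset_trans[OF T(1) S(2)] \<delta> Q0 Q])
    qed
  qed
qed

text \<open>The three terms are the truncation at height \<open>n\<close>, the oscillation inside
  cells that behave well, and the probability that some cell does not. There are
  \<open>n * k + 1\<close> cells because time \<open>k\<close> itself belongs to cell number
  \<open>n * k\<close>.\<close>

lemma expectation_path_dist_step_le:
  assumes n: "0 < n" and \<delta>: "0 < \<delta>" and Q0: "0 \<le> Q"
    and Q: "\<And>t x. 0 \<le> t \<Longrightarrow> t \<le> 1 / real n \<Longrightarrow> 0 \<le> x \<Longrightarrow> kernel4 V \<Phi> t x \<le> Q"
  shows "(\<integral>\<omega>. path_dist k (path_of X \<omega>) (step_path n (grid_values n (path_of X \<omega>))) \<partial>M)
    \<le> exp (- real n) + 2 * \<delta> + real (n * k + 1) * (2 * Q / \<delta> ^ 4)"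
proof -
  define R where "R j = \<rat> \<inter> {real j / real n..real j / real n + 1 / real n}" for j
  define E where "E j = {\<omega> \<in> space M. \<exists>s\<in>R j. 2 * \<delta> \<le> \<bar>exp (- X s \<omega>) - exp (- X (real j / real n) \<omega>)\<bar>}" for j
  have R: "countable (R j)" "R j \<subseteq> {real j / real n..real j / real n + 1 / real n}" for j
    by (auto simp: R_def countable_rat)
  have E: "E j \<in> sets M" "prob (E j) \<le> 2 * Q / \<delta> ^ 4" for j
    unfolding E_def using prob_countable_oscillation_le[OF _ _ R \<delta> Q0 Q] n by simp_all
  define Bad where "Bad = (\<Union>j\<in>{..n * k}. E j)"
  have Bad: "Bad \<in> sets M" unfolding Bad_def using E by auto
  have "prob Bad \<le> (\<Sum>j\<le>n * k. prob (E j))"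
    unfolding Bad_def using E by (intro finite_measure_subadditive_finite) auto
  also have "\<dots> \<le> (\<Sum>j\<le>n * k. 2 * Q / \<delta> ^ 4)" by (intro sum_mono E)
  finally have pBad: "prob Bad \<le> real (n * k + 1) * (2 * Q / \<delta> ^ 4)" by simp
  let ?d = "\<lambda>\<omega>. path_dist k (path_of X \<omega>) (step_path n (grid_values n (path_of X \<omega>)))"
  have "(\<integral>\<omega>. ?d \<omega> \<partial>M) \<le> (\<integral>\<omega>. (exp (- real n) + 2 * \<delta>) + indicator Bad \<omega> \<partial>M)"
  proof (rule integral_mono)
    show "integrable M ?d"
      by (intro integrable_path_dist_step prob_space_axioms path_of_in_skorokhod_space path_of_measurable)
    show "integrable M (\<lambda>\<omega>. (exp (- real n) + 2 * \<delta>) + indicator Bad \<omega>)"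
      using Bad by (intro Bochner_Integration.integrable_add integrable_real_indicator) (auto simp: less_top[symmetric])
    fix \<omega> assume \<omega>: "\<omega> \<in> space M"
    show "?d \<omega> \<le> (exp (- real n) + 2 * \<delta>) + indicator Bad \<omega>"
    proof (cases "\<omega> \<in> Bad")
      case True
      have "?d \<omega> \<le> 1" by (intro path_dist_le_1 step_path_in_skorokhod_space path_of_in_skorokhod_space \<omega>)
      moreover have "0 \<le> exp (- real n) + 2 * \<delta>" using \<delta> by simp
      ultimately show ?thesis using True by simp
    next
      case False
      have "?d \<omega> \<le> exp (- real n) + 2 * \<delta>"
        unfolding path_dist_def
      proof (rule cSUP_least[OF rats_Icc_nonempty])
        fix s assume "s \<in> \<rat> \<inter> {0..real k}"
        then have s: "s \<in> \<rat>" "0 \<le> s" "s \<le> real k" by auto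
        define j where "j = nat \<lfloor>real n * s\<rfloor>"
        have "real n * s \<le> real n * real k" using s by (intro mult_left_mono) auto
        then have "\<lfloor>real n * s\<rfloor> \<le> int (n * k)" by (simp add: floor_le_iff)
        then have jle: "j \<le> n * k" by (simp only: j_def nat_le_iff)
        have "real j = of_int \<lfloor>real n * s\<rfloor>" using s by (simp add: j_def)
        then have "real j \<le> real n * s" "real n * s \<le> real j + 1" by linarith+
        then have "s \<in> R j" using s n by (auto simp: R_def field_simps)
        then have 1: "\<bar>exp (- X s \<omega>) - exp (- X (real j / real n) \<omega>)\<bar> < 2 * \<delta>"
          using False jle \<omega> unfolding Bad_def E_def by fastforce
        have 0: "0 < exp (- X (real j / real n) \<omega>)" "exp (- X (real j / real n) \<omega>) \<le> 1"
          using nonneg[OF _ \<omega>] by simp_all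
        have "exp (- step_path n (grid_values n (path_of X \<omega>)) s)
          = min 1 (max (exp (- X (real j / real n) \<omega>)) (exp (- real n)))"
          unfolding exp_step_path[OF s(2)] j_def[symmetric] by (simp add: grid_values_def path_of_def)
        then have "\<bar>exp (- step_path n (grid_values n (path_of X \<omega>)) s) - exp (- X (real j / real n) \<omega>)\<bar> \<le> exp (- real n)"
          using 0 exp_gt_zero[of "- real n"] by linarith
        moreover have "path_of X \<omega> s = X s \<omega>" using s by (simp add: path_of_def)
        ultimately show "\<bar>exp (- path_of X \<omega> s) - exp (- step_path n (grid_values n (path_of X \<omega>)) s)\<bar>
          \<le> exp (- real n) + 2 * \<delta>" using 1 by (simp only:)
      qed
      then show ?thesis using False by simp
    qed
  qed
  also have "\<dots> = exp (- real n) + 2 * \<delta> + prob Bad"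
    using Bad by (subst Bochner_Integration.integral_add) (auto simp: prob_space less_top[symmetric])
  finally show ?thesis using pBad by linarith
qed

end


subsection \<open>Convergence at the points of a grid\<close>

lemma laplace_transform_tendsto:
  fixes B :: "'b \<Rightarrow> real"
  assumes "prob_space N" and B: "B \<in> borel_measurable N" "\<And>\<omega>. \<omega> \<in> space N \<Longrightarrow> 0 \<le> B \<omega>"
    and w: "w \<longlonglongrightarrow> z" "\<And>n :: nat. 0 \<le> w n"
  shows "(\<lambda>n. \<integral>\<omega>. exp (- w n * B \<omega>) \<partial>N) \<longlonglongrightarrow> (\<integral>\<omega>. exp (- z * B \<omega>) \<partial>N)"
proof (rule integral_dominated_convergence[where w = "\<lambda>_. 1"])
  interpret prob_space N by fact
  note [measurable] = B(1)
  show "integrable N (\<lambda>_. 1 :: real)" by simp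
  show "AE \<omega> in N. norm (exp (- w n * B \<omega>)) \<le> 1" for n
    using w(2) B(2) by (intro AE_I2) simp
  show "AE \<omega> in N. (\<lambda>n. exp (- w n * B \<omega>)) \<longlonglongrightarrow> exp (- z * B \<omega>)"
    by (intro AE_I2 tendsto_intros w)
  show "(\<lambda>\<omega>. exp (- z * B \<omega>)) \<in> borel_measurable N" by measurable
  show "(\<lambda>\<omega>. exp (- w n * B \<omega>)) \<in> borel_measurable N" for n by measurable
qed

text \<open>Monotonicity in the exponent replaces a tightness argument.\<close>

lemma laplace_transform_tendsto_varying:
  fixes A :: "'i \<Rightarrow> 'a \<Rightarrow> real" and B :: "'b \<Rightarrow> real"
  assumes A: "eventually (\<lambda>i. prob_space (M i) \<and> A i \<in> borel_measurable (M i) \<and> (\<forall>\<omega>\<in>space (M i). 0 \<le> A i \<omega>)) F"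
    and N: "prob_space N" and B: "B \<in> borel_measurable N" "\<And>\<omega>. \<omega> \<in> space N \<Longrightarrow> 0 \<le> B \<omega>"
    and conv: "\<And>z. 0 \<le> z \<Longrightarrow> ((\<lambda>i. \<integral>\<omega>. exp (- z * A i \<omega>) \<partial>M i) \<longlongrightarrow> (\<integral>\<omega>. exp (- z * B \<omega>) \<partial>N)) F"
    and z: "0 \<le> z" and zi: "eventually (\<lambda>i. 0 \<le> zi i) F" "(zi \<longlongrightarrow> z) F"
  shows "((\<lambda>i. \<integral>\<omega>. exp (- zi i * A i \<omega>) \<partial>M i) \<longlongrightarrow> (\<integral>\<omega>. exp (- z * B \<omega>) \<partial>N)) F"
proof (rule tendstoI)
  fix e :: real assume e: "0 < e"
  define L where "L w = (\<integral>\<omega>. exp (- w * B \<omega>) \<partial>N)" for w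
  have inv0: "(\<lambda>n. inverse (real (Suc n))) \<longlonglongrightarrow> 0" by (rule LIMSEQ_inverse_real_of_nat)
  have "(\<lambda>n. z + inverse (real (Suc n))) \<longlonglongrightarrow> z" using tendsto_add[OF tendsto_const inv0] by simp
  then have "(\<lambda>n. L (z + inverse (real (Suc n)))) \<longlonglongrightarrow> L z"
    unfolding L_def using z by (intro laplace_transform_tendsto N B) auto
  from tendstoD[OF this half_gt_zero[OF e]] have 1: "eventually (\<lambda>n. dist (L (z + inverse (real (Suc n)))) (L z) < e / 2) sequentially" .
  \<comment> \<open>The exponent is cut at 0, as the hypothesis \<open>conv\<close> concerns
    nonnegative exponents.\<close>
  have "(\<lambda>n. max 0 (z - inverse (real (Suc n)))) \<longlonglongrightarrow> max 0 (z - 0)" by (intro tendsto_intros inv0)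
  then have "(\<lambda>n. max 0 (z - inverse (real (Suc n)))) \<longlonglongrightarrow> z" using z by simp
  then have "(\<lambda>n. L (max 0 (z - inverse (real (Suc n))))) \<longlonglongrightarrow> L z"
    unfolding L_def by (intro laplace_transform_tendsto N B) auto
  from tendstoD[OF this half_gt_zero[OF e]] have "eventually (\<lambda>n. dist (L (max 0 (z - inverse (real (Suc n))))) (L z) < e / 2) sequentially" .
  with 1 have "eventually (\<lambda>n. dist (L (z + inverse (real (Suc n)))) (L z) < e / 2 \<and>
     dist (L (max 0 (z - inverse (real (Suc n))))) (L z) < e / 2) sequentially" by (rule eventually_conj)
  then obtain n where n: "dist (L (z + inverse (real (Suc n)))) (L z) < e / 2"
     "dist (L (max 0 (z - inverse (real (Suc n))))) (L z) < e / 2" using eventually_happens'[OF sequentially_bot] by blast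
  \<comment> \<open>The limit transform at \<open>z + d\<close> and at \<open>max 0 (z - d)\<close>
    differs from that at \<open>z\<close> by less than \<open>e / 2\<close>; the varying exponent is
    caught between these two fixed ones.\<close>
  define d where "d = inverse (real (Suc n))"
  have d: "0 < d" by (simp add: d_def)
  have "eventually (\<lambda>i. dist (\<integral>\<omega>. exp (- (z + d) * A i \<omega>) \<partial>M i) (L (z + d)) < e / 2) F"
    unfolding L_def using d z by (intro tendstoD[OF conv[of "z + d"] half_gt_zero[OF e]]) simp
  moreover have "eventually (\<lambda>i. dist (\<integral>\<omega>. exp (- max 0 (z - d) * A i \<omega>) \<partial>M i) (L (max 0 (z - d))) < e / 2) F"
    unfolding L_def by (intro tendstoD[OF conv[of "max 0 (z - d)"] half_gt_zero[OF e]]) simp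
  moreover have "eventually (\<lambda>i. dist (zi i) z < d) F" using tendstoD[OF zi(2) d] .
  ultimately show "eventually (\<lambda>i. dist (\<integral>\<omega>. exp (- zi i * A i \<omega>) \<partial>M i) (\<integral>\<omega>. exp (- z * B \<omega>) \<partial>N) < e) F"
    using A zi(1)
  proof eventually_elim
    case (elim i)
    interpret prob_space "M i" using elim by blast
    have [measurable]: "A i \<in> borel_measurable (M i)" and A0: "\<And>\<omega>. \<omega> \<in> space (M i) \<Longrightarrow> 0 \<le> A i \<omega>" using elim by blast+
    have int: "integrable (M i) (\<lambda>\<omega>. exp (- w * A i \<omega>))" if "0 \<le> w" for w
    proof (rule integrable_const_bound[of _ 1])
      show "AE \<omega> in M i. norm (exp (- w * A i \<omega>)) \<le> 1" using A0 that by (intro AE_I2) simp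
    qed measurable
    have "(\<integral>\<omega>. exp (- (z + d) * A i \<omega>) \<partial>M i) \<le> (\<integral>\<omega>. exp (- zi i * A i \<omega>) \<partial>M i)"
    proof (rule integral_mono[OF int int])
      fix \<omega> assume "\<omega> \<in> space (M i)"
      have "zi i \<le> z + d" using elim by (simp add: dist_real_def abs_less_iff)
      from mult_right_mono[OF this A0[OF \<open>\<omega> \<in> space (M i)\<close>]]
      show "exp (- (z + d) * A i \<omega>) \<le> exp (- zi i * A i \<omega>)"
        by (simp only: exp_le_cancel_iff mult_minus_left neg_le_iff_le)
    qed (use z d elim in auto)
    moreover have "(\<integral>\<omega>. exp (- zi i * A i \<omega>) \<partial>M i) \<le> (\<integral>\<omega>. exp (- max 0 (z - d) * A i \<omega>) \<partial>M i)"
    proof (rule integral_mono[OF int int])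
      fix \<omega> assume "\<omega> \<in> space (M i)"
      have "max 0 (z - d) \<le> zi i" using elim by (simp add: dist_real_def abs_less_iff)
      from mult_right_mono[OF this A0[OF \<open>\<omega> \<in> space (M i)\<close>]]
      show "exp (- zi i * A i \<omega>) \<le> exp (- max 0 (z - d) * A i \<omega>)"
        by (simp only: exp_le_cancel_iff mult_minus_left neg_le_iff_le)
    qed (use elim in auto)
    ultimately show ?case
      using elim(1,2) n unfolding d_def[symmetric] L_def[symmetric] dist_real_def by linarith
  qed
qed

text \<open>Conditioning at the last but one grid time removes the last value and adds its cumulant
  to the weight of the preceding one.\<close>

lemma (in laplace_markov) laplace_transform_grid_Suc:
  assumes h: "0 \<le> h" and z: "\<And>j. 0 \<le> z j"
  shows "(\<integral>\<omega>. exp (- (\<Sum>j\<le>Suc m. z j * X (real j * h) \<omega>)) \<partial>M) =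
    exp (- \<Phi> h (z (Suc m))) *
    (\<integral>\<omega>. exp (- (\<Sum>j\<le>m. (z(m := z m + V h (z (Suc m)))) j * X (real j * h) \<omega>)) \<partial>M)"
proof -
  define s where "s = real m * h"
  have s: "0 \<le> s" using h by (simp add: s_def)
  define U where "U \<omega> = exp (- (\<Sum>j\<le>m. z j * X (real j * h) \<omega>))" for \<omega>
  have [measurable]: "X (real j * h) \<in> borel_measurable (G s)" if "j \<in> {..m}" for j
    using h that by (intro adapted) (auto simp: s_def intro!: mult_right_mono)
  have U: "U \<in> borel_measurable (G s)" unfolding U_def by measurable
  have U01: "0 \<le> U \<omega> \<and> U \<omega> \<le> 1" if "\<omega> \<in> space M" for \<omega>
    using nonneg[OF _ that] h z by (auto simp: U_def intro!: sum_nonneg)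
  have sh: "s + h = real (Suc m) * h" by (simp add: s_def algebra_simps)
  have "(\<integral>\<omega>. exp (- (\<Sum>j\<le>Suc m. z j * X (real j * h) \<omega>)) \<partial>M)
    = (\<integral>\<omega>. U \<omega> * exp (- z (Suc m) * X (s + h) \<omega>) \<partial>M)"
    unfolding U_def sh by (simp add: exp_add[symmetric])
  also have "\<dots> = (\<integral>\<omega>. U \<omega> * exp (- X s \<omega> * V h (z (Suc m)) - \<Phi> h (z (Suc m))) \<partial>M)"
    by (rule markov[OF s h z U U01])
  also have "\<dots> = (\<integral>\<omega>. exp (- \<Phi> h (z (Suc m))) *
      exp (- (\<Sum>j\<le>m. (z(m := z m + V h (z (Suc m)))) j * X (real j * h) \<omega>)) \<partial>M)"
  proof (rule Bochner_Integration.integral_cong[OF refl])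
    fix \<omega>
    have "(\<Sum>j\<le>m. (z(m := z m + V h (z (Suc m)))) j * X (real j * h) \<omega>)
      = (\<Sum>j\<le>m. z j * X (real j * h) \<omega> + (if j = m then V h (z (Suc m)) * X s \<omega> else 0))"
      by (intro sum.cong) (auto simp: s_def distrib_right)
    also have "\<dots> = (\<Sum>j\<le>m. z j * X (real j * h) \<omega>) + V h (z (Suc m)) * X s \<omega>"
      by (simp add: sum.distrib)
    finally show "U \<omega> * exp (- X s \<omega> * V h (z (Suc m)) - \<Phi> h (z (Suc m))) = exp (- \<Phi> h (z (Suc m))) *
      exp (- (\<Sum>j\<le>m. (z(m := z m + V h (z (Suc m)))) j * X (real j * h) \<omega>))"
      unfolding U_def by (simp add: exp_add[symmetric] mult.commute)
  qed
  finally show ?thesis by simp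
qed

text \<open>The weights may depend on \<open>i\<close> because the induction forces it: after one
  step the new weight contains \<open>V i h\<close>. For the same reason \<open>convV\<close> and
  \<open>conv\<Phi>\<close> are stated along convergent arguments.\<close>

lemma laplace_transform_grid_tendsto:
  assumes ev: "eventually (\<lambda>i. laplace_markov (M i) (G i) (X i) (V i) (\<Phi> i)) F"
    and N: "laplace_markov N H Y W \<Psi>"
    and convV: "\<And>t z zi. 0 \<le> t \<Longrightarrow> 0 \<le> z \<Longrightarrow> eventually (\<lambda>i. 0 \<le> zi i) F \<Longrightarrow> (zi \<longlongrightarrow> z) F \<Longrightarrow>
      ((\<lambda>i. V i t (zi i)) \<longlongrightarrow> W t z) F"
    and conv\<Phi>: "\<And>t z zi. 0 \<le> t \<Longrightarrow> 0 \<le> z \<Longrightarrow> eventually (\<lambda>i. 0 \<le> zi i) F \<Longrightarrow> (zi \<longlongrightarrow> z) F \<Longrightarrow>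
      ((\<lambda>i. \<Phi> i t (zi i)) \<longlongrightarrow> \<Psi> t z) F"
    and init: "\<And>z. 0 \<le> z \<Longrightarrow> ((\<lambda>i. \<integral>\<omega>. exp (- z * X i 0 \<omega>) \<partial>M i) \<longlongrightarrow> (\<integral>\<omega>. exp (- z * Y 0 \<omega>) \<partial>N)) F"
    and h: "0 \<le> h"
  shows "(\<And>j. 0 \<le> z j) \<Longrightarrow> eventually (\<lambda>i. \<forall>j. 0 \<le> zi i j) F \<Longrightarrow> (\<And>j. ((\<lambda>i. zi i j) \<longlongrightarrow> z j) F) \<Longrightarrow>
    ((\<lambda>i. \<integral>\<omega>. exp (- (\<Sum>j\<le>m. zi i j * X i (real j * h) \<omega>)) \<partial>M i) \<longlongrightarrow>
      (\<integral>\<omega>. exp (- (\<Sum>j\<le>m. z j * Y (real j * h) \<omega>)) \<partial>N)) F"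
proof (induction m arbitrary: z zi)
  case 0
  interpret N: laplace_markov N H Y W \<Psi> by (rule N)
  have "((\<lambda>i. \<integral>\<omega>. exp (- zi i 0 * X i 0 \<omega>) \<partial>M i) \<longlongrightarrow> (\<integral>\<omega>. exp (- z 0 * Y 0 \<omega>) \<partial>N)) F"
  proof (rule laplace_transform_tendsto_varying)
    show "eventually (\<lambda>i. prob_space (M i) \<and> X i 0 \<in> borel_measurable (M i) \<and> (\<forall>\<omega>\<in>space (M i). 0 \<le> X i 0 \<omega>)) F"
      using ev
    proof eventually_elim
      case (elim i)
      then interpret laplace_markov "M i" "G i" "X i" "V i" "\<Phi> i" .
      show ?case using prob_space_axioms X_measurable[of 0] nonneg[of 0] by simp
    qed
    show "eventually (\<lambda>i. 0 \<le> zi i 0) F" using 0(2) by (rule eventually_mono) blast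
  qed (use 0 init N.prob_space_axioms N.X_measurable[of 0] N.nonneg[of 0] in simp_all)
  then show ?case by simp
next
  case (Suc m)
  interpret N: laplace_markov N H Y W \<Psi> by (rule N)
  have ev0: "eventually (\<lambda>i. 0 \<le> zi i (Suc m)) F" using Suc.prems(2) by (rule eventually_mono) blast
  let ?z = "z(m := z m + W h (z (Suc m)))"
  let ?zi = "\<lambda>i. (zi i)(m := zi i m + V i h (zi i (Suc m)))"
  have "((\<lambda>i. exp (- \<Phi> i h (zi i (Suc m))) * (\<integral>\<omega>. exp (- (\<Sum>j\<le>m. ?zi i j * X i (real j * h) \<omega>)) \<partial>M i)) \<longlongrightarrow>
      exp (- \<Psi> h (z (Suc m))) * (\<integral>\<omega>. exp (- (\<Sum>j\<le>m. ?z j * Y (real j * h) \<omega>)) \<partial>N)) F"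
  proof (intro tendsto_mult tendsto_exp tendsto_minus conv\<Phi> Suc.IH h ev0 Suc.prems(1,3))
    show "0 \<le> ?z j" for j using Suc.prems(1) N.V_nonneg[OF h] by simp
    show "eventually (\<lambda>i. \<forall>j. 0 \<le> ?zi i j) F"
      using Suc.prems(2) ev
    proof eventually_elim
      case (elim i)
      then interpret laplace_markov "M i" "G i" "X i" "V i" "\<Phi> i" by blast
      show ?case using elim V_nonneg[OF h] by simp
    qed
    show "((\<lambda>i. ?zi i j) \<longlongrightarrow> ?z j) F" for j
      using Suc.prems(3) convV[OF h Suc.prems(1) ev0 Suc.prems(3)]
      by (cases "j = m") (auto intro!: tendsto_add)
  qed
  moreover have "eventually (\<lambda>i. exp (- \<Phi> i h (zi i (Suc m))) * (\<integral>\<omega>. exp (- (\<Sum>j\<le>m. ?zi i j * X i (real j * h) \<omega>)) \<partial>M i)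
     = (\<integral>\<omega>. exp (- (\<Sum>j\<le>Suc m. zi i j * X i (real j * h) \<omega>)) \<partial>M i)) F"
    using Suc.prems(2) ev
  proof eventually_elim
    case (elim i)
    then interpret laplace_markov "M i" "G i" "X i" "V i" "\<Phi> i" by blast
    have "\<And>j. 0 \<le> zi i j" using elim(1) by blast
    from laplace_transform_grid_Suc[of h "zi i" m, OF h this] show ?case by simp
  qed
  ultimately show ?case
    unfolding N.laplace_transform_grid_Suc[of h z m, OF h Suc.prems(1)] by (rule Lim_transform_eventually)
qed

section \<open>Polynomials on the Hilbert cube\<close>

definition unit_cube :: "(nat \<Rightarrow> real) set" where
  "unit_cube = {z. \<forall>j. z j \<in> {0..1}}"

text \<open>Evaluated at grid values, a monomial has as expectation a multiple of a joint Laplace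
  transform with integer weights. Addition is the only further generator, so that convergence of
  expectations, which is linear, follows by induction; closure under products is proved
  separately.\<close>

inductive_set cube_polynomials :: "((nat \<Rightarrow> real) \<Rightarrow> real) set" where
  monomial: "(\<lambda>z. c * (\<Prod>j\<le>m. z j ^ k j)) \<in> cube_polynomials"
| add: "f \<in> cube_polynomials \<Longrightarrow> g \<in> cube_polynomials \<Longrightarrow> (\<lambda>z. f z + g z) \<in> cube_polynomials"

lemma prod_power_extend:
  fixes z :: "nat \<Rightarrow> real"
  assumes "m \<le> l"
  shows "(\<Prod>j\<le>m. z j ^ k j) = (\<Prod>j\<le>l. z j ^ (if j \<le> m then k j else 0))"
  using assms by (intro prod.mono_neutral_cong_left) auto

lemma cube_polynomials_mult:
  assumes "f \<in> cube_polynomials" "g \<in> cube_polynomials"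
  shows "(\<lambda>z. f z * g z) \<in> cube_polynomials"
  using assms
proof (induction arbitrary: g)
  case (monomial c k m)
  from monomial.prems show ?case
  proof induction
    case (monomial c' k' m')
    \<comment> \<open>Padding with exponents 0 brings both monomials to the same range of
      indices.\<close>
    define l where "l = max m m'"
    have l: "m \<le> l" "m' \<le> l" by (simp_all add: l_def)
    have "(\<lambda>z. c * (\<Prod>j\<le>m. z j ^ k j) * (c' * (\<Prod>j\<le>m'. z j ^ k' j)))
      = (\<lambda>z. (c * c') * (\<Prod>j\<le>l. z j ^ ((if j \<le> m then k j else 0) + (if j \<le> m' then k' j else 0))))"
      unfolding prod_power_extend[OF l(1)] prod_power_extend[OF l(2)] power_add prod.distrib
      by (simp only: mult_ac)
    then show ?case using cube_polynomials.monomial by simp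
  next
    case (add f g)
    from cube_polynomials.add[OF add.IH] show ?case by (simp only: distrib_left)
  qed
next
  case (add f1 f2)
  from cube_polynomials.add[OF add.IH(1)[OF add.prems] add.IH(2)[OF add.prems]] show ?case
    by (simp only: distrib_right)
qed

lemma continuous_on_cube_polynomials:
  assumes "f \<in> cube_polynomials"
  shows "continuous_on S f"
  using assms
proof induction
  case (monomial c k m)
  have "continuous_on S (\<lambda>z :: nat \<Rightarrow> real. z j)" for j
    by (rule continuous_on_subset[OF continuous_on_product_coordinates]) simp
  then show ?case by (intro continuous_intros)
qed (intro continuous_intros)

lemma compact_unit_cube: "compact unit_cube"
proof -
  have "compactin (product_topology (\<lambda>j :: nat. euclideanreal) UNIV) (PiE UNIV (\<lambda>_. {0..1}))"
    unfolding compactin_PiE by (simp add: compactin_euclidean_iff)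
  moreover have "PiE UNIV (\<lambda>_ :: nat. {0..1 :: real}) = unit_cube"
    by (auto simp: unit_cube_def PiE_def)
  ultimately show ?thesis by (simp add: euclidean_product_topology compactin_euclidean_iff)
qed

lemma cube_polynomials_dense:
  fixes g :: "(nat \<Rightarrow> real) \<Rightarrow> real"
  assumes "continuous_on UNIV g" "0 < e"
  obtains r where "r \<in> cube_polynomials" "\<And>z. z \<in> unit_cube \<Longrightarrow> \<bar>g z - r z\<bar> < e"
proof -
  interpret function_ring_on cube_polynomials unit_cube
  proof
    show "compact unit_cube" by (rule compact_unit_cube)
    show "(\<lambda>_. c) \<in> cube_polynomials" for c
      using monomial[of c "\<lambda>_. 0" 0] by simp
    fix x y :: "nat \<Rightarrow> real" assume "x \<noteq> y"
    then obtain j where j: "x j \<noteq> y j" by blast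
    \<comment> \<open>A coordinate, written as a monomial; coordinates separate points.\<close>
    define f where "f z = 1 * (\<Prod>i\<le>j. z i ^ (if i = j then 1 else 0))" for z :: "nat \<Rightarrow> real"
    have "f \<in> cube_polynomials" unfolding f_def by (rule monomial)
    moreover have "f z = z j" for z
    proof -
      have "f z = (\<Prod>i\<le>j. if i = j then z j else 1)" unfolding f_def mult_1 by (rule prod.cong) simp_all
      then show ?thesis by simp
    qed
    ultimately show "\<exists>f\<in>cube_polynomials. f x \<noteq> f y" using j by (intro bexI[of _ f]) simp_all
  qed (auto intro: add cube_polynomials_mult continuous_on_cube_polynomials)
  have "continuous_on unit_cube g" by (rule continuous_on_subset[OF assms(1)]) simp
  from Stone_Weierstrass_basic[OF this assms(2)] show ?thesis using that by blast
qed

lemma (in laplace_markov) grid_values_in_unit_cube: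
  "\<omega> \<in> space M \<Longrightarrow> grid_values n (path_of X \<omega>) \<in> unit_cube"
  by (simp add: unit_cube_def grid_values_def path_of_def nonneg)

lemma (in laplace_markov) integrable_grid_values:
  fixes g :: "(nat \<Rightarrow> real) \<Rightarrow> real"
  assumes "continuous_on UNIV g"
  shows "integrable M (\<lambda>\<omega>. g (grid_values n (path_of X \<omega>)))"
proof -
  have "compact (g ` unit_cube)"
    by (intro compact_continuous_image compact_unit_cube continuous_on_subset[OF assms]) simp
  then obtain C where C: "\<And>z. z \<in> unit_cube \<Longrightarrow> \<bar>g z\<bar> \<le> C"
    using compact_imp_bounded[of "g ` unit_cube"] unfolding bounded_iff by auto
  show ?thesis
  proof (rule bounded_integrable)
    show "(\<lambda>\<omega>. g (grid_values n (path_of X \<omega>))) \<in> borel_measurable M"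
      by (rule measurable_compose[OF measurable_grid_values borel_measurable_continuous_onI[OF assms]])
        (rule path_of_measurable)
  qed (rule C[OF grid_values_in_unit_cube])
qed

lemma (in laplace_markov) expectation_grid_values_close:
  assumes g: "continuous_on UNIV g" and r: "continuous_on UNIV r"
    and gr: "\<And>z. z \<in> unit_cube \<Longrightarrow> \<bar>g z - r z\<bar> \<le> (e :: real)"
  shows "\<bar>(\<integral>\<omega>. g (grid_values n (path_of X \<omega>)) \<partial>M) - (\<integral>\<omega>. r (grid_values n (path_of X \<omega>)) \<partial>M)\<bar> \<le> e"
proof -
  note int = integrable_grid_values[OF g, of n] integrable_grid_values[OF r, of n]
  have "(\<integral>\<omega>. g (grid_values n (path_of X \<omega>)) \<partial>M) - (\<integral>\<omega>. r (grid_values n (path_of X \<omega>)) \<partial>M)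
    = (\<integral>\<omega>. g (grid_values n (path_of X \<omega>)) - r (grid_values n (path_of X \<omega>)) \<partial>M)"
    using int by simp
  also have "\<bar>\<dots>\<bar> \<le> (\<integral>\<omega>. e \<partial>M)"
  proof (rule order_trans[OF integral_abs_bound integral_mono])
    show "integrable M (\<lambda>\<omega>. \<bar>g (grid_values n (path_of X \<omega>)) - r (grid_values n (path_of X \<omega>))\<bar>)"
      using int by simp
    show "integrable M (\<lambda>_. e)" by simp
    fix \<omega> assume "\<omega> \<in> space M"
    from gr[OF grid_values_in_unit_cube[OF this]]
    show "\<bar>g (grid_values n (path_of X \<omega>)) - r (grid_values n (path_of X \<omega>))\<bar> \<le> e" .
  qed
  finally show ?thesis by (simp add: prob_space)
qed

lemma monomial_grid_values:
  "c * (\<Prod>j\<le>m. grid_values n (path_of X \<omega>) j ^ k j)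
    = c * exp (- (\<Sum>j\<le>m. real (k j) * X (real j * (1 / real n)) \<omega>))"
  by (simp add: grid_values_def path_of_def exp_of_nat_mult[symmetric] exp_sum[symmetric] sum_negf[symmetric])

theorem grid_values_tendsto:
  fixes g :: "(nat \<Rightarrow> real) \<Rightarrow> real"
  assumes ev: "eventually (\<lambda>i. laplace_markov (M i) (G i) (X i) (V i) (\<Phi> i)) F"
    and N: "laplace_markov N H Y W \<Psi>"
    and convV: "\<And>t z zi. 0 \<le> t \<Longrightarrow> 0 \<le> z \<Longrightarrow> eventually (\<lambda>i. 0 \<le> zi i) F \<Longrightarrow> (zi \<longlongrightarrow> z) F \<Longrightarrow>
      ((\<lambda>i. V i t (zi i)) \<longlongrightarrow> W t z) F"
    and conv\<Phi>: "\<And>t z zi. 0 \<le> t \<Longrightarrow> 0 \<le> z \<Longrightarrow> eventually (\<lambda>i. 0 \<le> zi i) F \<Longrightarrow> (zi \<longlongrightarrow> z) F \<Longrightarrow>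
      ((\<lambda>i. \<Phi> i t (zi i)) \<longlongrightarrow> \<Psi> t z) F"
    and init: "\<And>z. 0 \<le> z \<Longrightarrow> ((\<lambda>i. \<integral>\<omega>. exp (- z * X i 0 \<omega>) \<partial>M i) \<longlongrightarrow> (\<integral>\<omega>. exp (- z * Y 0 \<omega>) \<partial>N)) F"
    and g: "continuous_on UNIV g"
  shows "((\<lambda>i. \<integral>\<omega>. g (grid_values n (path_of (X i) \<omega>)) \<partial>M i) \<longlongrightarrow>
    (\<integral>\<omega>. g (grid_values n (path_of Y \<omega>)) \<partial>N)) F"
proof -
  interpret N: laplace_markov N H Y W \<Psi> by (rule N)
  have poly: "((\<lambda>i. \<integral>\<omega>. r (grid_values n (path_of (X i) \<omega>)) \<partial>M i) \<longlongrightarrow>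
    (\<integral>\<omega>. r (grid_values n (path_of Y \<omega>)) \<partial>N)) F" if "r \<in> cube_polynomials" for r
    using that
  proof induction
    case (monomial c k m)
    have "((\<lambda>i. \<integral>\<omega>. exp (- (\<Sum>j\<le>m. real (k j) * X i (real j * (1 / real n)) \<omega>)) \<partial>M i) \<longlongrightarrow>
      (\<integral>\<omega>. exp (- (\<Sum>j\<le>m. real (k j) * Y (real j * (1 / real n)) \<omega>)) \<partial>N)) F"
      by (rule laplace_transform_grid_tendsto[OF ev N convV conv\<Phi> init]) auto
    then show ?case unfolding monomial_grid_values integral_mult_right_zero by (intro tendsto_mult tendsto_const)
  next
    case (add f1 f2)
    have c: "continuous_on UNIV f1" "continuous_on UNIV f2"
      using add.hyps continuous_on_cube_polynomials by blast+
    have "eventually (\<lambda>i. (\<integral>\<omega>. f1 (grid_values n (path_of (X i) \<omega>)) \<partial>M i) + (\<integral>\<omega>. f2 (grid_values n (path_of (X i) \<omega>)) \<partial>M i)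
      = (\<integral>\<omega>. f1 (grid_values n (path_of (X i) \<omega>)) + f2 (grid_values n (path_of (X i) \<omega>)) \<partial>M i)) F"
      using ev
    proof eventually_elim
      case (elim i)
      then interpret laplace_markov "M i" "G i" "X i" "V i" "\<Phi> i" .
      show ?case using integrable_grid_values[OF c(1), of n] integrable_grid_values[OF c(2), of n] by simp
    qed
    moreover have "(\<integral>\<omega>. f1 (grid_values n (path_of Y \<omega>)) + f2 (grid_values n (path_of Y \<omega>)) \<partial>N)
      = (\<integral>\<omega>. f1 (grid_values n (path_of Y \<omega>)) \<partial>N) + (\<integral>\<omega>. f2 (grid_values n (path_of Y \<omega>)) \<partial>N)"
      using N.integrable_grid_values[OF c(1), of n] N.integrable_grid_values[OF c(2), of n] by simp
    ultimately show ?case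
      using Lim_transform_eventually[OF tendsto_add[OF add.IH]] by simp
  qed
  show ?thesis
  proof (rule tendstoI)
    fix e :: real assume e: "0 < e"
    then have e3: "0 < e / 3" by simp
    \<comment> \<open>One \<open>r\<close> serves all processes at once, since all their grid values
      lie in the unit cube.\<close>
    obtain r where r: "r \<in> cube_polynomials" and gr: "\<And>z. z \<in> unit_cube \<Longrightarrow> \<bar>g z - r z\<bar> < e / 3"
      by (rule cube_polynomials_dense[OF g e3]) (rule that)
    have rc: "continuous_on UNIV r" by (rule continuous_on_cube_polynomials[OF r])
    from tendstoD[OF poly[OF r] e3] ev
    show "eventually (\<lambda>i. dist (\<integral>\<omega>. g (grid_values n (path_of (X i) \<omega>)) \<partial>M i) (\<integral>\<omega>. g (grid_values n (path_of Y \<omega>)) \<partial>N) < e) F"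
    proof eventually_elim
      case (elim i)
      have "\<bar>(\<integral>\<omega>. g (grid_values n (path_of (X i) \<omega>)) \<partial>M i) - (\<integral>\<omega>. r (grid_values n (path_of (X i) \<omega>)) \<partial>M i)\<bar> \<le> e / 3"
        by (rule laplace_markov.expectation_grid_values_close[OF elim(2) g rc less_imp_le[OF gr]])
      moreover have "\<bar>(\<integral>\<omega>. g (grid_values n (path_of Y \<omega>)) \<partial>N) - (\<integral>\<omega>. r (grid_values n (path_of Y \<omega>)) \<partial>N)\<bar> \<le> e / 3"
        by (rule N.expectation_grid_values_close[OF g rc less_imp_le[OF gr]])
      ultimately show ?case using elim(1) unfolding dist_real_def by linarith
    qed
  qed
qed


subsection \<open>Stability of the cumulant equation\<close>

text \<open>The cumulant equation has a one-sided derivative at time 0. In the interior the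
  derivative is two-sided, and at the endpoint it is used through continuity.\<close>

lemma nonincreasing_within:
  fixes g :: "real \<Rightarrow> real"
  assumes d: "\<And>s. 0 \<le> s \<Longrightarrow> s \<le> T \<Longrightarrow> (g has_real_derivative g' s) (at s within {0..})"
    and neg: "\<And>s. 0 \<le> s \<Longrightarrow> s \<le> T \<Longrightarrow> g' s \<le> 0" and t: "0 \<le> t" "t \<le> T"
  shows "g t \<le> g 0"
proof (rule DERIV_nonpos_imp_decreasing_open[OF t(1)])
  fix s assume s: "0 < s" "s < t"
  then have "at s within {0..} = at s" by (intro at_within_interior) simp
  moreover have sT: "0 \<le> s" "s \<le> T" using s t by linarith+
  ultimately have "(g has_real_derivative g' s) (at s)" using d[OF sT] by (simp only:)
  with neg[OF sT] show "\<exists>y. (g has_real_derivative y) (at s) \<and> y \<le> 0" by blast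
next
  show "continuous_on {0..t} g"
    unfolding continuous_on_eq_continuous_within
  proof
    fix s assume s: "s \<in> {0..t}"
    have "0 \<le> s" "s \<le> T" using s t by auto
    from d[OF this] have "(g has_real_derivative g' s) (at s within {0..t})"
      by (rule DERIV_subset) auto
    then show "continuous (at s within {0..t}) g" by (rule DERIV_continuous)
  qed
qed

text \<open>Squaring avoids the derivative of an absolute value. For the distance \<open>d\<close>
  of the two functions, \<open>2 * e * d \<le> e\<^sup>2 + d\<^sup>2\<close> turns the perturbation
  into the additive \<open>e\<^sup>2\<close> and accounts for the 1 in
  \<open>2 * L + 1\<close>.\<close>

lemma gronwall_square:
  fixes v w :: "real \<Rightarrow> real"
  assumes v: "\<And>s. 0 \<le> s \<Longrightarrow> s \<le> T \<Longrightarrow> (v has_real_derivative v' s) (at s within {0..})"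
    and w: "\<And>s. 0 \<le> s \<Longrightarrow> s \<le> T \<Longrightarrow> (w has_real_derivative w' s) (at s within {0..})"
    and bound: "\<And>s. 0 \<le> s \<Longrightarrow> s \<le> T \<Longrightarrow> \<bar>v' s - w' s\<bar> \<le> e + L * \<bar>v s - w s\<bar>"
    and L: "0 \<le> L" and t: "0 \<le> t" "t \<le> T"
  shows "(v t - w t)\<^sup>2 \<le> ((v 0 - w 0)\<^sup>2 + e\<^sup>2 * t) * exp ((2 * L + 1) * t)"
proof -
  define m where "m = 2 * L + 1"
  define g where "g s = (v s - w s)\<^sup>2 * exp (- m * s) - e\<^sup>2 * s" for s
  define g' where "g' s = (2 * (v s - w s) * (v' s - w' s) - m * (v s - w s)\<^sup>2) * exp (- m * s) - e\<^sup>2" for s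
  have "g t \<le> g 0"
  proof (rule nonincreasing_within[where g' = g' and T = T])
    fix s assume s: "0 \<le> s" "s \<le> T"
    show "(g has_real_derivative g' s) (at s within {0..})"
      unfolding g_def g'_def
      by (rule derivative_eq_intros v[OF s] w[OF s] refl)+ (simp add: algebra_simps power2_eq_square)
    have "(v s - w s) * (v' s - w' s) \<le> \<bar>v s - w s\<bar> * \<bar>v' s - w' s\<bar>"
      by (metis abs_ge_self abs_mult)
    also have "\<dots> \<le> \<bar>v s - w s\<bar> * (e + L * \<bar>v s - w s\<bar>)"
      by (intro mult_left_mono bound s) simp
    also have "\<dots> = e * \<bar>v s - w s\<bar> + L * (v s - w s)\<^sup>2"
      by (simp add: distrib_left power2_eq_square)
    finally have 1: "(v s - w s) * (v' s - w' s) \<le> e * \<bar>v s - w s\<bar> + L * (v s - w s)\<^sup>2" .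
    have "0 \<le> (e - \<bar>v s - w s\<bar>)\<^sup>2" by simp
    then have 2: "2 * (e * \<bar>v s - w s\<bar>) \<le> e\<^sup>2 + (v s - w s)\<^sup>2" by (simp add: power2_diff)
    have "2 * (v s - w s) * (v' s - w' s) = 2 * ((v s - w s) * (v' s - w' s))"
      "m * (v s - w s)\<^sup>2 = 2 * (L * (v s - w s)\<^sup>2) + (v s - w s)\<^sup>2"
      by (simp_all add: m_def distrib_right)
    with 1 2 have "2 * (v s - w s) * (v' s - w' s) - m * (v s - w s)\<^sup>2 \<le> e\<^sup>2" by linarith
    then have "(2 * (v s - w s) * (v' s - w' s) - m * (v s - w s)\<^sup>2) * exp (- m * s) \<le> e\<^sup>2 * exp (- m * s)"
      by (intro mult_right_mono) auto
    also have "\<dots> \<le> e\<^sup>2 * 1"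
    proof (intro mult_left_mono)
      have "0 \<le> m * s" using s L by (simp add: m_def)
      then show "exp (- m * s) \<le> 1" by simp
    qed simp
    finally show "g' s \<le> 0" by (simp add: g'_def)
  qed (use t in auto)
  then have "(v t - w t)\<^sup>2 * exp (- m * t) \<le> (v 0 - w 0)\<^sup>2 + e\<^sup>2 * t" by (simp add: g_def)
  then have "(v t - w t)\<^sup>2 * exp (- m * t) * exp (m * t) \<le> ((v 0 - w 0)\<^sup>2 + e\<^sup>2 * t) * exp (m * t)"
    by (intro mult_right_mono) auto
  moreover have "(v t - w t)\<^sup>2 * exp (- m * t) * exp (m * t) = (v t - w t)\<^sup>2"
    by (simp add: mult.assoc exp_add[symmetric])
  ultimately show ?thesis by (simp only: m_def)
qed

text \<open>Comparison with a linear equation, by means of its integrating factor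
  \<open>exp (- c * s)\<close>.\<close>

lemma solves_cumulant_ode_le:
  assumes v: "solves_cumulant_ode R z v" and R: "\<And>x. 0 \<le> x \<Longrightarrow> - c * x \<le> R x" and t: "0 \<le> t"
  shows "v t \<le> z * exp (c * t)"
proof -
  have v0: "v 0 = z" and vd: "\<And>s. 0 \<le> s \<Longrightarrow> (v has_real_derivative - R (v s)) (at s within {0..})"
    and vn: "\<And>s. 0 \<le> s \<Longrightarrow> 0 \<le> v s"
    using v by (auto simp: solves_cumulant_ode_def)
  define g where "g s = v s * exp (- c * s)" for s
  have "g t \<le> g 0"
  proof (rule nonincreasing_within[where g' = "\<lambda>s. (- R (v s) - c * v s) * exp (- c * s)" and T = t])
    fix s :: real assume s: "0 \<le> s"
    show "(g has_real_derivative (- R (v s) - c * v s) * exp (- c * s)) (at s within {0..})"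
      unfolding g_def by (rule derivative_eq_intros vd[OF s] refl)+ (simp add: algebra_simps)
    show "(- R (v s) - c * v s) * exp (- c * s) \<le> 0"
      using R[OF vn[OF s]] by (intro mult_nonpos_nonneg) auto
  qed (use t in auto)
  then have "v t * exp (- c * t) * exp (c * t) \<le> z * exp (c * t)"
    by (intro mult_right_mono) (auto simp: g_def v0)
  then show ?thesis by (simp add: mult.assoc exp_add[symmetric])
qed

lemma solves_cumulant_ode_continuous:
  assumes "solves_cumulant_ode R z v"
  shows "continuous_on {0..} v"
  unfolding continuous_on_eq_continuous_within
  using assms DERIV_continuous by (fastforce simp: solves_cumulant_ode_def)

section \<open>Convergence of cumulants and of the integrated immigration\<close>

definition integrated_immigration :: "(real \<Rightarrow> real) \<Rightarrow> (real \<Rightarrow> real \<Rightarrow> real) \<Rightarrow> real \<Rightarrow> real \<Rightarrow> real" where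
  "integrated_immigration F v t z = integral {0..t} (\<lambda>s. F (v s z))"

text \<open>The mechanisms converge uniformly on compact intervals. The linear lower bound
  \<open>lower\<close>, common to all large \<open>i\<close>, confines the cumulants to such an
  interval over bounded times. The limits are quadratic and linear, which is what the fourth
  difference exploits.\<close>

locale cumulant_limit =
  fixes R F :: "'i \<Rightarrow> real \<Rightarrow> real" and v :: "'i \<Rightarrow> real \<Rightarrow> real \<Rightarrow> real" and w :: "real \<Rightarrow> real \<Rightarrow> real"
    and A B C c :: real and L :: "'i filter"
  assumes solves: "eventually (\<lambda>i. \<forall>z\<ge>0. solves_cumulant_ode (R i) z (\<lambda>t. v i t z)) L"
    and solves0: "\<And>z. 0 \<le> z \<Longrightarrow> solves_cumulant_ode (\<lambda>x. B * x + A * x\<^sup>2) z (\<lambda>t. w t z)"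
    and lower: "eventually (\<lambda>i. \<forall>x\<ge>0. - c * x \<le> R i x) L"
    and A: "0 \<le> A" and c: "0 \<le> c" "- c \<le> B"
    and R_unif: "\<And>K e. 0 < e \<Longrightarrow> eventually (\<lambda>i. \<forall>x\<in>{0..K}. \<bar>R i x - (B * x + A * x\<^sup>2)\<bar> \<le> e) L"
    and F_unif: "\<And>K e. 0 < e \<Longrightarrow> eventually (\<lambda>i. \<forall>x\<in>{0..K}. \<bar>F i x - C * x\<bar> \<le> e) L"
    and F_cont: "eventually (\<lambda>i. continuous_on {0..} (F i)) L"
begin

abbreviation "R0 x \<equiv> B * x + A * x\<^sup>2"

lemma lower0: "0 \<le> x \<Longrightarrow> - c * x \<le> R0 x"
  using mult_right_mono[OF c(2), of x] A by (simp add: add_increasing2)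

lemma w_bounds: "0 \<le> z \<Longrightarrow> 0 \<le> t \<Longrightarrow> t \<le> T \<Longrightarrow> 0 \<le> w t z \<and> w t z \<le> z * exp (c * T)"
  using solves_cumulant_ode_le[OF solves0 lower0, of z t] solves0[of z] c
  by (auto simp: solves_cumulant_ode_def intro: order_trans[OF _ mult_left_mono])

lemma R0_lipschitz:
  assumes "0 \<le> x" "x \<le> K" "0 \<le> y" "y \<le> K"
  shows "\<bar>R0 x - R0 y\<bar> \<le> (\<bar>B\<bar> + A * (2 * K)) * \<bar>x - y\<bar>"
proof -
  have "R0 x - R0 y = (B + A * (x + y)) * (x - y)" by (simp add: algebra_simps power2_eq_square)
  then have "\<bar>R0 x - R0 y\<bar> = \<bar>B + A * (x + y)\<bar> * \<bar>x - y\<bar>" by (simp add: abs_mult)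
  moreover have "A * (x + y) \<le> A * (2 * K)" "0 \<le> A * (x + y)" using assms A by (auto intro!: mult_left_mono)
  ultimately show ?thesis by (auto intro!: mult_right_mono)
qed

lemma cumulant_uniform:
  assumes z: "0 \<le> z" and zi: "eventually (\<lambda>i. 0 \<le> zi i) L" "(zi \<longlongrightarrow> z) L" and T: "0 \<le> T" and e: "0 < e"
  shows "eventually (\<lambda>i. \<forall>t\<in>{0..T}. \<bar>v i t (zi i) - w t z\<bar> \<le> e) L"
proof -
  \<comment> \<open>\<open>zi i\<close> is eventually at most \<open>z + 1\<close>, so
    \<open>K\<close> bounds the cumulants of all large \<open>i\<close> on
    \<open>[0,T]\<close>.\<close>
  define K where "K = (z + 1) * exp (c * T)"
  define m where "m = \<bar>B\<bar> + A * (2 * K)"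
  define D where "D = (1 + T) * exp ((2 * m + 1) * T)"
  have K: "0 \<le> K" using z by (simp add: K_def)
  have m: "0 \<le> m" using A K by (simp add: m_def)
  have D: "0 < D" using T by (simp add: D_def)
  \<comment> \<open>When the starting distance and the perturbation are at most
    \<open>\<eta>\<close>, Gronwall's bound is \<open>\<eta>\<^sup>2 * D\<close>; this choice makes
    it \<open>e\<^sup>2\<close>.\<close>
  define \<eta> where "\<eta> = e / sqrt D"
  have \<eta>: "0 < \<eta>" "\<eta>\<^sup>2 * D = e\<^sup>2" using e D by (simp_all add: \<eta>_def power_divide)
  have "eventually (\<lambda>i. dist (zi i) z < min 1 \<eta>) L" by (rule tendstoD[OF zi(2)]) (use \<eta> in simp)
  with zi(1) solves lower R_unif[OF \<eta>(1), of K] show ?thesis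
  proof eventually_elim
    case (elim i)
    have zi1: "zi i \<le> z + 1" "\<bar>zi i - z\<bar> \<le> \<eta>" using elim(5) by (auto simp: dist_real_def abs_less_iff)
    have sv: "solves_cumulant_ode (R i) (zi i) (\<lambda>t. v i t (zi i))" using elim by blast
    note sw = solves0[OF z]
    show ?case
    proof
      fix t assume t: "t \<in> {0..T}"
      have vb: "0 \<le> v i s (zi i) \<and> v i s (zi i) \<le> K" if "0 \<le> s" "s \<le> T" for s
      proof -
        have "v i s (zi i) \<le> zi i * exp (c * s)"
          by (rule solves_cumulant_ode_le[OF sv]) (use elim(3) that in auto)
        also have "\<dots> \<le> K" unfolding K_def using zi1 elim(1) that c z
          by (intro mult_mono) (auto intro!: mult_left_mono)
        finally show ?thesis using sv that by (auto simp: solves_cumulant_ode_def)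
      qed
      have wb: "0 \<le> w s z \<and> w s z \<le> K" if "0 \<le> s" "s \<le> T" for s
        using w_bounds[OF z that] unfolding K_def by (auto simp: distrib_right intro: order_trans)
      have "(v i t (zi i) - w t z)\<^sup>2 \<le> ((v i 0 (zi i) - w 0 z)\<^sup>2 + \<eta>\<^sup>2 * t) * exp ((2 * m + 1) * t)"
      proof (rule gronwall_square[where T = T and v' = "\<lambda>s. - R i (v i s (zi i))" and w' = "\<lambda>s. - R0 (w s z)"])
        fix s assume s: "0 \<le> s" "s \<le> T"
        show "((\<lambda>t. v i t (zi i)) has_real_derivative - R i (v i s (zi i))) (at s within {0..})"
          "((\<lambda>t. w t z) has_real_derivative - R0 (w s z)) (at s within {0..})"
          using sv sw s by (auto simp: solves_cumulant_ode_def)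
        have "\<bar>R i (v i s (zi i)) - R0 (v i s (zi i))\<bar> \<le> \<eta>" using elim(4) vb[OF s] by auto
        moreover have "\<bar>R0 (v i s (zi i)) - R0 (w s z)\<bar> \<le> m * \<bar>v i s (zi i) - w s z\<bar>"
          unfolding m_def using vb[OF s] wb[OF s] by (intro R0_lipschitz) auto
        ultimately show "\<bar>- R i (v i s (zi i)) - - R0 (w s z)\<bar> \<le> \<eta> + m * \<bar>v i s (zi i) - w s z\<bar>"
          by linarith
      qed (use m t in auto)
      also have "\<dots> \<le> (\<eta>\<^sup>2 + \<eta>\<^sup>2 * T) * exp ((2 * m + 1) * T)"
      proof (intro mult_mono add_mono)
        have "v i 0 (zi i) - w 0 z = zi i - z" using sv sw by (simp add: solves_cumulant_ode_def)
        then show "(v i 0 (zi i) - w 0 z)\<^sup>2 \<le> \<eta>\<^sup>2"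
          using zi1(2) \<eta>(1) by (simp add: abs_le_square_iff[symmetric])
      qed (use t m in \<open>auto intro!: mult_left_mono\<close>)
      also have "\<dots> = e\<^sup>2" using \<eta>(2) by (simp add: D_def algebra_simps)
      finally show "\<bar>v i t (zi i) - w t z\<bar> \<le> e" using e by (simp add: abs_le_square_iff[symmetric])
    qed
  qed
qed

lemma immigration_uniform:
  assumes z: "0 \<le> z" and zi: "eventually (\<lambda>i. 0 \<le> zi i) L" "(zi \<longlongrightarrow> z) L" and T: "0 \<le> T" and e: "0 < e"
  shows "eventually (\<lambda>i. \<forall>t\<in>{0..T}. \<bar>integrated_immigration (F i) (v i) t (zi i)
    - integrated_immigration (\<lambda>x. C * x) w t z\<bar> \<le> e) L"
proof -
  \<comment> \<open>An error \<open>d\<close> in both mechanism and cumulant costs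
    \<open>(1 + \<bar>C\<bar>) * d\<close> per unit of time; the 1 added to \<open>T\<close> avoids
    a division by 0 at \<open>T = 0\<close>.\<close>
  define E where "E = (1 + \<bar>C\<bar>) * (1 + T)"
  define d where "d = e / E"
  have dpos: "0 < E" unfolding E_def using T by (intro mult_pos_pos) auto
  then have d: "0 < d" using e by (simp add: d_def)
  have dle: "(d + \<bar>C\<bar> * d) * T \<le> e"
  proof -
    have "(d + \<bar>C\<bar> * d) * T = d * ((1 + \<bar>C\<bar>) * T)" by (simp add: algebra_simps)
    also have "\<dots> \<le> d * E" unfolding E_def using d by (intro mult_left_mono) auto
    also have "\<dots> = e" using dpos by (simp add: d_def)
    finally show ?thesis .
  qed
  \<comment> \<open>The cumulant for \<open>i\<close> exceeds the limit cumulant by at most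
    \<open>d\<close>, so it stays in \<open>[0,K]\<close>.\<close>
  define K where "K = z * exp (c * T) + d"
  from F_cont F_unif[OF d, of K] cumulant_uniform[OF z zi T d] solves zi(1) show ?thesis
  proof eventually_elim
    case (elim i)
    have sv: "solves_cumulant_ode (R i) (zi i) (\<lambda>t. v i t (zi i))" using elim by blast
    note sw = solves0[OF z]
    have vn: "0 \<le> v i s (zi i)" if "0 \<le> s" for s using sv that by (auto simp: solves_cumulant_ode_def)
    show ?case
    proof
      fix t assume t: "t \<in> {0..T}"
      have "continuous_on {0..} (\<lambda>s. F i (v i s (zi i)))"
        by (rule continuous_on_compose2[OF elim(1) solves_cumulant_ode_continuous[OF sv]]) (use vn in auto)
      then have c1: "continuous_on {0..t} (\<lambda>s. F i (v i s (zi i)))" by (rule continuous_on_subset) auto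
      have "continuous_on {0..} (\<lambda>s. C * w s z)"
        by (intro continuous_intros solves_cumulant_ode_continuous[OF sw])
      then have c2: "continuous_on {0..t} (\<lambda>s. C * w s z)" by (rule continuous_on_subset) auto
      have "integrated_immigration (F i) (v i) t (zi i) - integrated_immigration (\<lambda>x. C * x) w t z
        = integral {0..t} (\<lambda>s. F i (v i s (zi i)) - C * w s z)"
        unfolding integrated_immigration_def
        by (intro integral_diff[symmetric] integrable_continuous_real c1 c2)
      also have "norm \<dots> \<le> (d + \<bar>C\<bar> * d) * (t - 0)"
      proof (rule integral_bound)
        show "continuous_on {0..t} (\<lambda>s. F i (v i s (zi i)) - C * w s z)"
          by (intro continuous_on_diff c1 c2)
        fix s assume s: "s \<in> {0..t}"
        then have s': "0 \<le> s" "s \<le> T" using t by auto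
        have vw: "\<bar>v i s (zi i) - w s z\<bar> \<le> d" using elim(3) s' by auto
        then have "v i s (zi i) \<in> {0..K}"
          using vn[OF s'(1)] w_bounds[OF z s'] by (auto simp: K_def)
        then have "\<bar>F i (v i s (zi i)) - C * v i s (zi i)\<bar> \<le> d" using elim(2) by blast
        moreover have "\<bar>C * v i s (zi i) - C * w s z\<bar> \<le> \<bar>C\<bar> * d"
          unfolding right_diff_distrib[symmetric] abs_mult by (intro mult_left_mono vw) simp
        ultimately show "norm (F i (v i s (zi i)) - C * w s z) \<le> d + \<bar>C\<bar> * d"
          unfolding real_norm_def by linarith
      qed (use t in simp)
      also have "\<dots> \<le> (d + \<bar>C\<bar> * d) * T" using t d by (intro mult_left_mono) auto
      finally show "\<bar>integrated_immigration (F i) (v i) t (zi i) - integrated_immigration (\<lambda>x. C * x) w t z\<bar> \<le> e"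
        using dle by simp
    qed
  qed
qed

text \<open>Up to time \<open>s\<close> the cumulant moves by at most \<open>m * K * s\<close>. The
  Lipschitz bound on \<open>R0\<close> turns this into a bound on the variation of its derivative,
  and the mean value inequality gives the quadratic remainder.\<close>

lemma cumulant_taylor:
  assumes z: "0 \<le> z"
  obtains D where "0 \<le> D" "\<And>t. 0 \<le> t \<Longrightarrow> t \<le> 1 \<Longrightarrow> \<bar>w t z - z + t * R0 z\<bar> \<le> D * t\<^sup>2"
    "\<And>t. 0 \<le> t \<Longrightarrow> t \<le> 1 \<Longrightarrow> \<bar>integrated_immigration (\<lambda>x. C * x) w t z - t * (C * z)\<bar> \<le> D * t\<^sup>2"
proof -
  define K where "K = z * exp c"
  define m where "m = \<bar>B\<bar> + A * (2 * K)"
  have K: "0 \<le> K" "z \<le> K" using z c mult_left_mono[of 1 "exp c" z] by (simp_all add: K_def)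
  have m: "0 \<le> m" using A K by (simp add: m_def)
  have sw: "w 0 z = z" "\<And>s. 0 \<le> s \<Longrightarrow> ((\<lambda>t. w t z) has_real_derivative - R0 (w s z)) (at s within {0..})"
    using solves0[OF z] by (auto simp: solves_cumulant_ode_def)
  have wb: "0 \<le> w s z \<and> w s z \<le> K" if "0 \<le> s" "s \<le> 1" for s
    using w_bounds[OF z that] by (simp add: K_def)
  have R0K: "\<bar>R0 (w s z)\<bar> \<le> m * K" if "0 \<le> s" "s \<le> 1" for s
  proof -
    have "\<bar>R0 (w s z) - R0 0\<bar> \<le> m * \<bar>w s z - 0\<bar>"
      unfolding m_def using wb[OF that] K by (intro R0_lipschitz) auto
    also have "\<dots> \<le> m * K" using wb[OF that] m by (intro mult_left_mono) auto
    finally show ?thesis by simp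
  qed
  have inc: "\<bar>w s z - z\<bar> \<le> m * K * s" if s: "0 \<le> s" "s \<le> 1" for s
  proof -
    have "norm (w s z - w 0 z) \<le> (m * K) * norm (s - 0)"
    proof (rule field_differentiable_bound[where S = "{0..s}"])
      show "((\<lambda>t. w t z) has_field_derivative - R0 (w r z)) (at r within {0..s})" if "r \<in> {0..s}" for r
        using that by (intro DERIV_subset[OF sw(2)]) auto
      show "norm (- R0 (w r z)) \<le> m * K" if "r \<in> {0..s}" for r
        using R0K[of r] that s by simp
    qed (use s in auto)
    then show ?thesis using s sw(1) by simp
  qed
  have D1: "\<bar>w t z - z + t * R0 z\<bar> \<le> (m * (m * K)) * t\<^sup>2" if t: "0 \<le> t" "t \<le> 1" for t
  proof -
    define g where "g r = w r z + r * R0 z" for r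
    have "norm (g t - g 0) \<le> (m * (m * K * t)) * norm (t - 0)"
    proof (rule field_differentiable_bound[where S = "{0..t}"])
      fix r assume r: "r \<in> {0..t}"
      have "((\<lambda>t. w t z) has_field_derivative - R0 (w r z)) (at r within {0..t})"
        using r by (intro DERIV_subset[OF sw(2)]) auto
      then show "(g has_field_derivative - R0 (w r z) + R0 z) (at r within {0..t})"
        unfolding g_def by (auto intro!: derivative_eq_intros)
      have "\<bar>R0 z - R0 (w r z)\<bar> \<le> m * \<bar>z - w r z\<bar>"
        unfolding m_def using wb[of r] r t z K by (intro R0_lipschitz) auto
      also have "\<dots> \<le> m * (m * K * t)"
      proof (intro mult_left_mono m)
        have "\<bar>z - w r z\<bar> \<le> m * K * r" using inc[of r] r t by (simp add: abs_minus_commute)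
        also have "\<dots> \<le> m * K * t" using r m K by (intro mult_left_mono) auto
        finally show "\<bar>z - w r z\<bar> \<le> m * K * t" .
      qed
      finally show "norm (- R0 (w r z) + R0 z) \<le> m * (m * K * t)" by simp
    qed (use t in auto)
    then show ?thesis using t sw(1) by (simp add: g_def power2_eq_square algebra_simps)
  qed
  have D2: "\<bar>integrated_immigration (\<lambda>x. C * x) w t z - t * (C * z)\<bar> \<le> (\<bar>C\<bar> * (m * K)) * t\<^sup>2"
    if t: "0 \<le> t" "t \<le> 1" for t
  proof -
    have "continuous_on {0..t} (\<lambda>s. w s z)"
      by (rule continuous_on_subset[OF solves_cumulant_ode_continuous[OF solves0[OF z]]]) auto
    then have cw: "continuous_on {0..t} (\<lambda>s. C * w s z)" by (intro continuous_intros)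
    have "integrated_immigration (\<lambda>x. C * x) w t z - t * (C * z)
      = integral {0..t} (\<lambda>s. C * w s z) - integral {0..t} (\<lambda>s. C * z)"
      using t by (simp add: integrated_immigration_def)
    also have "\<dots> = integral {0..t} (\<lambda>s. C * w s z - C * z)"
      by (intro integral_diff[symmetric] integrable_continuous_real cw continuous_on_const)
    also have "norm \<dots> \<le> (\<bar>C\<bar> * (m * K * t)) * (t - 0)"
    proof (rule integral_bound)
      show "continuous_on {0..t} (\<lambda>s. C * w s z - C * z)" by (intro continuous_intros cw)
      fix s assume s: "s \<in> {0..t}"
      have "\<bar>w s z - z\<bar> \<le> m * K * s" using inc[of s] s t by simp
      also have "\<dots> \<le> m * K * t" using s m K by (intro mult_left_mono) auto
      finally show "norm (C * w s z - C * z) \<le> \<bar>C\<bar> * (m * K * t)"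
        unfolding right_diff_distrib[symmetric] real_norm_def abs_mult by (intro mult_left_mono) auto
    qed (use t in simp)
    finally show ?thesis by (simp add: power2_eq_square mult_ac)
  qed
  show ?thesis
  proof (rule that[of "m * (m * K) + \<bar>C\<bar> * (m * K)"])
    show "0 \<le> m * (m * K) + \<bar>C\<bar> * (m * K)" using m K by simp
    fix t :: real assume t: "0 \<le> t" "t \<le> 1"
    show "\<bar>w t z - z + t * R0 z\<bar> \<le> (m * (m * K) + \<bar>C\<bar> * (m * K)) * t\<^sup>2"
      using D1[OF t] m K by (intro order_trans[OF D1[OF t]] mult_right_mono) auto
    show "\<bar>integrated_immigration (\<lambda>x. C * x) w t z - t * (C * z)\<bar> \<le> (m * (m * K) + \<bar>C\<bar> * (m * K)) * t\<^sup>2"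
      using m K by (intro order_trans[OF D2[OF t]] mult_right_mono) auto
  qed
qed

end

section \<open>Fourth differences of the exponent\<close>

lemma abs_exp_minus_1_minus_self:
  fixes e :: real
  shows "\<bar>exp e - 1 - e\<bar> \<le> e\<^sup>2 * exp \<bar>e\<bar>"
proof -
  have lo: "0 \<le> exp e - 1 - e" using exp_ge_add_one_self[of e] by linarith
  have "(1 + - e) * exp e \<le> exp (- e) * exp e" by (intro mult_right_mono exp_ge_add_one_self) simp
  then have up: "exp e - 1 \<le> e * exp e" by (simp add: exp_minus field_simps)
  have "exp e - 1 - e \<le> e * (exp e - 1)" using up by (simp add: right_diff_distrib)
  also have "\<dots> \<le> e\<^sup>2 * exp \<bar>e\<bar>"
  proof (cases "0 \<le> e")
    case True
    then have "e * (exp e - 1) \<le> e * (e * exp e)" by (intro mult_left_mono up)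
    then show ?thesis using True by (simp add: power2_eq_square mult.assoc)
  next
    case False
    have "e * (exp e - 1) = (- e) * (1 - exp e)" by (simp add: algebra_simps)
    also have "\<dots> \<le> (- e) * (- e)"
    proof (rule mult_left_mono)
      show "1 - exp e \<le> - e" using exp_ge_add_one_self[of e] by linarith
    qed (use False in simp)
    also have "\<dots> \<le> e\<^sup>2 * exp \<bar>e\<bar>"
      using mult_left_mono[of 1 "exp \<bar>e\<bar>" "e\<^sup>2"] by (simp add: power2_eq_square)
    finally show ?thesis .
  qed
  finally show ?thesis using lo by simp
qed

text \<open>The fourth difference of a polynomial of degree two vanishes, so only second-order terms in
  the time \<open>t\<close> survive.\<close>

lemma kernel4_le:
  fixes V \<Phi> :: "real \<Rightarrow> real \<Rightarrow> real" and A B C \<kappa> \<rho> q t x :: real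
  assumes x: "0 \<le> x" and t: "0 \<le> t"
    and V: "\<And>k :: nat. k \<le> 4 \<Longrightarrow> \<bar>V t (real k) - real k + t * (B * real k + A * (real k)\<^sup>2)\<bar> \<le> \<kappa>"
    and \<Phi>: "\<And>k :: nat. k \<le> 4 \<Longrightarrow> \<bar>\<Phi> t (real k) - t * (C * real k)\<bar> \<le> \<kappa>"
    and \<rho>: "\<And>k :: nat. k \<le> 4 \<Longrightarrow> \<bar>B * real k + A * (real k)\<^sup>2\<bar> \<le> \<rho>" "\<And>k :: nat. k \<le> 4 \<Longrightarrow> \<bar>C * real k\<bar> \<le> \<rho>"
    and q: "\<kappa> + t * \<rho> \<le> q" "q \<le> 1"
  shows "kernel4 V \<Phi> t x \<le> 16 * (\<kappa> + 3 * q\<^sup>2)"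
proof -
  define cf where "cf k = real (4 choose k) * (- 1) ^ (4 - k)" for k :: nat
  \<comment> \<open>After \<open>exp (- 4 * x)\<close> is taken out of the \<open>k\<close>-th term,
    the exponent left is \<open>e k\<close>; \<open>a k\<close> is its first-order part in
    \<open>t\<close>.\<close>
  define e where "e k = - x * (V t (real k) - real k) - \<Phi> t (real k)" for k :: nat
  define a where "a k = t * (x * (B * real k + A * (real k)\<^sup>2) - C * real k)" for k :: nat
  define D where "D = (1 + x) * \<kappa> + ((1 + x) * q)\<^sup>2 * exp (1 + x)"
  have \<kappa>0: "0 \<le> \<kappa>" using \<Phi>[of 0] abs_ge_zero order_trans by blast
  have \<rho>0: "0 \<le> \<rho>" using \<rho>(2)[of 0] abs_ge_zero order_trans by blast
  have q0: "0 \<le> q" using q(1) \<kappa>0 \<rho>0 t by (meson add_nonneg_nonneg mult_nonneg_nonneg order_trans)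
  have set4: "{..4 :: nat} = {0, 1, 2, 3, 4}" by auto
  have choose4: "(4 choose 0) = (1 :: nat)" "(4 choose 1) = (4 :: nat)" "(4 choose 2) = (6 :: nat)"
    "(4 choose 3) = (4 :: nat)" "(4 choose 4) = (1 :: nat)"
    by (simp_all add: eval_nat_numeral)
  \<comment> \<open>\<open>1 + a k\<close> is a polynomial of degree at most two in
    \<open>k\<close>.\<close>
  have zero: "(\<Sum>k\<le>4. cf k * (1 + a k)) = 0"
    unfolding set4 cf_def a_def by (simp add: choose4[simplified] algebra_simps power2_eq_square)
  have sixteen: "(\<Sum>k\<le>4. real (4 choose k)) = 16"
    unfolding set4 by (simp add: choose4[simplified])
  have term_le: "cf k * (exp (e k) - 1 - a k) \<le> real (4 choose k) * D" if k: "k \<le> 4" for k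
  proof -
    have ea: "\<bar>e k - a k\<bar> \<le> (1 + x) * \<kappa>"
    proof -
      have "e k - a k = - (x * (V t (real k) - real k + t * (B * real k + A * (real k)\<^sup>2))) - (\<Phi> t (real k) - t * (C * real k))"
        by (simp add: e_def a_def algebra_simps)
      moreover have "\<bar>x * (V t (real k) - real k + t * (B * real k + A * (real k)\<^sup>2))\<bar> \<le> x * \<kappa>"
        using V[OF k] x by (simp add: abs_mult mult_left_mono)
      ultimately show ?thesis using \<Phi>[OF k] unfolding distrib_right mult_1 by linarith
    qed
    have aa: "\<bar>a k\<bar> \<le> (1 + x) * (t * \<rho>)"
    proof -
      have "\<bar>x * (B * real k + A * (real k)\<^sup>2)\<bar> \<le> x * \<rho>"
        using \<rho>(1)[OF k] x by (simp only: abs_mult abs_of_nonneg mult_left_mono)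
      then have "\<bar>x * (B * real k + A * (real k)\<^sup>2) - C * real k\<bar> \<le> x * \<rho> + \<rho>"
        using \<rho>(2)[OF k] by linarith
      then have "\<bar>a k\<bar> \<le> t * (x * \<rho> + \<rho>)"
        using t by (simp only: a_def abs_mult abs_of_nonneg mult_left_mono)
      then show ?thesis by (simp add: algebra_simps)
    qed
    have "\<bar>e k\<bar> \<le> (1 + x) * \<kappa> + (1 + x) * (t * \<rho>)" using ea aa by linarith
    also have "\<dots> = (1 + x) * (\<kappa> + t * \<rho>)" by (simp only: distrib_left)
    also have "\<dots> \<le> (1 + x) * q" using x q(1) by (intro mult_left_mono) auto
    finally have ek: "\<bar>e k\<bar> \<le> (1 + x) * q" .
    have "(1 + x) * q \<le> 1 + x" using x q(2) by (intro mult_left_le) auto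
    with ek have ek1: "\<bar>e k\<bar> \<le> 1 + x" by (rule order_trans)
    have sq: "(e k)\<^sup>2 \<le> ((1 + x) * q)\<^sup>2"
      using ek power_mono[OF ek abs_ge_zero, of 2] by simp
    have "\<bar>exp (e k) - 1 - e k\<bar> \<le> (e k)\<^sup>2 * exp \<bar>e k\<bar>" by (rule abs_exp_minus_1_minus_self)
    also have "\<dots> \<le> ((1 + x) * q)\<^sup>2 * exp (1 + x)"
      using sq ek1 by (intro mult_mono) auto
    finally have "\<bar>exp (e k) - 1 - a k\<bar> \<le> D" unfolding D_def using ea by linarith
    then have "\<bar>cf k\<bar> * \<bar>exp (e k) - 1 - a k\<bar> \<le> real (4 choose k) * D"
      by (simp add: cf_def abs_mult mult_left_mono)
    then show ?thesis by (metis abs_ge_self abs_mult order_trans)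
  qed
  have "kernel4 V \<Phi> t x = (\<Sum>k\<le>4. exp (- 4 * x) * (cf k * exp (e k)))"
    unfolding kernel4_def
  proof (rule sum.cong[OF refl])
    fix k :: nat assume "k \<in> {..4}"
    then have "exp (- x) ^ (4 - k) = exp (- 4 * x + real k * x)"
      by (simp add: exp_of_nat_mult[symmetric] of_nat_diff algebra_simps)
    then have "exp (- x) ^ (4 - k) * exp (- x * V t (real k) - \<Phi> t (real k)) = exp (- 4 * x) * exp (e k)"
      by (simp add: exp_add[symmetric] e_def algebra_simps)
    then show "real (4 choose k) * (- 1) ^ (4 - k) * (exp (- x) ^ (4 - k) * exp (- x * V t (real k) - \<Phi> t (real k)))
      = exp (- 4 * x) * (cf k * exp (e k))"
      by (simp only: cf_def mult_ac)
  qed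
  also have "\<dots> = exp (- 4 * x) * (\<Sum>k\<le>4. cf k * exp (e k))" by (simp only: sum_distrib_left)
  also have "(\<Sum>k\<le>4. cf k * exp (e k)) = (\<Sum>k\<le>4. cf k * (exp (e k) - 1 - a k)) + (\<Sum>k\<le>4. cf k * (1 + a k))"
    by (simp add: sum.distrib[symmetric] algebra_simps)
  also have "\<dots> = (\<Sum>k\<le>4. cf k * (exp (e k) - 1 - a k))" by (simp only: zero add_0_right)
  also have "exp (- 4 * x) * \<dots> \<le> exp (- 4 * x) * (\<Sum>k\<le>4. real (4 choose k) * D)"
    by (intro mult_left_mono sum_mono term_le) auto
  also have "\<dots> = 16 * (exp (- 4 * x) * D)"
    unfolding sum_distrib_right[symmetric] sixteen by (rule mult.left_commute)
  \<comment> \<open>From \<open>1 + x \<le> exp x\<close>, the product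
    \<open>(1 + x)\<^sup>2 * exp (1 + x)\<close> is at most \<open>exp (1 + 3 * x)\<close>. The
    prefactor leaves \<open>exp (1 - x)\<close>, at most \<open>exp 1\<close>; this is the origin of
    the 3.\<close>
  also have "exp (- 4 * x) * D \<le> \<kappa> + 3 * q\<^sup>2"
  proof -
    have x1: "1 + x \<le> exp x" by (rule exp_ge_add_one_self)
    have "exp (- 4 * x) * (1 + x) \<le> exp (- 4 * x) * exp x" by (intro mult_left_mono x1) simp
    also have "\<dots> = exp (- 3 * x)" by (simp add: exp_add[symmetric])
    also have "\<dots> \<le> 1" using x by simp
    finally have "exp (- 4 * x) * (1 + x) * \<kappa> \<le> 1 * \<kappa>" by (rule mult_right_mono[OF _ \<kappa>0])
    moreover have "exp (- 4 * x) * ((1 + x)\<^sup>2 * exp (1 + x)) \<le> 3"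
    proof -
      have "(1 + x)\<^sup>2 \<le> (exp x)\<^sup>2" using x by (intro power_mono x1) auto
      then have "exp (- 4 * x) * ((1 + x)\<^sup>2 * exp (1 + x)) \<le> exp (- 4 * x) * ((exp x)\<^sup>2 * exp (1 + x))"
        by (intro mult_left_mono mult_right_mono) auto
      also have "\<dots> = exp (1 - x)" by (simp add: exp_add[symmetric] exp_of_nat_mult[symmetric])
      also have "\<dots> \<le> exp 1" using x by simp
      also have "\<dots> \<le> 3" by (rule exp_le)
      finally show ?thesis .
    qed
    then have "exp (- 4 * x) * ((1 + x)\<^sup>2 * exp (1 + x)) * q\<^sup>2 \<le> 3 * q\<^sup>2" by (rule mult_right_mono) simp
    moreover have "exp (- 4 * x) * D
      = exp (- 4 * x) * (1 + x) * \<kappa> + exp (- 4 * x) * ((1 + x)\<^sup>2 * exp (1 + x)) * q\<^sup>2"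
      unfolding D_def power_mult_distrib distrib_left[of "exp (- 4 * x)" "(1 + x) * \<kappa>"] by (simp only: mult_ac)
    ultimately show ?thesis by linarith
  qed
  finally show ?thesis by simp
qed

context cumulant_limit
begin

abbreviation "\<Phi> i \<equiv> integrated_immigration (F i) (v i)"
abbreviation "\<Phi>0 \<equiv> integrated_immigration (\<lambda>x. C * x) w"

text \<open>\<open>D\<close> and \<open>h0\<close> are fixed before \<open>h\<close>, the threshold
  in \<open>i\<close> after it. For large \<open>i\<close> the cumulants and integrated immigrations
  are within \<open>h\<^sup>2\<close> of their limits on \<open>[0,h]\<close>, an error of the same
  order as the Taylor remainder.\<close>

lemma kernel4_uniform:
  obtains D h0 where "0 \<le> D" "0 < h0"
    "\<And>h. 0 < h \<Longrightarrow> h \<le> h0 \<Longrightarrow> eventually (\<lambda>i. \<forall>t x. 0 \<le> t \<longrightarrow> t \<le> h \<longrightarrow> 0 \<le> x \<longrightarrow> kernel4 (v i) (\<Phi> i) t x \<le> D * h\<^sup>2) L"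
    "\<And>h t x. 0 < h \<Longrightarrow> h \<le> h0 \<Longrightarrow> 0 \<le> t \<Longrightarrow> t \<le> h \<Longrightarrow> 0 \<le> x \<Longrightarrow> kernel4 w \<Phi>0 t x \<le> D * h\<^sup>2"
proof -
  have "\<exists>D\<ge>0. \<forall>t. 0 \<le> t \<longrightarrow> t \<le> 1 \<longrightarrow> \<bar>w t (real k) - real k + t * R0 (real k)\<bar> \<le> D * t\<^sup>2 \<and>
    \<bar>\<Phi>0 t (real k) - t * (C * real k)\<bar> \<le> D * t\<^sup>2" for k :: nat
    by (rule cumulant_taylor[of "real k"]) auto
  then obtain d where d: "\<And>k :: nat. 0 \<le> d k"
    and dw: "\<And>k t. 0 \<le> t \<Longrightarrow> t \<le> 1 \<Longrightarrow> \<bar>w t (real k) - real k + t * R0 (real k)\<bar> \<le> d k * t\<^sup>2"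
    and d\<Phi>: "\<And>k t. 0 \<le> t \<Longrightarrow> t \<le> 1 \<Longrightarrow> \<bar>\<Phi>0 t (real k) - t * (C * real k)\<bar> \<le> d k * t\<^sup>2"
    by metis
  \<comment> \<open>The added 1 is room for the distance \<open>h\<^sup>2\<close> from the
    limit.\<close>
  define D1 where "D1 = (\<Sum>k\<le>4. d k) + 1"
  have dD: "d k + 1 \<le> D1" if "k \<le> 4" for k
    unfolding D1_def using that d by (auto intro!: member_le_sum)
  have D1: "0 < D1" using dD[of 0] d[of 0] by linarith
  define \<rho> where "\<rho> = \<bar>B\<bar> * 4 + A * 16 + \<bar>C\<bar> * 4"
  have \<rho>0: "0 \<le> \<rho>" using A by (simp add: \<rho>_def)
  have \<rho>: "\<bar>R0 (real k)\<bar> \<le> \<rho>" "\<bar>C * real k\<bar> \<le> \<rho>" if "k \<le> 4" for k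
  proof -
    have k: "real k \<le> 4" using that by simp
    have "(real k)\<^sup>2 \<le> 4\<^sup>2" using k by (intro power_mono) auto
    then have "A * (real k)\<^sup>2 \<le> A * 16" "0 \<le> A * (real k)\<^sup>2" using A by (auto intro!: mult_left_mono)
    moreover have "\<bar>B * real k\<bar> \<le> \<bar>B\<bar> * 4" "\<bar>C * real k\<bar> \<le> \<bar>C\<bar> * 4"
      using k by (auto simp: abs_mult intro!: mult_left_mono)
    moreover have "0 \<le> A * 16" "0 \<le> \<bar>B\<bar> * 4" "0 \<le> \<bar>C\<bar> * 4" using A by auto
    ultimately show "\<bar>R0 (real k)\<bar> \<le> \<rho>" "\<bar>C * real k\<bar> \<le> \<rho>"
      unfolding \<rho>_def by linarith+
  qed
  \<comment> \<open>\<open>S * h\<close> plays the role of \<open>q\<close> in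
    \<open>kernel4_le\<close>: it dominates \<open>D1 * h\<^sup>2 + t * \<rho>\<close>, and
    \<open>h \<le> 1 / S\<close> makes it at most 1.\<close>
  define S where "S = D1 + \<rho> + 1"
  have S: "1 \<le> S" using D1 \<rho>0 by (simp add: S_def)
  define h0 where "h0 = 1 / S"
  have h0: "0 < h0" "h0 \<le> 1" using S by (auto simp: h0_def)
  define K where "K = 16 * (D1 + 3 * S\<^sup>2)"
  have K0: "0 \<le> K" using D1 by (simp add: K_def)
  have main: "kernel4 V P t x \<le> K * h\<^sup>2"
    if h: "0 < h" "h \<le> h0" and t: "0 \<le> t" "t \<le> h" and x: "0 \<le> x"
    and V: "\<And>k :: nat. k \<le> 4 \<Longrightarrow> \<bar>V t (real k) - w t (real k)\<bar> \<le> h\<^sup>2"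
    and P: "\<And>k :: nat. k \<le> 4 \<Longrightarrow> \<bar>P t (real k) - \<Phi>0 t (real k)\<bar> \<le> h\<^sup>2" for V P h t x
  proof -
    have t1: "t \<le> 1" "h \<le> 1" using t h h0 by linarith+
    have sq: "t\<^sup>2 \<le> h\<^sup>2" using t by (intro power_mono) auto
    have dk: "d k * t\<^sup>2 + h\<^sup>2 \<le> D1 * h\<^sup>2" if "k \<le> 4" for k
    proof -
      have "d k * t\<^sup>2 \<le> d k * h\<^sup>2" by (intro mult_left_mono sq d)
      moreover have "(d k + 1) * h\<^sup>2 \<le> D1 * h\<^sup>2" by (intro mult_right_mono dD that) simp
      ultimately show ?thesis by (simp only: distrib_right mult_1)
    qed
    have "kernel4 V P t x \<le> 16 * (D1 * h\<^sup>2 + 3 * (S * h)\<^sup>2)"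
    proof (rule kernel4_le[OF x t(1), where \<kappa> = "D1 * h\<^sup>2" and \<rho> = \<rho> and A = A and B = B and C = C])
      fix k :: nat assume k: "k \<le> 4"
      show "\<bar>V t (real k) - real k + t * R0 (real k)\<bar> \<le> D1 * h\<^sup>2"
        using V[OF k] dw[OF t(1) t1(1), of k] dk[OF k] by linarith
      show "\<bar>P t (real k) - t * (C * real k)\<bar> \<le> D1 * h\<^sup>2"
        using P[OF k] d\<Phi>[OF t(1) t1(1), of k] dk[OF k] by linarith
    next
      have "D1 * h\<^sup>2 \<le> D1 * h"
        using D1 h t1 by (intro mult_left_mono) (auto simp: power2_eq_square mult_left_le)
      moreover have "t * \<rho> \<le> h * \<rho>" using t \<rho>0 by (intro mult_right_mono)
      moreover have "D1 * h + h * \<rho> \<le> S * h" using h by (simp add: S_def algebra_simps)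
      ultimately show "D1 * h\<^sup>2 + t * \<rho> \<le> S * h" by linarith
      show "S * h \<le> 1" using h S mult_left_mono[OF h(2), of S] by (simp add: h0_def)
    qed (rule \<rho>, assumption)+
    also have "\<dots> = K * h\<^sup>2" by (simp add: K_def power_mult_distrib algebra_simps)
    finally show ?thesis .
  qed
  show ?thesis
  proof (rule that[OF K0 h0(1)])
    fix h :: real assume h: "0 < h" "h \<le> h0"
    have h2: "0 < h\<^sup>2" using h by simp
    have "eventually (\<lambda>i. \<forall>k\<in>{..4 :: nat}. \<forall>t\<in>{0..h}. \<bar>v i t (real k) - w t (real k)\<bar> \<le> h\<^sup>2) L"
      using h h2 by (intro eventually_ball_finite ballI cumulant_uniform) auto
    moreover have "eventually (\<lambda>i. \<forall>k\<in>{..4 :: nat}. \<forall>t\<in>{0..h}. \<bar>\<Phi> i t (real k) - \<Phi>0 t (real k)\<bar> \<le> h\<^sup>2) L"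
      using h h2 by (intro eventually_ball_finite ballI immigration_uniform) auto
    ultimately show "eventually (\<lambda>i. \<forall>t x. 0 \<le> t \<longrightarrow> t \<le> h \<longrightarrow> 0 \<le> x \<longrightarrow> kernel4 (v i) (\<Phi> i) t x \<le> K * h\<^sup>2) L"
    proof eventually_elim
      case (elim i)
      show ?case
      proof (intro allI impI)
        fix t x :: real assume t: "0 \<le> t" "t \<le> h" and x: "0 \<le> x"
        show "kernel4 (v i) (\<Phi> i) t x \<le> K * h\<^sup>2"
          by (rule main[OF h t x]) (use elim t in auto)
      qed
    qed
    fix t x :: real assume t: "0 \<le> t" "t \<le> h" and x: "0 \<le> x"
    show "kernel4 w \<Phi>0 t x \<le> K * h\<^sup>2"
      by (rule main[OF h t x]) simp_all
  qed
qed

theorem laplace_markov_converges_in_distribution: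
  assumes ev: "eventually (\<lambda>i. laplace_markov (M i) (G i) (X i) (v i) (\<Phi> i)) L"
    and N: "laplace_markov N H Y w \<Phi>0"
    and init: "\<And>z. 0 \<le> z \<Longrightarrow> ((\<lambda>i. \<integral>\<omega>. exp (- z * X i 0 \<omega>) \<partial>M i) \<longlongrightarrow> (\<integral>\<omega>. exp (- z * Y 0 \<omega>) \<partial>N)) L"
  shows "converges_in_distribution skorokhod_topology M (\<lambda>i. path_of (X i)) N (path_of Y) L"
proof (rule converges_in_distribution_skorokhodI)
  interpret N: laplace_markov N H Y w \<Phi>0 by (rule N)
  show "eventually (\<lambda>i. prob_space (M i) \<and> (\<forall>\<omega>\<in>space (M i). path_of (X i) \<omega> \<in> skorokhod_space) \<and>
      (\<forall>t\<ge>0. (\<lambda>\<omega>. path_of (X i) \<omega> t) \<in> borel_measurable (M i))) L"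
    using ev
  proof eventually_elim
    case (elim i)
    then interpret laplace_markov "M i" "G i" "X i" "v i" "\<Phi> i" .
    show ?case using prob_space_axioms path_of_in_skorokhod_space path_of_measurable by blast
  qed
  show "prob_space N" "\<And>\<omega>. \<omega> \<in> space N \<Longrightarrow> path_of Y \<omega> \<in> skorokhod_space"
    "\<And>t. 0 \<le> t \<Longrightarrow> (\<lambda>\<omega>. path_of Y \<omega> t) \<in> borel_measurable N"
    by (rule N.prob_space_axioms N.path_of_in_skorokhod_space N.path_of_measurable, assumption?)+
  have convV: "((\<lambda>i. v i t (zi i)) \<longlongrightarrow> w t z) L"
    if "0 \<le> t" "0 \<le> z" "eventually (\<lambda>i. 0 \<le> zi i) L" "(zi \<longlongrightarrow> z) L" for t z zi
  proof (rule tendstoI)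
    fix e :: real assume "0 < e"
    then have e: "0 < e / 2" by simp
    from cumulant_uniform[OF that(2,3,4,1) e] show "eventually (\<lambda>i. dist (v i t (zi i)) (w t z) < e) L"
    proof eventually_elim
      case (elim i)
      then have "\<bar>v i t (zi i) - w t z\<bar> \<le> e / 2" using that(1) by simp
      then show ?case using \<open>0 < e\<close> unfolding dist_real_def by linarith
    qed
  qed
  have conv\<Phi>: "((\<lambda>i. \<Phi> i t (zi i)) \<longlongrightarrow> \<Phi>0 t z) L"
    if "0 \<le> t" "0 \<le> z" "eventually (\<lambda>i. 0 \<le> zi i) L" "(zi \<longlongrightarrow> z) L" for t z zi
  proof (rule tendstoI)
    fix e :: real assume "0 < e"
    then have e: "0 < e / 2" by simp
    from immigration_uniform[OF that(2,3,4,1) e] show "eventually (\<lambda>i. dist (\<Phi> i t (zi i)) (\<Phi>0 t z) < e) L"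
    proof eventually_elim
      case (elim i)
      then have "\<bar>\<Phi> i t (zi i) - \<Phi>0 t z\<bar> \<le> e / 2" using that(1) by simp
      then show ?case using \<open>0 < e\<close> unfolding dist_real_def by linarith
    qed
  qed
  show "((\<lambda>i. \<integral>\<omega>. g (grid_values n (path_of (X i) \<omega>)) \<partial>M i) \<longlongrightarrow> (\<integral>\<omega>. g (grid_values n (path_of Y \<omega>)) \<partial>N)) L"
    if "continuous_on UNIV g" for n and g :: "(nat \<Rightarrow> real) \<Rightarrow> real"
    by (rule grid_values_tendsto[OF ev N convV conv\<Phi> init that])
  fix k :: nat and e :: real assume e: "0 < e"
  obtain D h0 where D: "0 \<le> D" and h0: "0 < h0"
    and kv: "\<And>h. 0 < h \<Longrightarrow> h \<le> h0 \<Longrightarrow> eventually (\<lambda>i. \<forall>t x. 0 \<le> t \<longrightarrow> t \<le> h \<longrightarrow> 0 \<le> x \<longrightarrow> kernel4 (v i) (\<Phi> i) t x \<le> D * h\<^sup>2) L"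
    and kw: "\<And>h t x. 0 < h \<Longrightarrow> h \<le> h0 \<Longrightarrow> 0 \<le> t \<Longrightarrow> t \<le> h \<Longrightarrow> 0 \<le> x \<Longrightarrow> kernel4 w \<Phi>0 t x \<le> D * h\<^sup>2"
    by (rule kernel4_uniform) (rule that)
  \<comment> \<open>The oscillation term \<open>2 * \<delta>\<close> becomes \<open>e / 4\<close>;
    truncation and bad cells get \<open>e / 4\<close> each.\<close>
  define \<delta> where "\<delta> = e / 8"
  have \<delta>: "0 < \<delta>" using e by (simp add: \<delta>_def)
  \<comment> \<open>\<open>E / n\<close> bounds the bad-cell term: at most
    \<open>n * (k + 1)\<close> cells, each with a probability of order
    \<open>1 / n\<^sup>2\<close>.\<close>
  define E where "E = (real k + 1) * (2 * D / \<delta> ^ 4)"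
  have E: "0 \<le> E" using D \<delta> by (simp add: E_def)
  \<comment> \<open>The summands give, in turn, \<open>n \<ge> 1\<close>, a mesh of at most
    \<open>h0\<close>, a truncation term of at most \<open>e / 4\<close> and a bad-cell term of at
    most \<open>e / 4\<close>.\<close>
  obtain n :: nat where n: "1 + 1 / h0 + 4 / e + 4 * E / e \<le> real n" using real_arch_simple by blast
  have pos: "0 < 1 / h0" "0 < 4 / e" "0 \<le> 4 * E / e" using h0 e E by auto
  have n1: "1 \<le> real n" "1 / h0 \<le> real n" "4 / e \<le> real n" "4 * E / e \<le> real n" using n pos by linarith+
  then have n0: "0 < n" by (cases n) auto
  have hn: "0 < 1 / real n" "1 / real n \<le> h0"
    using n0 n1(2) h0 by (auto simp: field_simps)
  define Q where "Q = D * (1 / real n)\<^sup>2"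
  have Q0: "0 \<le> Q" using D by (simp add: Q_def)
  have bound: "exp (- real n) + 2 * \<delta> + real (n * k + 1) * (2 * Q / \<delta> ^ 4) \<le> e"
  proof -
    have "real n \<le> exp (real n)" using exp_ge_add_one_self[of "real n"] by linarith
    then have "exp (- real n) \<le> 1 / real n" using n0 by (simp add: exp_minus field_simps)
    also have "\<dots> \<le> e / 4" using n0 n1(3) e by (simp add: field_simps)
    finally have 1: "exp (- real n) \<le> e / 4" .
    have "real (n * k + 1) \<le> real n * (real k + 1)" using n1(1) by (simp add: distrib_left)
    then have "real (n * k + 1) * (2 * Q / \<delta> ^ 4) \<le> real n * (real k + 1) * (2 * Q / \<delta> ^ 4)"
      using Q0 \<delta> by (intro mult_right_mono) auto
    also have "\<dots> = E * (real n * (1 / real n)\<^sup>2)"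
      unfolding Q_def E_def by (simp only: mult_ac times_divide_eq_left times_divide_eq_right)
    also have "\<dots> = E / real n" using n0 by (simp add: power2_eq_square)
    also have "\<dots> \<le> e / 4" using n0 n1(4) e by (simp add: field_simps)
    finally have "real (n * k + 1) * (2 * Q / \<delta> ^ 4) \<le> e / 4" .
    moreover have "2 * \<delta> = e / 4" by (simp add: \<delta>_def)
    ultimately show ?thesis using 1 e by linarith
  qed
  show "\<exists>n>0. (\<integral>\<omega>. path_dist k (path_of Y \<omega>) (step_path n (grid_values n (path_of Y \<omega>))) \<partial>N) \<le> e \<and>
    eventually (\<lambda>i. (\<integral>\<omega>. path_dist k (path_of (X i) \<omega>) (step_path n (grid_values n (path_of (X i) \<omega>))) \<partial>M i) \<le> e) L"
  proof (intro exI[of _ n] conjI n0)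
    have "kernel4 w \<Phi>0 t x \<le> Q" if "0 \<le> t" "t \<le> 1 / real n" "0 \<le> x" for t x
      unfolding Q_def by (rule kw[OF hn that])
    from order_trans[OF N.expectation_path_dist_step_le[OF n0 \<delta> Q0 this] bound]
    show "(\<integral>\<omega>. path_dist k (path_of Y \<omega>) (step_path n (grid_values n (path_of Y \<omega>))) \<partial>N) \<le> e" .
    from kv[OF hn] ev
    show "eventually (\<lambda>i. (\<integral>\<omega>. path_dist k (path_of (X i) \<omega>) (step_path n (grid_values n (path_of (X i) \<omega>))) \<partial>M i) \<le> e) L"
    proof eventually_elim
      case (elim i)
      then interpret laplace_markov "M i" "G i" "X i" "v i" "\<Phi> i" by blast
      have "kernel4 (v i) (\<Phi> i) t x \<le> Q" if "0 \<le> t" "t \<le> 1 / real n" "0 \<le> x" for t x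
        unfolding Q_def using elim(1) that by blast
      from order_trans[OF expectation_path_dist_step_le[OF n0 \<delta> Q0 this] bound] show ?case .
    qed
  qed
qed

end


subsection \<open>Rescaled branching processes with immigration\<close>

lemma cadlag_rescale:
  assumes y: "cadlag y" and \<theta>: "0 < \<theta>"
  shows "cadlag (\<lambda>t. y (\<theta> * t) / \<theta>)"
  unfolding cadlag_def
proof (intro conjI allI impI)
  fix t :: real assume t: "0 \<le> t"
  have "filterlim (\<lambda>s. \<theta> * s) (at_right (\<theta> * t)) (at_right t)"
    unfolding filterlim_at using \<theta>
    by (auto intro!: tendsto_eq_intros simp: eventually_at_right_field intro: exI[of _ "t + 1"])
  moreover have "(y \<longlongrightarrow> y (\<theta> * t)) (at_right (\<theta> * t))"
    using y t \<theta> by (simp add: cadlag_def continuous_within)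
  ultimately have "((\<lambda>s. y (\<theta> * s)) \<longlongrightarrow> y (\<theta> * t)) (at_right t)" by (rule filterlim_compose[rotated])
  then show "continuous (at_right t) (\<lambda>t. y (\<theta> * t) / \<theta>)"
    unfolding continuous_within using \<theta> by (intro tendsto_divide tendsto_const) auto
next
  fix t :: real assume t: "0 < t"
  have "filterlim (\<lambda>s. \<theta> * s) (at_left (\<theta> * t)) (at_left t)"
    unfolding filterlim_at using \<theta>
    by (auto intro!: tendsto_eq_intros simp: eventually_at_left_field intro: exI[of _ "t - 1"])
  moreover obtain l where "(y \<longlongrightarrow> l) (at_left (\<theta> * t))"
    using y t \<theta> unfolding cadlag_def by (meson mult_pos_pos)
  ultimately have "((\<lambda>s. y (\<theta> * s)) \<longlongrightarrow> l) (at_left t)" by (rule filterlim_compose[rotated])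
  then have "((\<lambda>s. y (\<theta> * s) / \<theta>) \<longlongrightarrow> l / \<theta>) (at_left t)"
    using \<theta> by (intro tendsto_divide tendsto_const) auto
  then show "\<exists>l. ((\<lambda>t. y (\<theta> * t) / \<theta>) \<longlongrightarrow> l) (at_left t)" by blast
qed

section \<open>The natural filtration and the Laplace form of the Markov property\<close>

lemma halfline_measurable_imp_borel: "f \<in> M \<rightarrow>\<^sub>M halfline \<Longrightarrow> f \<in> borel_measurable M"
  using measurable_restrict_space2_iff[of f M borel "{0..}"] by blast

lemma natural_filtration_generators:
  "{Y u -` A \<inter> space M | u A. u \<in> {0..s} \<and> A \<in> sets halfline} \<subseteq> Pow (space M)"
  by blast

lemma space_natural_filtration: "space (natural_filtration M Y s) = space M"
  unfolding natural_filtration_def by (rule space_measure_of[OF natural_filtration_generators])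

lemma sets_natural_filtration:
  "sets (natural_filtration M Y s)
    = sigma_sets (space M) {Y u -` A \<inter> space M | u A. u \<in> {0..s} \<and> A \<in> sets halfline}"
  unfolding natural_filtration_def by (rule sets_measure_of[OF natural_filtration_generators])

lemma measurable_natural_filtration:
  assumes "0 \<le> u" "u \<le> s" and Y: "Y u \<in> M \<rightarrow>\<^sub>M halfline"
  shows "Y u \<in> natural_filtration M Y s \<rightarrow>\<^sub>M halfline"
proof (rule measurableI)
  fix A assume "A \<in> sets halfline"
  then show "Y u -` A \<inter> space (natural_filtration M Y s) \<in> sets (natural_filtration M Y s)"
    unfolding space_natural_filtration sets_natural_filtration using assms(1,2)
    by (intro sigma_sets.Basic) auto
next
  fix \<omega> assume "\<omega> \<in> space (natural_filtration M Y s)"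
  then show "Y u \<omega> \<in> space halfline"
    unfolding space_natural_filtration by (rule measurable_space[OF Y])
qed

lemma subalgebra_natural_filtration:
  assumes "\<And>u. 0 \<le> u \<Longrightarrow> Y u \<in> M \<rightarrow>\<^sub>M halfline"
  shows "subalgebra M (natural_filtration M Y s)"
  unfolding subalgebra_def space_natural_filtration sets_natural_filtration
proof (intro conjI refl sets.sigma_sets_subset subsetI)
  fix B assume "B \<in> {Y u -` A \<inter> space M | u A. u \<in> {0..s} \<and> A \<in> sets halfline}"
  then obtain u A where B: "B = Y u -` A \<inter> space M" "0 \<le> u" "A \<in> sets halfline" by auto
  show "B \<in> sets M" unfolding B(1) by (rule measurable_sets[OF assms[OF B(2)] B(3)])
qed

text \<open>The Markov property is defined through indicators of sets; equality of the two measures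
  below extends it to exponentials.\<close>

lemma markov_process_laplace:
  assumes "prob_space M" and P: "markov_semigroup P" and Y: "markov_process M P Y"
    and s: "0 \<le> s" and t: "0 \<le> t" and z: "0 \<le> z"
    and laplace: "\<And>x. 0 \<le> x \<Longrightarrow> (\<integral>y. exp (- z * y) \<partial>P t x) = exp (- x * a - c)"
    and U: "U \<in> borel_measurable (natural_filtration M Y s)" "\<And>\<omega>. \<omega> \<in> space M \<Longrightarrow> 0 \<le> U \<omega> \<and> U \<omega> \<le> 1"
    and a: "0 \<le> a"
  shows "(\<integral>\<omega>. U \<omega> * exp (- z * Y (s + t) \<omega>) \<partial>M) = (\<integral>\<omega>. U \<omega> * exp (- Y s \<omega> * a - c) \<partial>M)"
proof -
  interpret prob_space M by fact
  let ?G = "natural_filtration M Y s"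
  have Ym: "Y u \<in> M \<rightarrow>\<^sub>M halfline" if "0 \<le> u" for u using Y that by (simp add: markov_process_def)
  have sub: "subalgebra M ?G" by (rule subalgebra_natural_filtration[OF Ym])
  interpret G: finite_measure_subalgebra M ?G by unfold_locales (rule sub)
  have Um[measurable]: "U \<in> borel_measurable M" by (rule measurable_from_subalg[OF sub U(1)])
  have Ys[measurable]: "Y s \<in> M \<rightarrow>\<^sub>M halfline" and Yst[measurable]: "Y (s + t) \<in> M \<rightarrow>\<^sub>M halfline"
    using Ym s t by auto
  have Yb[measurable]: "Y s \<in> borel_measurable M" "Y (s + t) \<in> borel_measurable M"
    using Ys Yst by (auto intro: halfline_measurable_imp_borel)
  have Y0: "0 \<le> Y u \<omega>" if "\<omega> \<in> space M" "0 \<le> u" for u \<omega>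
    using measurable_space[OF Ym[OF that(2)] that(1)] by (simp add: space_restrict_space)
  have Pt[measurable]: "P t \<in> halfline \<rightarrow>\<^sub>M prob_algebra halfline" using P t by (simp add: markov_semigroup_def)
  have Psub[measurable]: "P t \<in> halfline \<rightarrow>\<^sub>M subprob_algebra halfline" by (rule measurable_prob_algebraD[OF Pt])
  have PtY: "P t (Y s \<omega>) \<in> space (prob_algebra halfline)" if "\<omega> \<in> space M" for \<omega>
    by (rule measurable_space[OF Pt measurable_space[OF Ys that]])
  have Pprob: "prob_space (P t (Y s \<omega>))" "sets (P t (Y s \<omega>)) = sets halfline" if "\<omega> \<in> space M" for \<omega>
    using PtY[OF that] by (auto simp: space_prob_algebra)
  \<comment> \<open>Weighting \<open>M\<close> with \<open>U\<close> turns the claim into an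
    equality of two measures on the half-line: the image of the later value, and the image of the
    present value pushed through the kernel.\<close>
  define D where "D = density M (\<lambda>\<omega>. ennreal (U \<omega>))"
  define \<mu>1 where "\<mu>1 = distr D halfline (Y (s + t))"
  define \<mu>2 where "\<mu>2 = distr D halfline (Y s) \<bind> P t"
  have DY: "Y s \<in> D \<rightarrow>\<^sub>M halfline" "Y (s + t) \<in> D \<rightarrow>\<^sub>M halfline"
    using Ys Yst by (auto simp: D_def)
  have ne: "space (distr D halfline (Y s)) \<noteq> {}" by (auto simp: space_restrict_space)
  have Psub': "P t \<in> distr D halfline (Y s) \<rightarrow>\<^sub>M subprob_algebra halfline" using Psub by simp
  have eU: "(\<lambda>\<omega>. ennreal (U \<omega>)) \<in> borel_measurable M" by measurable
  have eq: "\<mu>1 = \<mu>2"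
  proof (rule measure_eqI)
    show "sets \<mu>1 = sets \<mu>2"
      unfolding \<mu>1_def \<mu>2_def using sets_bind_measurable[OF Psub' ne] by simp
    fix A assume "A \<in> sets \<mu>1"
    then have A: "A \<in> sets halfline" by (simp add: \<mu>1_def)
    have mA: "(\<lambda>\<omega>. measure (P t (Y s \<omega>)) A) \<in> borel_measurable M"
      by (rule measurable_compose[OF Ys measurable_compose[OF Pt measurable_measure_prob_algebra[OF A]]])
    have iA: "(\<lambda>\<omega>. indicator A (Y (s + t) \<omega>) :: real) \<in> borel_measurable M"
      by (rule measurable_compose[OF Yst borel_measurable_indicator[OF A]])
    have int: "integrable M (\<lambda>\<omega>. U \<omega> * indicator A (Y (s + t) \<omega>))"
    proof (rule integrable_const_bound[of _ 1])
      show "AE \<omega> in M. norm (U \<omega> * indicator A (Y (s + t) \<omega>)) \<le> 1"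
        using U(2) by (intro AE_I2) (auto simp: indicator_def)
      show "(\<lambda>\<omega>. U \<omega> * indicator A (Y (s + t) \<omega>)) \<in> borel_measurable M"
        using iA by (intro borel_measurable_times Um)
    qed
    have ae: "AE \<omega> in M. real_cond_exp M ?G (\<lambda>\<omega>. indicator A (Y (s + t) \<omega>)) \<omega> = measure (P t (Y s \<omega>)) A"
      using Y s t A by (simp add: markov_process_def)
    have "(\<integral>\<omega>. U \<omega> * indicator A (Y (s + t) \<omega>) \<partial>M)
      = (\<integral>\<omega>. U \<omega> * real_cond_exp M ?G (\<lambda>\<omega>. indicator A (Y (s + t) \<omega>)) \<omega> \<partial>M)"
      by (rule G.real_cond_exp_intg(2)[OF int U(1) iA, symmetric])
    also have "\<dots> = (\<integral>\<omega>. U \<omega> * measure (P t (Y s \<omega>)) A \<partial>M)"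
      using ae by (intro integral_cong_AE borel_measurable_times Um borel_measurable_cond_exp2 mA) auto
    finally have real_eq: "(\<integral>\<omega>. U \<omega> * indicator A (Y (s + t) \<omega>) \<partial>M) = (\<integral>\<omega>. U \<omega> * measure (P t (Y s \<omega>)) A \<partial>M)" .
    have int2: "integrable M (\<lambda>\<omega>. U \<omega> * measure (P t (Y s \<omega>)) A)"
    proof (rule integrable_const_bound[of _ 1])
      show "AE \<omega> in M. norm (U \<omega> * measure (P t (Y s \<omega>)) A) \<le> 1"
      proof (rule AE_I2)
        fix \<omega> assume \<omega>: "\<omega> \<in> space M"
        have "measure (P t (Y s \<omega>)) A \<le> 1" by (rule prob_space.prob_le_1[OF Pprob(1)[OF \<omega>]])
        then show "norm (U \<omega> * measure (P t (Y s \<omega>)) A) \<le> 1"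
          using U(2)[OF \<omega>] by (simp add: abs_mult mult_le_one)
      qed
      show "(\<lambda>\<omega>. U \<omega> * measure (P t (Y s \<omega>)) A) \<in> borel_measurable M"
        by (intro borel_measurable_times Um mA)
    qed
    have eA: "(\<lambda>x. emeasure (P t x) A) \<in> borel_measurable halfline"
      by (rule measurable_compose[OF Psub measurable_emeasure_subprob_algebra[OF A]])
    have "emeasure \<mu>1 A = (\<integral>\<^sup>+y. indicator A y \<partial>\<mu>1)" using A by (simp add: \<mu>1_def)
    also have "\<dots> = (\<integral>\<^sup>+\<omega>. indicator A (Y (s + t) \<omega>) \<partial>D)"
      unfolding \<mu>1_def by (rule nn_integral_distr[OF DY(2)]) (use A in simp)
    also have "\<dots> = (\<integral>\<^sup>+\<omega>. ennreal (U \<omega>) * indicator A (Y (s + t) \<omega>) \<partial>M)"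
      unfolding D_def
      by (rule nn_integral_density[OF eU measurable_compose[OF Yst borel_measurable_indicator[OF A]]])
    also have "\<dots> = (\<integral>\<^sup>+\<omega>. ennreal (U \<omega> * indicator A (Y (s + t) \<omega>)) \<partial>M)"
      by (intro nn_integral_cong) (auto simp: indicator_def)
    also have "\<dots> = ennreal (\<integral>\<omega>. U \<omega> * indicator A (Y (s + t) \<omega>) \<partial>M)"
      using U(2) by (intro nn_integral_eq_integral int AE_I2) auto
    also have "\<dots> = ennreal (\<integral>\<omega>. U \<omega> * measure (P t (Y s \<omega>)) A \<partial>M)" by (simp only: real_eq)
    also have "\<dots> = (\<integral>\<^sup>+\<omega>. ennreal (U \<omega> * measure (P t (Y s \<omega>)) A) \<partial>M)"
      using U(2) by (intro nn_integral_eq_integral[symmetric] int2 AE_I2) auto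
    also have "\<dots> = (\<integral>\<^sup>+\<omega>. ennreal (U \<omega>) * emeasure (P t (Y s \<omega>)) A \<partial>M)"
    proof (rule nn_integral_cong)
      fix \<omega> assume \<omega>: "\<omega> \<in> space M"
      interpret K: prob_space "P t (Y s \<omega>)" by (rule Pprob(1)[OF \<omega>])
      show "ennreal (U \<omega> * measure (P t (Y s \<omega>)) A) = ennreal (U \<omega>) * emeasure (P t (Y s \<omega>)) A"
        using U(2)[OF \<omega>] by (simp add: K.emeasure_eq_measure ennreal_mult)
    qed
    also have "\<dots> = (\<integral>\<^sup>+\<omega>. emeasure (P t (Y s \<omega>)) A \<partial>D)"
      unfolding D_def by (rule nn_integral_density[OF eU measurable_compose[OF Ys eA], symmetric])
    also have "\<dots> = emeasure \<mu>2 A"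
      unfolding \<mu>2_def emeasure_bind[OF ne Psub' A]
      by (rule nn_integral_distr[OF DY(1), symmetric]) (use eA in simp)
    finally show "emeasure \<mu>1 A = emeasure \<mu>2 A" .
  qed
  have em: "(\<lambda>y. ennreal (exp (- z * y))) \<in> borel_measurable halfline"
    by (intro measurable_restrict_space1) measurable
  have "ennreal (\<integral>\<omega>. U \<omega> * exp (- z * Y (s + t) \<omega>) \<partial>M) = (\<integral>\<^sup>+\<omega>. ennreal (U \<omega> * exp (- z * Y (s + t) \<omega>)) \<partial>M)"
  proof (rule nn_integral_eq_integral[symmetric])
    show "integrable M (\<lambda>\<omega>. U \<omega> * exp (- z * Y (s + t) \<omega>))"
    proof (rule integrable_const_bound[of _ 1])
      show "AE \<omega> in M. norm (U \<omega> * exp (- z * Y (s + t) \<omega>)) \<le> 1"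
        using U(2) Y0 s t z by (intro AE_I2) (auto simp: abs_mult intro!: mult_le_one)
    qed measurable
  qed (use U(2) in \<open>auto intro!: AE_I2\<close>)
  also have "\<dots> = (\<integral>\<^sup>+\<omega>. ennreal (U \<omega>) * ennreal (exp (- z * Y (s + t) \<omega>)) \<partial>M)"
    using U(2) by (intro nn_integral_cong ennreal_mult) auto
  also have "\<dots> = (\<integral>\<^sup>+y. ennreal (exp (- z * y)) \<partial>\<mu>1)"
  proof -
    have "(\<integral>\<^sup>+y. ennreal (exp (- z * y)) \<partial>\<mu>1) = (\<integral>\<^sup>+\<omega>. ennreal (exp (- z * Y (s + t) \<omega>)) \<partial>D)"
      unfolding \<mu>1_def by (rule nn_integral_distr[OF DY(2)]) (use em in simp)
    also have "\<dots> = (\<integral>\<^sup>+\<omega>. ennreal (U \<omega>) * ennreal (exp (- z * Y (s + t) \<omega>)) \<partial>M)"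
      unfolding D_def by (rule nn_integral_density[OF eU measurable_compose[OF Yst em]])
    finally show ?thesis ..
  qed
  also have "\<dots> = (\<integral>\<^sup>+x. \<integral>\<^sup>+y. ennreal (exp (- z * y)) \<partial>P t x \<partial>distr D halfline (Y s))"
    unfolding eq \<mu>2_def by (rule nn_integral_bind[OF em Psub'])
  also have "\<dots> = (\<integral>\<^sup>+\<omega>. \<integral>\<^sup>+y. ennreal (exp (- z * y)) \<partial>P t (Y s \<omega>) \<partial>D)"
    by (rule nn_integral_distr[OF DY(1)])
      (use measurable_compose[OF Psub nn_integral_measurable_subprob_algebra[OF em]] in simp)
  also have "\<dots> = (\<integral>\<^sup>+\<omega>. ennreal (U \<omega>) * (\<integral>\<^sup>+y. ennreal (exp (- z * y)) \<partial>P t (Y s \<omega>)) \<partial>M)"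
    unfolding D_def
    by (rule nn_integral_density[OF eU measurable_compose[OF Ys
          measurable_compose[OF Psub nn_integral_measurable_subprob_algebra[OF em]]]])
  also have "\<dots> = (\<integral>\<^sup>+\<omega>. ennreal (U \<omega> * exp (- Y s \<omega> * a - c)) \<partial>M)"
  proof (rule nn_integral_cong)
    fix \<omega> assume \<omega>: "\<omega> \<in> space M"
    interpret K: prob_space "P t (Y s \<omega>)" by (rule Pprob(1)[OF \<omega>])
    have sp: "space (P t (Y s \<omega>)) = {0..}"
      using sets_eq_imp_space_eq[OF Pprob(2)[OF \<omega>]] by (simp add: space_restrict_space)
    have "(\<integral>\<^sup>+y. ennreal (exp (- z * y)) \<partial>P t (Y s \<omega>)) = ennreal (\<integral>y. exp (- z * y) \<partial>P t (Y s \<omega>))"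
    proof (rule nn_integral_eq_integral)
      show "integrable (P t (Y s \<omega>)) (\<lambda>y. exp (- z * y))"
      proof (rule K.integrable_const_bound[of _ 1])
        show "AE y in P t (Y s \<omega>). norm (exp (- z * y)) \<le> 1"
          using z by (intro AE_I2) (simp add: sp)
        have "(\<lambda>y. exp (- z * y)) \<in> borel_measurable halfline"
          by (intro measurable_restrict_space1) measurable
        then show "(\<lambda>y. exp (- z * y)) \<in> borel_measurable (P t (Y s \<omega>))"
          by (subst measurable_cong_sets[OF Pprob(2)[OF \<omega>] refl])
      qed
    qed simp
    also have "\<dots> = ennreal (exp (- Y s \<omega> * a - c))"
      using laplace[OF Y0[OF \<omega> s]] by (simp only:)
    finally show "ennreal (U \<omega>) * (\<integral>\<^sup>+y. ennreal (exp (- z * y)) \<partial>P t (Y s \<omega>)) = ennreal (U \<omega> * exp (- Y s \<omega> * a - c))"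
      using U(2)[OF \<omega>] by (simp add: ennreal_mult)
  qed
  also have "\<dots> = ennreal (\<integral>\<omega>. U \<omega> * exp (- Y s \<omega> * a - c) \<partial>M)"
  proof (rule nn_integral_eq_integral)
    show "integrable M (\<lambda>\<omega>. U \<omega> * exp (- Y s \<omega> * a - c))"
    proof (rule integrable_const_bound[of _ "exp (- c)"])
      show "AE \<omega> in M. norm (U \<omega> * exp (- Y s \<omega> * a - c)) \<le> exp (- c)"
      proof (rule AE_I2)
        fix \<omega> assume \<omega>: "\<omega> \<in> space M"
        have "0 \<le> Y s \<omega> * a" using Y0[OF \<omega> s] a by simp
        then have "U \<omega> * exp (- Y s \<omega> * a - c) \<le> 1 * exp (- c)"
          using U(2)[OF \<omega>] by (intro mult_mono) auto
        then show "norm (U \<omega> * exp (- Y s \<omega> * a - c)) \<le> exp (- c)"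
          using U(2)[OF \<omega>] by (simp add: abs_mult)
      qed
    qed measurable
  qed (use U(2) in \<open>auto intro!: AE_I2\<close>)
  finally show ?thesis
    by (rule ennreal_inj[THEN iffD1, rotated 2])
      (use U(2) in \<open>auto intro!: Bochner_Integration.integral_nonneg_AE AE_I2\<close>)
qed

text \<open>If \<open>v\<close> is the cumulant of \<open>Y\<close>, that of the rescaled process is
  \<open>\<theta> * v (\<theta> * t) (z / \<theta>)\<close>. One factor \<theta> from space and one
  from time give \<open>\<theta>\<^sup>2 * R (z / \<theta>)\<close>, while the immigration mechanism
  takes the factor from time alone. With \<theta> equal to 1 this covers the limit process
  too.\<close>

lemma cbi_process_laplace_markov:
  assumes cbi: "cbi_process M R F Y" and \<theta>: "0 < \<theta>"
  obtains G V where
    "laplace_markov M G (\<lambda>t \<omega>. Y (\<theta> * t) \<omega> / \<theta>) V (integrated_immigration (\<lambda>z. \<theta> * F (z / \<theta>)) V)"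
    "\<And>z. 0 \<le> z \<Longrightarrow> solves_cumulant_ode (\<lambda>z. \<theta>\<^sup>2 * R (z / \<theta>)) z (\<lambda>t. V t z)"
proof -
  from cbi[unfolded cbi_process_def] obtain P v where "prob_space M"
    and cad': "\<forall>\<omega>\<in>space M. cadlag (\<lambda>t. Y t \<omega>)"
    and P: "markov_semigroup P" and Y: "markov_process M P Y"
    and v': "\<forall>z\<ge>0. unique_cumulant R z (\<lambda>t. v t z)"
    and laplace': "\<forall>x\<ge>0. \<forall>z\<ge>0. \<forall>t\<ge>0.
      (\<integral>y. exp (- z * y) \<partial>P t x) = exp (- x * v t z - integral {0..t} (\<lambda>s. F (v s z)))"
    by (elim conjE exE) (rule that)
  have cad: "cadlag (\<lambda>t. Y t \<omega>)" if "\<omega> \<in> space M" for \<omega> using cad' that by (rule bspec)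
  have v: "solves_cumulant_ode R z (\<lambda>t. v t z)" if "0 \<le> z" for z
    using v'[rule_format, OF that] unfolding unique_cumulant_def by (rule conjunct1)
  note laplace = laplace'[rule_format]
  interpret prob_space M by fact
  have Ym: "Y u \<in> M \<rightarrow>\<^sub>M halfline" if "0 \<le> u" for u using Y that by (simp add: markov_process_def)
  have Y0: "0 \<le> Y u \<omega>" if "\<omega> \<in> space M" "0 \<le> u" for u \<omega>
    using measurable_space[OF Ym[OF that(2)] that(1)] by (simp add: space_restrict_space)
  define V where "V t z = \<theta> * v (\<theta> * t) (z / \<theta>)" for t z
  define X where "X = (\<lambda>t \<omega>. Y (\<theta> * t) \<omega> / \<theta>)"
  have vn: "0 \<le> v t z" if "0 \<le> t" "0 \<le> z" for t z
    using v[OF that(2)] that(1) by (simp add: solves_cumulant_ode_def)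
  \<comment> \<open>Substitution in the time integral absorbs the factor \<theta> of the rescaled
    immigration mechanism.\<close>
  have imm: "integrated_immigration (\<lambda>z. \<theta> * F (z / \<theta>)) V t z
    = integral {0..\<theta> * t} (\<lambda>s. F (v s (z / \<theta>)))" if "0 \<le> t" for t z
  proof -
    have img: "(\<lambda>x. x / \<theta>) ` {0..\<theta> * t} = {0..t}"
    proof (rule antisym)
      show "{0..t} \<subseteq> (\<lambda>x. x / \<theta>) ` {0..\<theta> * t}"
      proof
        fix x assume "x \<in> {0..t}"
        then show "x \<in> (\<lambda>x. x / \<theta>) ` {0..\<theta> * t}" using \<theta> by (intro image_eqI[of _ _ "\<theta> * x"]) auto
      qed
    qed (use \<theta> in \<open>auto simp: field_simps\<close>)
    have "integrated_immigration (\<lambda>z. \<theta> * F (z / \<theta>)) V t z = \<theta> * integral {0..t} (\<lambda>s. F (v (\<theta> * s) (z / \<theta>)))"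
      using \<theta> by (simp add: integrated_immigration_def V_def)
    also have "integral {0..t} (\<lambda>s. F (v (\<theta> * s) (z / \<theta>))) = (1 / \<theta>) * integral {0..\<theta> * t} (\<lambda>s. F (v s (z / \<theta>)))"
      using integral_stretch_real[of \<theta> 0 "\<theta> * t" "\<lambda>s. F (v s (z / \<theta>))"] \<theta> unfolding img by simp
    finally show ?thesis using \<theta> by simp
  qed
  have "laplace_markov M (\<lambda>s. natural_filtration M Y (\<theta> * s)) X V (integrated_immigration (\<lambda>z. \<theta> * F (z / \<theta>)) V)"
  proof
    show "subalgebra M (natural_filtration M Y (\<theta> * s))" for s
      by (rule subalgebra_natural_filtration[OF Ym])
    show "X u \<in> borel_measurable (natural_filtration M Y (\<theta> * s))" if "0 \<le> u" "u \<le> s" for u s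
    proof -
      have "Y (\<theta> * u) \<in> natural_filtration M Y (\<theta> * s) \<rightarrow>\<^sub>M halfline"
        using that \<theta> by (intro measurable_natural_filtration Ym) auto
      from halfline_measurable_imp_borel[OF this] show ?thesis by (simp add: X_def)
    qed
    show "0 \<le> X t \<omega>" if "0 \<le> t" "\<omega> \<in> space M" for t \<omega>
      using Y0[OF that(2), of "\<theta> * t"] \<theta> that by (simp add: X_def)
    show "cadlag (\<lambda>t. X t \<omega>)" if "\<omega> \<in> space M" for \<omega>
      unfolding X_def by (rule cadlag_rescale[OF cad[OF that] \<theta>])
    show "0 \<le> V t z" if "0 \<le> t" "0 \<le> z" for t z
      using vn[of "\<theta> * t" "z / \<theta>"] \<theta> that by (simp add: V_def)
    fix s t z :: real and U :: "'a \<Rightarrow> real"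
    assume s: "0 \<le> s" and t: "0 \<le> t" and z: "0 \<le> z" and U: "U \<in> borel_measurable (natural_filtration M Y (\<theta> * s))"
      "\<And>\<omega>. \<omega> \<in> space M \<Longrightarrow> 0 \<le> U \<omega> \<and> U \<omega> \<le> 1"
    have s': "0 \<le> \<theta> * s" and t': "0 \<le> \<theta> * t" and z': "0 \<le> z / \<theta>" using s t z \<theta> by auto
    have "(\<integral>\<omega>. U \<omega> * exp (- (z / \<theta>) * Y (\<theta> * s + \<theta> * t) \<omega>) \<partial>M)
      = (\<integral>\<omega>. U \<omega> * exp (- Y (\<theta> * s) \<omega> * v (\<theta> * t) (z / \<theta>) - integral {0..\<theta> * t} (\<lambda>s. F (v s (z / \<theta>)))) \<partial>M)"
      by (rule markov_process_laplace[OF prob_space_axioms P Y s' t' z' laplace[OF _ z' t'] U vn[OF t' z']])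
    then show "(\<integral>\<omega>. U \<omega> * exp (- z * X (s + t) \<omega>) \<partial>M)
      = (\<integral>\<omega>. U \<omega> * exp (- X s \<omega> * V t z - integrated_immigration (\<lambda>z. \<theta> * F (z / \<theta>)) V t z) \<partial>M)"
      unfolding imm[OF t] using \<theta> by (simp add: X_def V_def distrib_left)
  qed
  moreover have "solves_cumulant_ode (\<lambda>z. \<theta>\<^sup>2 * R (z / \<theta>)) z (\<lambda>t. V t z)" if z: "0 \<le> z" for z
    unfolding solves_cumulant_ode_def
  proof (intro conjI allI impI)
    have vs: "solves_cumulant_ode R (z / \<theta>) (\<lambda>t. v t (z / \<theta>))" using z \<theta> by (intro v) simp
    then show "V 0 z = z" using \<theta> by (simp add: V_def solves_cumulant_ode_def)
    fix t :: real assume t: "0 \<le> t"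
    then have t': "0 \<le> \<theta> * t" using \<theta> by simp
    show "0 \<le> V t z" using vn[OF t', of "z / \<theta>"] z \<theta> by (simp add: V_def)
    have "((\<lambda>t. v t (z / \<theta>)) has_real_derivative - R (v (\<theta> * t) (z / \<theta>))) (at (\<theta> * t) within {0..})"
      using vs t' by (simp add: solves_cumulant_ode_def)
    then have "((\<lambda>t. v t (z / \<theta>)) has_real_derivative - R (v (\<theta> * t) (z / \<theta>))) (at (\<theta> * t) within (\<lambda>t. \<theta> * t) ` {0..})"
      by (rule DERIV_subset) (use \<theta> in auto)
    moreover have "((\<lambda>t. \<theta> * t) has_real_derivative \<theta>) (at t within {0..})"
      by (auto intro!: derivative_eq_intros)
    ultimately have "((\<lambda>t. v (\<theta> * t) (z / \<theta>)) has_real_derivative - R (v (\<theta> * t) (z / \<theta>)) * \<theta>) (at t within {0..})"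
      by (rule DERIV_image_chain[unfolded comp_def])
    from DERIV_cmult[OF this, of \<theta>]
    show "((\<lambda>t. V t z) has_real_derivative - (\<theta>\<^sup>2 * R (V t z / \<theta>))) (at t within {0..})"
      using \<theta> by (simp add: V_def power2_eq_square mult_ac)
  qed
  ultimately show ?thesis using that unfolding X_def by blast
qed

section \<open>Jump integrals under rescaling\<close>

lemma exp_neg_le_quadratic:
  fixes y :: real
  assumes "0 \<le> y"
  shows "exp (- y) \<le> 1 - y + y\<^sup>2 / 2"
proof -
  define f where "f y = 1 - y + y\<^sup>2 / 2 - exp (- y)" for y :: real
  have "f 0 \<le> f y"
  proof (rule DERIV_nonneg_imp_nondecreasing[OF assms])
    fix x :: real
    have "(f has_real_derivative - 1 + x + exp (- x)) (at x)"
      unfolding f_def by (auto intro!: derivative_eq_intros)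
    moreover have "0 \<le> - 1 + x + exp (- x)" using exp_ge_add_one_self[of "- x"] by linarith
    ultimately show "\<exists>z. (f has_real_derivative z) (at x) \<and> 0 \<le> z" by blast
  qed
  then show ?thesis by (simp add: f_def)
qed

lemma exp_neg_ge_cubic:
  fixes y :: real
  assumes "0 \<le> y"
  shows "1 - y + y\<^sup>2 / 2 - y ^ 3 / 6 \<le> exp (- y)"
proof -
  define f where "f y = exp (- y) - (1 - y + y\<^sup>2 / 2 - y ^ 3 / 6)" for y :: real
  have "f 0 \<le> f y"
  proof (rule DERIV_nonneg_imp_nondecreasing[OF assms])
    fix x :: real assume "0 \<le> x"
    have "(f has_real_derivative 1 - x + x\<^sup>2 / 2 - exp (- x)) (at x)"
      unfolding f_def by (auto intro!: derivative_eq_intros)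
    moreover have "0 \<le> 1 - x + x\<^sup>2 / 2 - exp (- x)" using exp_neg_le_quadratic[OF \<open>0 \<le> x\<close>] by linarith
    ultimately show "\<exists>z. (f has_real_derivative z) (at x) \<and> 0 \<le> z" by blast
  qed
  then show ?thesis by (simp add: f_def)
qed

text \<open>The Taylor remainder is cubic, but \<open>p\<close> is only assumed to have a second
  moment. So a quadratic bound takes over for large \<open>y\<close>, and \<open>min 1 y\<close>
  joins the two.\<close>

lemma branching_jump_remainder:
  fixes y :: real
  assumes y: "0 \<le> y"
  shows "\<bar>(exp (- y) - 1 + y) - y\<^sup>2 / 2\<bar> \<le> y\<^sup>2 * min 1 y"
proof -
  have 1: "exp (- y) - 1 + y - y\<^sup>2 / 2 \<le> 0" using exp_neg_le_quadratic[OF y] by linarith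
  have 2: "- (y ^ 3 / 6) \<le> exp (- y) - 1 + y - y\<^sup>2 / 2" using exp_neg_ge_cubic[OF y] by linarith
  have 3: "- (y\<^sup>2 / 2) \<le> exp (- y) - 1 + y - y\<^sup>2 / 2" using exp_ge_add_one_self[of "- y"] by linarith
  have "0 \<le> y\<^sup>2" "0 \<le> y ^ 3" "y ^ 3 = y\<^sup>2 * y" using y by (simp_all add: power2_eq_square power3_eq_cube)
  then have "\<bar>(exp (- y) - 1 + y) - y\<^sup>2 / 2\<bar> \<le> y\<^sup>2 * 1" "\<bar>(exp (- y) - 1 + y) - y\<^sup>2 / 2\<bar> \<le> y\<^sup>2 * y"
    using 1 2 3 by linarith+
  then show ?thesis unfolding min_def by (simp only: split: if_split) simp
qed

text \<open>The same compromise one order lower, where a first moment is at hand.\<close>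

lemma immigration_jump_remainder:
  fixes y :: real
  assumes y: "0 \<le> y"
  shows "\<bar>(1 - exp (- y)) - y\<bar> \<le> y * min 1 y"
proof -
  have "exp (- y) - 1 + y \<le> y\<^sup>2 / 2" using exp_neg_le_quadratic[OF y] by linarith
  moreover have "exp (- y) - 1 \<le> 0" using y by simp
  moreover have "0 \<le> exp (- y) - 1 + y" using exp_ge_add_one_self[of "- y"] by linarith
  moreover have "0 \<le> y\<^sup>2" "y * y = y\<^sup>2" by (simp_all add: power2_eq_square)
  ultimately show ?thesis by (cases "y \<le> 1") auto
qed

lemma min_1_mono: "x \<le> y \<Longrightarrow> min 1 x \<le> min 1 (y :: real)"
  by linarith

text \<open>The measure may have infinite mass near 0, so bounds on integrands have to carry a power
  of \<open>u\<close>.\<close>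

locale jump_measure =
  fixes m :: "real measure"
  assumes sets_m: "sets m = sets (restrict_space borel {0<..})"
begin

lemma space_m: "space m = {0<..}"
  using sets_eq_imp_space_eq[OF sets_m] by (simp add: space_restrict_space)

lemma measurable_m: "f \<in> borel_measurable borel \<Longrightarrow> f \<in> borel_measurable m"
  using measurable_restrict_space1[of f borel borel "{0<..}"] measurable_cong_sets[OF sets_m refl] by blast

text \<open>The weight is at most 1 and tends to 0 at each \<open>u\<close>, so \<open>g\<close>
  itself dominates.\<close>

lemma tail_moment_tendsto:
  fixes g :: "real \<Rightarrow> real"
  assumes g: "integrable m g" and g0: "\<And>u. 0 < u \<Longrightarrow> 0 \<le> g u" and K: "0 \<le> K"
  shows "((\<lambda>\<theta>. \<integral>u. g u * min 1 (K * u / \<theta>) \<partial>m) \<longlongrightarrow> 0) at_top"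
proof -
  have gm[measurable]: "g \<in> borel_measurable m" using g by (rule borel_measurable_integrable)
  have min_m: "(\<lambda>u. min 1 (K * u / \<theta>)) \<in> borel_measurable m" for \<theta> :: real
    by (rule measurable_m) measurable
  have "((\<lambda>\<theta>. \<integral>u. g u * min 1 (K * u / \<theta>) \<partial>m) \<longlongrightarrow> (\<integral>u. 0 \<partial>m)) at_top"
  proof (rule integral_dominated_convergence_at_top[where w = g])
    show "(\<lambda>u. g u * min 1 (K * u / \<theta>)) \<in> borel_measurable m" for \<theta> :: real
      by (intro borel_measurable_times gm min_m)
    show "eventually (\<lambda>\<theta>. AE u in m. norm (g u * min 1 (K * u / \<theta>)) \<le> g u) at_top"
      using eventually_gt_at_top[of 0]
    proof eventually_elim
      case (elim \<theta>)
      show ?case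
      proof (rule AE_I2)
        fix u assume "u \<in> space m"
        then have u: "0 < u" by (simp add: space_m)
        have "0 \<le> min 1 (K * u / \<theta>)" "min 1 (K * u / \<theta>) \<le> 1" using u K elim by auto
        then show "norm (g u * min 1 (K * u / \<theta>)) \<le> g u"
          using g0[OF u] by (simp add: abs_mult mult_left_le)
      qed
    qed
    show "AE u in m. ((\<lambda>\<theta>. g u * min 1 (K * u / \<theta>)) \<longlongrightarrow> 0) at_top"
    proof (rule AE_I2)
      fix u
      have "((\<lambda>\<theta>. K * u / \<theta>) \<longlongrightarrow> 0) at_top"
        by (intro tendsto_divide_0[OF tendsto_const] filterlim_at_top_imp_at_infinity filterlim_ident)
      from tendsto_min[OF tendsto_const[of 1] this]
      have "((\<lambda>\<theta>. g u * min 1 (K * u / \<theta>)) \<longlongrightarrow> g u * min 1 0) at_top" by (intro tendsto_mult tendsto_const)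
      then show "((\<lambda>\<theta>. g u * min 1 (K * u / \<theta>)) \<longlongrightarrow> 0) at_top" by simp
    qed
  qed (use g in simp_all)
  then show ?thesis by simp
qed

text \<open>With \<open>y = x / \<theta> * u\<close> one has
  \<open>\<theta>\<^sup>2 * y\<^sup>2 = x\<^sup>2 * u\<^sup>2\<close>: the scaling is absorbed
  exactly by the quadratic term, and the remainder is a tail moment. The second claim supplies the
  common lower bound of the mechanisms.\<close>

lemma branching_jump_integral:
  assumes sq: "integrable m (\<lambda>u. u\<^sup>2)" and \<theta>: "0 < \<theta>" and x: "0 \<le> x" "x \<le> K"
  shows "\<bar>\<theta>\<^sup>2 * (\<integral>u. (exp (- (x / \<theta>) * u) - 1 + (x / \<theta>) * u) \<partial>m) - x\<^sup>2 * (1 / 2 * (\<integral>u. u\<^sup>2 \<partial>m))\<bar>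
    \<le> K\<^sup>2 * (\<integral>u. u\<^sup>2 * min 1 (K * u / \<theta>) \<partial>m)"
    and "0 \<le> (\<integral>u. (exp (- (x / \<theta>) * u) - 1 + (x / \<theta>) * u) \<partial>m)"
proof -
  let ?e = "\<lambda>u. exp (- (x / \<theta>) * u) - 1 + (x / \<theta>) * u"
  have em: "?e \<in> borel_measurable m" by (rule measurable_m) measurable
  have y0: "0 \<le> x / \<theta> * u" if "0 < u" for u using x \<theta> that by simp
  have e0: "0 \<le> ?e u" for u using exp_ge_add_one_self[of "- (x / \<theta>) * u"] by linarith
  have int_e: "integrable m ?e"
  proof (rule Bochner_Integration.integrable_bound[OF integrable_mult_right[OF sq, of "(x / \<theta>)\<^sup>2"] em AE_I2])
    fix u assume "u \<in> space m"
    then have u: "0 < u" by (simp add: space_m)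
    have "?e u \<le> (x / \<theta> * u)\<^sup>2 / 2" using exp_neg_le_quadratic[OF y0[OF u]] by simp
    also have "\<dots> \<le> (x / \<theta> * u)\<^sup>2" by simp
    also have "\<dots> = (x / \<theta>)\<^sup>2 * u\<^sup>2" by (rule power_mult_distrib)
    finally show "norm (?e u) \<le> norm ((x / \<theta>)\<^sup>2 * u\<^sup>2)" using e0[of u] by simp
  qed
  have int_t: "integrable m (\<lambda>u. u\<^sup>2 * min 1 (K * u / \<theta>))"
  proof (rule Bochner_Integration.integrable_bound[OF sq _ AE_I2])
    show "(\<lambda>u. u\<^sup>2 * min 1 (K * u / \<theta>)) \<in> borel_measurable m" by (rule measurable_m) measurable
    fix u assume "u \<in> space m"
    then have "0 \<le> min 1 (K * u / \<theta>)" "min 1 (K * u / \<theta>) \<le> 1" using x \<theta> by (auto simp: space_m)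
    then show "norm (u\<^sup>2 * min 1 (K * u / \<theta>)) \<le> norm (u\<^sup>2)" by (simp add: abs_mult mult_left_le)
  qed
  have "\<theta>\<^sup>2 * (\<integral>u. ?e u \<partial>m) - x\<^sup>2 * (1 / 2 * (\<integral>u. u\<^sup>2 \<partial>m)) = (\<integral>u. \<theta>\<^sup>2 * ?e u - x\<^sup>2 / 2 * u\<^sup>2 \<partial>m)"
    using int_e sq by simp
  note eq = this
  have "\<bar>(\<integral>u. \<theta>\<^sup>2 * ?e u - x\<^sup>2 / 2 * u\<^sup>2 \<partial>m)\<bar> \<le> (\<integral>u. K\<^sup>2 * (u\<^sup>2 * min 1 (K * u / \<theta>)) \<partial>m)"
  proof (rule order_trans[OF integral_abs_bound integral_mono])
    show "integrable m (\<lambda>u. \<bar>\<theta>\<^sup>2 * ?e u - x\<^sup>2 / 2 * u\<^sup>2\<bar>)"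
      by (intro integrable_abs Bochner_Integration.integrable_diff integrable_mult_right int_e sq)
    show "integrable m (\<lambda>u. K\<^sup>2 * (u\<^sup>2 * min 1 (K * u / \<theta>)))"
      by (intro integrable_mult_right int_t)
    fix u assume "u \<in> space m"
    then have u: "0 < u" by (simp add: space_m)
    define y where "y = x / \<theta> * u"
    have y: "0 \<le> y" using y0[OF u] by (simp add: y_def)
    have \<theta>y: "\<theta>\<^sup>2 * y\<^sup>2 = x\<^sup>2 * u\<^sup>2" using \<theta> by (simp add: y_def power_mult_distrib power_divide)
    have "\<theta>\<^sup>2 * ?e u - x\<^sup>2 / 2 * u\<^sup>2 = \<theta>\<^sup>2 * ((exp (- y) - 1 + y) - y\<^sup>2 / 2)"
      unfolding right_diff_distrib times_divide_eq_right \<theta>y by (simp add: y_def right_diff_distrib)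
    also have "\<bar>\<dots>\<bar> \<le> \<theta>\<^sup>2 * (y\<^sup>2 * min 1 y)"
      unfolding abs_mult by (intro mult_mono branching_jump_remainder[OF y]) simp_all
    also have "\<dots> = x\<^sup>2 * u\<^sup>2 * min 1 y" by (simp only: mult.assoc[symmetric] \<theta>y)
    also have "\<dots> \<le> K\<^sup>2 * u\<^sup>2 * min 1 (K * u / \<theta>)"
    proof (intro mult_mono min_1_mono power_mono)
      show "y \<le> K * u / \<theta>" using x u \<theta> by (simp add: y_def divide_right_mono mult_right_mono)
    qed (use x y u in auto)
    finally show "\<bar>\<theta>\<^sup>2 * ?e u - x\<^sup>2 / 2 * u\<^sup>2\<bar> \<le> K\<^sup>2 * (u\<^sup>2 * min 1 (K * u / \<theta>))" by (simp only: mult.assoc)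
  qed
  then show "\<bar>\<theta>\<^sup>2 * (\<integral>u. ?e u \<partial>m) - x\<^sup>2 * (1 / 2 * (\<integral>u. u\<^sup>2 \<partial>m))\<bar>
    \<le> K\<^sup>2 * (\<integral>u. u\<^sup>2 * min 1 (K * u / \<theta>) \<partial>m)"
    unfolding eq integral_mult_right_zero .
  show "0 \<le> (\<integral>u. ?e u \<partial>m)" using e0 by (intro Bochner_Integration.integral_nonneg) auto
qed

lemma immigration_jump_integrable:
  assumes id: "integrable m (\<lambda>u. u)" and z: "0 \<le> z"
  shows "integrable m (\<lambda>u. 1 - exp (- z * u))"
proof (rule Bochner_Integration.integrable_bound[OF integrable_mult_right[OF id, of z] _ AE_I2])
  show "(\<lambda>u. 1 - exp (- z * u)) \<in> borel_measurable m" by (rule measurable_m) measurable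
  fix u assume "u \<in> space m"
  then have "0 \<le> z * u" using z by (simp add: space_m)
  then have "0 \<le> 1 - exp (- z * u)" "1 - exp (- z * u) \<le> z * u"
    using exp_ge_add_one_self[of "- z * u"] by auto
  then show "norm (1 - exp (- z * u)) \<le> norm (z * u)" using \<open>0 \<le> z * u\<close> by simp
qed

lemma immigration_jump_integral:
  assumes id: "integrable m (\<lambda>u. u)" and \<theta>: "0 < \<theta>" and x: "0 \<le> x" "x \<le> K"
  shows "\<bar>\<theta> * (\<integral>u. (1 - exp (- (x / \<theta>) * u)) \<partial>m) - x * (\<integral>u. u \<partial>m)\<bar> \<le> K * (\<integral>u. u * min 1 (K * u / \<theta>) \<partial>m)"
proof -
  let ?e = "\<lambda>u. 1 - exp (- (x / \<theta>) * u)"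
  have int_e: "integrable m ?e" using x \<theta> by (intro immigration_jump_integrable id) simp
  have int_t: "integrable m (\<lambda>u. u * min 1 (K * u / \<theta>))"
  proof (rule Bochner_Integration.integrable_bound[OF id _ AE_I2])
    show "(\<lambda>u. u * min 1 (K * u / \<theta>)) \<in> borel_measurable m" by (rule measurable_m) measurable
    fix u assume "u \<in> space m"
    then have "0 \<le> min 1 (K * u / \<theta>)" "min 1 (K * u / \<theta>) \<le> 1" using x \<theta> by (auto simp: space_m)
    then show "norm (u * min 1 (K * u / \<theta>)) \<le> norm u" by (simp add: abs_mult mult_left_le)
  qed
  have "\<theta> * (\<integral>u. ?e u \<partial>m) - x * (\<integral>u. u \<partial>m) = (\<integral>u. \<theta> * ?e u - x * u \<partial>m)"
    using int_e id by simp
  note eq = this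
  have "\<bar>(\<integral>u. \<theta> * ?e u - x * u \<partial>m)\<bar> \<le> (\<integral>u. K * (u * min 1 (K * u / \<theta>)) \<partial>m)"
  proof (rule order_trans[OF integral_abs_bound integral_mono])
    show "integrable m (\<lambda>u. \<bar>\<theta> * ?e u - x * u\<bar>)"
      by (intro integrable_abs Bochner_Integration.integrable_diff integrable_mult_right int_e id)
    show "integrable m (\<lambda>u. K * (u * min 1 (K * u / \<theta>)))"
      by (intro integrable_mult_right int_t)
    fix u assume "u \<in> space m"
    then have u: "0 < u" by (simp add: space_m)
    define y where "y = x / \<theta> * u"
    have y: "0 \<le> y" using x \<theta> u by (simp add: y_def)
    have \<theta>y: "\<theta> * y = x * u" using \<theta> by (simp add: y_def)
    have "\<theta> * ?e u - x * u = \<theta> * ((1 - exp (- y)) - y)"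
      unfolding right_diff_distrib \<theta>y by (simp add: y_def right_diff_distrib)
    also have "\<bar>\<dots>\<bar> \<le> \<theta> * (y * min 1 y)"
      unfolding abs_mult using \<theta> by (intro mult_mono immigration_jump_remainder[OF y]) simp_all
    also have "\<dots> = x * u * min 1 y" by (simp only: mult.assoc[symmetric] \<theta>y)
    also have "\<dots> \<le> K * u * min 1 (K * u / \<theta>)"
    proof (intro mult_mono min_1_mono)
      show "y \<le> K * u / \<theta>" using x u \<theta> by (simp add: y_def divide_right_mono mult_right_mono)
    qed (use x y u in auto)
    finally show "\<bar>\<theta> * ?e u - x * u\<bar> \<le> K * (u * min 1 (K * u / \<theta>))" by (simp only: mult.assoc)
  qed
  then show ?thesis unfolding eq integral_mult_right_zero .
qed

text \<open>On the half-line \<open>exp (- z * u)\<close> is Lipschitz in \<open>z\<close> with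
  constant \<open>u\<close>, so the first moment is a Lipschitz constant of the integral. The
  continuity makes the immigration integrable in time along the cumulant.\<close>

lemma continuous_on_immigration_jump_integral:
  assumes id: "integrable m (\<lambda>u. u)"
  shows "continuous_on {0..} (\<lambda>z. \<integral>u. (1 - exp (- z * u)) \<partial>m)"
proof (rule lipschitz_on_continuous_on[OF lipschitz_onI])
  have I0: "0 \<le> (\<integral>u. u \<partial>m)" by (intro integral_nonneg_AE AE_I2) (simp add: space_m)
  then show "0 \<le> (\<integral>u. u \<partial>m)" .
  fix x y :: real assume xy: "x \<in> {0..}" "y \<in> {0..}"
  have ix: "integrable m (\<lambda>u. 1 - exp (- x * u))" and iy: "integrable m (\<lambda>u. 1 - exp (- y * u))"
    using xy by (simp_all only: immigration_jump_integrable[OF id] atLeast_iff)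
  have "(\<integral>u. (1 - exp (- x * u)) \<partial>m) - (\<integral>u. (1 - exp (- y * u)) \<partial>m)
    = (\<integral>u. (1 - exp (- x * u)) - (1 - exp (- y * u)) \<partial>m)"
    by (rule Bochner_Integration.integral_diff[OF ix iy, symmetric])
  also have "\<bar>\<dots>\<bar> \<le> (\<integral>u. \<bar>x - y\<bar> * u \<partial>m)"
  proof (rule order_trans[OF integral_abs_bound integral_mono])
    show "integrable m (\<lambda>u. \<bar>(1 - exp (- x * u)) - (1 - exp (- y * u))\<bar>)"
      by (intro integrable_abs Bochner_Integration.integrable_diff ix iy)
    show "integrable m (\<lambda>u. \<bar>x - y\<bar> * u)" by (intro integrable_mult_right id)
    fix u assume "u \<in> space m"
    then have u: "0 < u" by (simp add: space_m)
    have *: "exp (- a) - exp (- b) \<le> b - a" if "0 \<le> a" "a \<le> b" for a b :: real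
    proof -
      have "exp (- a) - exp (- b) = exp (- a) * (1 - exp (- (b - a)))"
        by (simp add: right_diff_distrib exp_add[symmetric])
      also have "\<dots> \<le> 1 * (b - a)"
      proof (rule mult_mono)
        show "1 - exp (- (b - a)) \<le> b - a" using exp_ge_add_one_self[of "- (b - a)"] by linarith
      qed (use that in auto)
      finally show ?thesis by simp
    qed
    have "\<bar>exp (- (y * u)) - exp (- (x * u))\<bar> \<le> \<bar>x * u - y * u\<bar>"
    proof (cases "x * u \<le> y * u")
      case True
      have "exp (- (y * u)) \<le> exp (- (x * u))" using True by simp
      with *[OF _ True] xy u True show ?thesis by simp
    next
      case False
      then have "y * u \<le> x * u" by simp
      moreover have "exp (- (x * u)) \<le> exp (- (y * u))" using calculation by simp
      ultimately show ?thesis using *[of "y * u" "x * u"] xy u by simp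
    qed
    also have "\<dots> = \<bar>x - y\<bar> * u" using u by (simp add: left_diff_distrib[symmetric] abs_mult)
    finally show "\<bar>(1 - exp (- x * u)) - (1 - exp (- y * u))\<bar> \<le> \<bar>x - y\<bar> * u" by simp
  qed
  finally show "dist (\<integral>u. (1 - exp (- x * u)) \<partial>m) (\<integral>u. (1 - exp (- y * u)) \<partial>m) \<le> (\<integral>u. u \<partial>m) * dist x y"
    by (simp add: dist_real_def mult.commute)
qed

end

theorem corollary2p13:
  fixes M :: "real \<Rightarrow> 'a measure" and Y\<theta> :: "real \<Rightarrow> real \<Rightarrow> 'a \<Rightarrow> real"
    and N :: "'b measure" and Y :: "real \<Rightarrow> 'b \<Rightarrow> real"
    and \<alpha>\<theta> \<beta>\<theta> b\<theta> :: "real \<Rightarrow> real" and \<alpha> \<beta> b :: real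
    and n p :: "real measure"
  assumes n_sets: "sets n = sets (restrict_space borel {0<..})"
    and p_sets: "sets p = sets (restrict_space borel {0<..})"
    and n_moment: "(\<integral>\<^sup>+u. ennreal u \<partial>n) < \<infinity>"
    and p_moment: "(\<integral>\<^sup>+u. ennreal (u\<^sup>2) \<partial>p) < \<infinity>"
    and \<alpha>\<theta>_nonneg: "\<And>\<theta>. \<theta> > 0 \<Longrightarrow> \<alpha>\<theta> \<theta> \<ge> 0"
    and b\<theta>_nonneg: "\<And>\<theta>. \<theta> > 0 \<Longrightarrow> b\<theta> \<theta> \<ge> 0"
    and Y\<theta>_cbi: "\<And>\<theta>. \<theta> > 0 \<Longrightarrow> cbi_process (M \<theta>)
          (\<lambda>z. - \<beta>\<theta> \<theta> * z + \<alpha>\<theta> \<theta> * z\<^sup>2 + (\<integral>u. (exp (- z * u) - 1 + z * u) \<partial>p))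
          (\<lambda>z. b\<theta> \<theta> * z + (\<integral>u. (1 - exp (- z * u)) \<partial>n))
          (Y\<theta> \<theta>)"
    and Y_cbi: "cbi_process N
          (\<lambda>z. - \<beta> * z + (\<alpha> + 1 / 2 * (\<integral>u. u\<^sup>2 \<partial>p)) * z\<^sup>2)
          (\<lambda>z. (b + (\<integral>u. u \<partial>n)) * z)
          Y"
    and \<alpha>\<theta>_lim: "(\<alpha>\<theta> \<longlongrightarrow> \<alpha>) at_top"
    and b\<theta>_lim: "(b\<theta> \<longlongrightarrow> b) at_top"
    and \<beta>\<theta>_lim: "((\<lambda>\<theta>. \<theta> * \<beta>\<theta> \<theta>) \<longlongrightarrow> \<beta>) at_top"
    and init: "converges_in_distribution (top_of_set {0..}) M (\<lambda>\<theta> \<omega>. Y\<theta> \<theta> 0 \<omega> / \<theta>) N (Y 0) at_top"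
  shows "converges_in_distribution skorokhod_topology
           M (\<lambda>\<theta> \<omega>. \<lambda>t\<in>{0..}. Y\<theta> \<theta> (\<theta> * t) \<omega> / \<theta>)
           N (\<lambda>\<omega>. \<lambda>t\<in>{0..}. Y t \<omega>) at_top"
proof -
  interpret n: jump_measure n by unfold_locales (rule n_sets)
  interpret p: jump_measure p by unfold_locales (rule p_sets)
  have idm: "(\<lambda>u. u) \<in> borel_measurable n" by (rule n.measurable_m) simp
  \<comment> \<open>Integrability has to be derived from the moment hypothesis, as a Bochner
    integral defaults to 0 without it.\<close>
  have int_n: "integrable n (\<lambda>u. u)"
    by (rule integrableI_nonneg[OF idm _ n_moment]) (intro AE_I2, simp add: n.space_m)
  have sqm: "(\<lambda>u. u\<^sup>2) \<in> borel_measurable p" by (rule p.measurable_m) simp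
  have int_p: "integrable p (\<lambda>u. u\<^sup>2)"
    by (rule integrableI_nonneg[OF sqm _ p_moment]) (intro AE_I2, simp)
  define R\<theta> where "R\<theta> \<theta> = (\<lambda>z. - \<beta>\<theta> \<theta> * z + \<alpha>\<theta> \<theta> * z\<^sup>2 + (\<integral>u. (exp (- z * u) - 1 + z * u) \<partial>p))" for \<theta>
  define F\<theta> where "F\<theta> \<theta> = (\<lambda>z. b\<theta> \<theta> * z + (\<integral>u. (1 - exp (- z * u)) \<partial>n))" for \<theta>
  define R where "R \<theta> = (\<lambda>z. \<theta>\<^sup>2 * R\<theta> \<theta> (z / \<theta>))" for \<theta>
  define F where "F \<theta> = (\<lambda>z. \<theta> * F\<theta> \<theta> (z / \<theta>))" for \<theta>
  define m1 where "m1 = (\<integral>u. u \<partial>n)"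
  define m2 where "m2 = (\<integral>u. u\<^sup>2 \<partial>p)"
  define A where "A = \<alpha> + 1 / 2 * m2"
  define C where "C = b + m1"
  define X where "X \<theta> = (\<lambda>t \<omega>. Y\<theta> \<theta> (\<theta> * t) \<omega> / \<theta>)" for \<theta>
  define good where "good \<theta> G V \<longleftrightarrow>
      laplace_markov (M \<theta>) G (X \<theta>) V (integrated_immigration (F \<theta>) V) \<and>
      (\<forall>z\<ge>0. solves_cumulant_ode (R \<theta>) z (\<lambda>t. V t z))" for \<theta> G V
  have "\<exists>G V. 0 < \<theta> \<longrightarrow> good \<theta> G V" for \<theta>
  proof (cases "0 < \<theta>")
    case True
    have cbi: "cbi_process (M \<theta>) (R\<theta> \<theta>) (F\<theta> \<theta>) (Y\<theta> \<theta>)"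
      unfolding R\<theta>_def F\<theta>_def by (rule Y\<theta>_cbi[OF True])
    obtain G V
      where "laplace_markov (M \<theta>) G (\<lambda>t \<omega>. Y\<theta> \<theta> (\<theta> * t) \<omega> / \<theta>) V
          (integrated_immigration (\<lambda>z. \<theta> * F\<theta> \<theta> (z / \<theta>)) V)"
        "\<And>z. 0 \<le> z \<Longrightarrow> solves_cumulant_ode (\<lambda>z. \<theta>\<^sup>2 * R\<theta> \<theta> (z / \<theta>)) z (\<lambda>t. V t z)"
      by (rule cbi_process_laplace_markov[OF cbi True]) (rule that)
    then have "good \<theta> G V" unfolding good_def X_def F_def R_def by blast
    then show ?thesis by blast
  qed simp
  note good_ex = this
  \<comment> \<open>Filtration and cumulant are chosen one after the other, the second relative to
    the first; for \<theta> at most 0 the choice is arbitrary.\<close>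
  define G where "G \<theta> = (SOME G. \<exists>V. good \<theta> G V)" for \<theta>
  define v where "v \<theta> = (SOME V. good \<theta> (G \<theta>) V)" for \<theta>
  have "good \<theta> (G \<theta>) (v \<theta>)" if "0 < \<theta>" for \<theta>
  proof -
    have "\<exists>G V. good \<theta> G V" using good_ex[of \<theta>] that by simp
    then have "\<exists>V. good \<theta> (G \<theta>) V" unfolding G_def by (rule someI_ex)
    then show ?thesis unfolding v_def by (rule someI_ex)
  qed
  then have lm: "laplace_markov (M \<theta>) (G \<theta>) (X \<theta>) (v \<theta>) (integrated_immigration (F \<theta>) (v \<theta>))"
    and ode: "\<forall>z\<ge>0. solves_cumulant_ode (R \<theta>) z (\<lambda>t. v \<theta> t z)" if "0 < \<theta>" for \<theta>
    using that unfolding good_def by blast+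
  have cbi0: "cbi_process N (\<lambda>x. - \<beta> * x + A * x\<^sup>2) (\<lambda>x. C * x) Y"
    using Y_cbi by (simp only: A_def C_def m1_def m2_def)
  \<comment> \<open>The limit process is the case of scaling parameter 1.\<close>
  obtain H w where "laplace_markov N H (\<lambda>t \<omega>. Y (1 * t) \<omega> / 1) w (integrated_immigration (\<lambda>x. 1 * (C * (x / 1))) w)"
    and "\<And>z. 0 \<le> z \<Longrightarrow> solves_cumulant_ode (\<lambda>x. 1\<^sup>2 * (- \<beta> * (x / 1) + A * (x / 1)\<^sup>2)) z (\<lambda>t. w t z)"
    by (rule cbi_process_laplace_markov[OF cbi0 zero_less_one]) (rule that)
  then have N: "laplace_markov N H Y w (integrated_immigration (\<lambda>x. C * x) w)"
    and ode0: "\<And>z. 0 \<le> z \<Longrightarrow> solves_cumulant_ode (\<lambda>x. - \<beta> * x + A * x\<^sup>2) z (\<lambda>t. w t z)"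
    by (simp_all only: mult_1 div_by_1 power_one)
  have pos: "eventually (\<lambda>\<theta> :: real. 0 < \<theta>) at_top" by (rule eventually_gt_at_top)
  have R_eq: "R \<theta> x = - (\<theta> * \<beta>\<theta> \<theta>) * x + \<alpha>\<theta> \<theta> * x\<^sup>2
      + \<theta>\<^sup>2 * (\<integral>u. (exp (- (x / \<theta>) * u) - 1 + (x / \<theta>) * u) \<partial>p)" if "0 < \<theta>" for \<theta> x
  proof -
    have "\<theta>\<^sup>2 * (- \<beta>\<theta> \<theta> * (x / \<theta>)) = - (\<theta> * \<beta>\<theta> \<theta>) * x"
      "\<theta>\<^sup>2 * (\<alpha>\<theta> \<theta> * (x / \<theta>)\<^sup>2) = \<alpha>\<theta> \<theta> * x\<^sup>2"
      using that by (simp_all add: power2_eq_square)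
    then show ?thesis unfolding R_def R\<theta>_def distrib_left by (simp only:)
  qed
  have F_eq: "F \<theta> x = b\<theta> \<theta> * x + \<theta> * (\<integral>u. (1 - exp (- (x / \<theta>) * u)) \<partial>n)" if "0 < \<theta>" for \<theta> x
    using that by (simp add: F_def F\<theta>_def distrib_left)
  have \<alpha>0: "0 \<le> \<alpha>"
    by (rule tendsto_lowerbound[OF \<alpha>\<theta>_lim eventually_mono[OF pos]]) (auto intro: \<alpha>\<theta>_nonneg)
  have m20: "0 \<le> m2" unfolding m2_def by (rule Bochner_Integration.integral_nonneg) simp
  \<comment> \<open>The constant \<open>\<bar>\<beta>\<bar> + 1\<close> eventually exceeds
    \<open>\<theta> * \<beta>\<theta> \<theta>\<close>; the quadratic and the jump term of
    \<open>R \<theta>\<close> are nonnegative, so it gives the linear lower bound.\<close>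
  interpret cumulant_limit R F v w A "- \<beta>" C "\<bar>\<beta>\<bar> + 1" at_top
  proof
    show "eventually (\<lambda>\<theta>. \<forall>z\<ge>0. solves_cumulant_ode (R \<theta>) z (\<lambda>t. v \<theta> t z)) at_top"
      using pos by (rule eventually_mono) (rule ode)
    show "solves_cumulant_ode (\<lambda>x. - \<beta> * x + A * x\<^sup>2) z (\<lambda>t. w t z)" if "0 \<le> z" for z
      by (rule ode0[OF that])
    have "eventually (\<lambda>\<theta>. dist (\<theta> * \<beta>\<theta> \<theta>) \<beta> < 1) at_top" by (rule tendstoD[OF \<beta>\<theta>_lim]) simp
    then show "eventually (\<lambda>\<theta>. \<forall>x\<ge>0. - (\<bar>\<beta>\<bar> + 1) * x \<le> R \<theta> x) at_top"
      using pos
    proof eventually_elim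
      case (elim \<theta>)
      show ?case
      proof (intro allI impI)
        fix x :: real assume x: "0 \<le> x"
        define J where "J = \<theta>\<^sup>2 * (\<integral>u. (exp (- (x / \<theta>) * u) - 1 + (x / \<theta>) * u) \<partial>p)"
        have "\<theta> * \<beta>\<theta> \<theta> \<le> \<bar>\<beta>\<bar> + 1" using elim(1) unfolding dist_real_def by linarith
        then have "\<theta> * \<beta>\<theta> \<theta> * x \<le> (\<bar>\<beta>\<bar> + 1) * x" by (rule mult_right_mono[OF _ x])
        moreover have "0 \<le> \<alpha>\<theta> \<theta> * x\<^sup>2" using \<alpha>\<theta>_nonneg[OF elim(2)] by simp
        moreover have "0 \<le> J" unfolding J_def
          by (intro mult_nonneg_nonneg p.branching_jump_integral(2)[OF int_p elim(2) x order_refl]) simp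
        ultimately show "- (\<bar>\<beta>\<bar> + 1) * x \<le> R \<theta> x"
          unfolding R_eq[OF elim(2)] J_def[symmetric] unfolding mult_minus_left by linarith
      qed
    qed
    show "0 \<le> A" using \<alpha>0 m20 by (simp add: A_def)
    show "0 \<le> \<bar>\<beta>\<bar> + 1" "- (\<bar>\<beta>\<bar> + 1) \<le> - \<beta>" by linarith+
    show "eventually (\<lambda>\<theta>. \<forall>x\<in>{0..K}. \<bar>R \<theta> x - (- \<beta> * x + A * x\<^sup>2)\<bar> \<le> e) at_top" if e: "0 < e" for K e :: real
    proof (cases "0 \<le> K")
      case K: True
      \<comment> \<open>The summands bound the errors of the linear, the quadratic and the jump
        term, each uniformly for \<open>x\<close> in \<open>[0,K]\<close>.\<close>
      have "((\<lambda>\<theta>. \<bar>\<theta> * \<beta>\<theta> \<theta> - \<beta>\<bar> * K + \<bar>\<alpha>\<theta> \<theta> - \<alpha>\<bar> * K\<^sup>2 + K\<^sup>2 * (\<integral>u. u\<^sup>2 * min 1 (K * u / \<theta>) \<partial>p))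
        \<longlongrightarrow> \<bar>\<beta> - \<beta>\<bar> * K + \<bar>\<alpha> - \<alpha>\<bar> * K\<^sup>2 + K\<^sup>2 * 0) at_top"
        by (intro tendsto_intros \<beta>\<theta>_lim \<alpha>\<theta>_lim p.tail_moment_tendsto int_p K) simp
      then have "eventually (\<lambda>\<theta>. \<bar>\<theta> * \<beta>\<theta> \<theta> - \<beta>\<bar> * K + \<bar>\<alpha>\<theta> \<theta> - \<alpha>\<bar> * K\<^sup>2 + K\<^sup>2 * (\<integral>u. u\<^sup>2 * min 1 (K * u / \<theta>) \<partial>p) < e) at_top"
        by (rule order_tendstoD) (use e in simp)
      then show ?thesis using pos
      proof eventually_elim
        case (elim \<theta>)
        show ?case
        proof
          fix x assume "x \<in> {0..K}"
          then have x: "0 \<le> x" "x \<le> K" by auto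
          define J where "J = \<theta>\<^sup>2 * (\<integral>u. (exp (- (x / \<theta>) * u) - 1 + (x / \<theta>) * u) \<partial>p)"
          have "R \<theta> x - (- \<beta> * x + A * x\<^sup>2) = - ((\<theta> * \<beta>\<theta> \<theta> - \<beta>) * x) + (\<alpha>\<theta> \<theta> - \<alpha>) * x\<^sup>2 + (J - x\<^sup>2 * (1 / 2 * m2))"
            unfolding R_eq[OF elim(2)] A_def J_def[symmetric] by (simp add: algebra_simps)
          moreover have "\<bar>(\<theta> * \<beta>\<theta> \<theta> - \<beta>) * x\<bar> \<le> \<bar>\<theta> * \<beta>\<theta> \<theta> - \<beta>\<bar> * K"
            using x by (simp add: abs_mult mult_left_mono)
          moreover have "\<bar>(\<alpha>\<theta> \<theta> - \<alpha>) * x\<^sup>2\<bar> \<le> \<bar>\<alpha>\<theta> \<theta> - \<alpha>\<bar> * K\<^sup>2"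
            using x by (simp add: abs_mult mult_left_mono power_mono)
          moreover have "\<bar>J - x\<^sup>2 * (1 / 2 * m2)\<bar> \<le> K\<^sup>2 * (\<integral>u. u\<^sup>2 * min 1 (K * u / \<theta>) \<partial>p)"
            unfolding J_def m2_def by (rule p.branching_jump_integral(1)[OF int_p elim(2) x])
          ultimately show "\<bar>R \<theta> x - (- \<beta> * x + A * x\<^sup>2)\<bar> \<le> e" using elim(1) by linarith
        qed
      qed
    qed simp
    show "eventually (\<lambda>\<theta>. \<forall>x\<in>{0..K}. \<bar>F \<theta> x - C * x\<bar> \<le> e) at_top" if e: "0 < e" for K e :: real
    proof (cases "0 \<le> K")
      case K: True
      have "((\<lambda>\<theta>. \<bar>b\<theta> \<theta> - b\<bar> * K + K * (\<integral>u. u * min 1 (K * u / \<theta>) \<partial>n)) \<longlongrightarrow> \<bar>b - b\<bar> * K + K * 0) at_top"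
        by (intro tendsto_intros b\<theta>_lim n.tail_moment_tendsto int_n K) simp
      then have "eventually (\<lambda>\<theta>. \<bar>b\<theta> \<theta> - b\<bar> * K + K * (\<integral>u. u * min 1 (K * u / \<theta>) \<partial>n) < e) at_top"
        by (rule order_tendstoD) (use e in simp)
      then show ?thesis using pos
      proof eventually_elim
        case (elim \<theta>)
        show ?case
        proof
          fix x assume "x \<in> {0..K}"
          then have x: "0 \<le> x" "x \<le> K" by auto
          define J where "J = \<theta> * (\<integral>u. (1 - exp (- (x / \<theta>) * u)) \<partial>n)"
          have "F \<theta> x - C * x = (b\<theta> \<theta> - b) * x + (J - x * m1)"
            unfolding F_eq[OF elim(2)] C_def J_def[symmetric] by (simp add: algebra_simps)
          moreover have "\<bar>(b\<theta> \<theta> - b) * x\<bar> \<le> \<bar>b\<theta> \<theta> - b\<bar> * K"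
            using x by (simp add: abs_mult mult_left_mono)
          moreover have "\<bar>J - x * m1\<bar> \<le> K * (\<integral>u. u * min 1 (K * u / \<theta>) \<partial>n)"
            unfolding J_def m1_def by (rule n.immigration_jump_integral[OF int_n elim(2) x])
          ultimately show "\<bar>F \<theta> x - C * x\<bar> \<le> e" using elim(1) by linarith
        qed
      qed
    qed simp
    show "eventually (\<lambda>\<theta>. continuous_on {0..} (F \<theta>)) at_top"
      using pos
    proof (rule eventually_mono)
      fix \<theta> :: real assume \<theta>: "0 < \<theta>"
      have "continuous_on {0..} (\<lambda>x. \<integral>u. (1 - exp (- (x / \<theta>) * u)) \<partial>n)"
        by (rule continuous_on_compose2[OF n.continuous_on_immigration_jump_integral[OF int_n]])
          (use \<theta> in \<open>auto intro!: continuous_intros\<close>)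
      then show "continuous_on {0..} (F \<theta>)"
        unfolding F_def F\<theta>_def by (intro continuous_intros) (use \<theta> in auto)
    qed
  qed
  have "converges_in_distribution skorokhod_topology M (\<lambda>\<theta>. path_of (X \<theta>)) N (path_of Y) at_top"
  proof (rule laplace_markov_converges_in_distribution[OF eventually_mono[OF pos lm] N])
    fix z :: real assume z: "0 \<le> z"
    \<comment> \<open>The initial laws enter through the test functions
      \<open>exp (- z * x)\<close>, bounded on the half-line for \<open>z \<ge> 0\<close>.\<close>
    have "continuous_map (top_of_set {0..}) euclideanreal (\<lambda>x. exp (- z * x))"
      by (auto intro!: continuous_intros)
    moreover have "bounded ((\<lambda>x. exp (- z * x)) ` topspace (top_of_set {0..}))"
      unfolding bounded_iff using z by (auto intro!: exI[of _ 1])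
    ultimately have bounded_cont: "continuous_map (top_of_set {0..}) euclideanreal (\<lambda>x. exp (- z * x)) \<and>
      bounded ((\<lambda>x. exp (- z * x)) ` topspace (top_of_set {0..}))" by (rule conjI)
    have "continuous_map (top_of_set {0..}) euclideanreal f \<and> bounded (f ` topspace (top_of_set {0..})) \<longrightarrow>
        ((\<lambda>\<theta>. \<integral>\<omega>. f (Y\<theta> \<theta> 0 \<omega> / \<theta>) \<partial>M \<theta>) \<longlongrightarrow> (\<integral>\<omega>. f (Y 0 \<omega>) \<partial>N)) at_top" for f :: "real \<Rightarrow> real"
      using init unfolding converges_in_distribution_def by (elim conjE allE)
    from mp[OF this bounded_cont]
    show "((\<lambda>\<theta>. \<integral>\<omega>. exp (- z * X \<theta> 0 \<omega>) \<partial>M \<theta>) \<longlongrightarrow> (\<integral>\<omega>. exp (- z * Y 0 \<omega>) \<partial>N)) at_top"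
      by (simp only: X_def mult_zero_right)
  qed
  then show ?thesis by (simp only: path_of_def X_def)
qed

end
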